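(* The decision version of VEST and the problem Matrix $k$-Product with Repetitions resulting to Zero Matrix are equivalent under parameterized reductions (each reduces to the other).
   Context: An instance of VEST consists of positive integers $d,m,h$, a vector $\mathbf{v}\in\mathbb{Q}^d$, a list $(T_1,\dots,T_m)$ of rational $d\times d$ matrices, $S\in\mathbb{Q}^{h\times d}$, and a parameter $k$; $M_k := |\{(i_1,\dots,i_k)\in\{1,\dots,m\}^k : S T_{i_k}\cdots T_{i_1}\mathbf{v}=\mathbf{0}\}|$, and the decision version asks whether $M_k>0$. Matrix $k$-Product with Repetitions resulting to Zero Matrix: given a list of $d\times d$ rational matrices and a parameter $k$, decide whether one can choose $k$ matrices from the list (possibly with repetitions) whose product is the $d\times d$ zero matrix. A parameterized reduction maps $(x,k)$ in time $f(k)n^c$ to an equivalent $(x',k')$ with $k'\le g(k)$. *)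

theory Defs
  imports "Jordan_Normal_Form.Matrix"
begin

section \<open>Deterministic multitape Turing machines\<close>

text \<open>
  Symbols and states are natural numbers; symbol 0 is the blank.  A machine starts in state 0 and
  halts when it reaches a state that is at least the number of its states.  Tapes are infinite in
  both directions.  Tape 0 holds the input and tape 1 the output.
\<close>

datatype move = Leftwards | Stay | Rightwards

fun shift :: "move \<Rightarrow> int" where
  "shift Leftwards = -1" | "shift Stay = 0" | "shift Rightwards = 1"

record tm =
  ntapes :: nat
  nsyms :: nat
  nstates :: nat
  delta :: "nat \<Rightarrow> nat list \<Rightarrow> nat \<times> (nat \<times> move) list"

text \<open>
  Only the finitely many values of \<^term>\<open>delta M\<close> at states below \<^term>\<open>nstates M\<close> and
  lists of \<^term>\<open>ntapes M\<close> symbols below \<^term>\<open>nsyms M\<close> influence a computation.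
\<close>

definition wf_tm :: "tm \<Rightarrow> bool" where
  "wf_tm M \<longleftrightarrow> ntapes M \<ge> 2 \<and> nsyms M \<ge> 1 \<and>
     (\<forall>q xs. q < nstates M \<and> length xs = ntapes M \<and> set xs \<subseteq> {..<nsyms M} \<longrightarrow>
        fst (delta M q xs) \<le> nstates M \<and>
        length (snd (delta M q xs)) = ntapes M \<and>
        fst ` set (snd (delta M q xs)) \<subseteq> {..<nsyms M})"

text \<open>A tape is given by its contents and the position of its head.\<close>

type_synonym tape = "(int \<Rightarrow> nat) \<times> int"
type_synonym config = "nat \<times> tape list"

definition read :: "tape \<Rightarrow> nat" where
  "read tp = fst tp (snd tp)"

definition act :: "nat \<times> move \<Rightarrow> tape \<Rightarrow> tape" where
  "act a tp = ((fst tp)(snd tp := fst a), snd tp + shift (snd a))"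

definition step :: "tm \<Rightarrow> config \<Rightarrow> config" where
  "step M c =
     (if fst c < nstates M
      then let (q, as) = delta M (fst c) (map read (snd c)) in (q, map2 act as (snd c))
      else c)"

definition written :: "nat list \<Rightarrow> int \<Rightarrow> nat" where
  "written s i = (if 0 \<le> i \<and> i < int (length s) then s ! nat i else 0)"

definition init_config :: "tm \<Rightarrow> nat list \<Rightarrow> config" where
  "init_config M s = (0, (written s, 0) # replicate (ntapes M - 1) (written [], 0))"

text \<open>
  Halting configurations are fixed by \<^const>\<open>step\<close>, so the following says that \<open>M\<close> halts
  on input \<open>s\<close> after at most \<open>t\<close> steps, with exactly \<open>s'\<close> on its output tape.
\<close>

definition computes_within :: "tm \<Rightarrow> nat list \<Rightarrow> nat list \<Rightarrow> nat \<Rightarrow> bool" where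
  "computes_within M s s' t \<longleftrightarrow>
     set s \<union> set s' \<subseteq> {0<..<nsyms M} \<and>
     (let c = (step M ^^ t) (init_config M s)
      in fst c \<ge> nstates M \<and> fst (snd c ! 1) = written s')"


section \<open>Encodings\<close>

text \<open>The symbols 1 and 2 are the binary digits; \<open>sym_one\<close> is also the unary digit.\<close>

abbreviation (input) sym_zero :: nat where "sym_zero \<equiv> 1"
abbreviation (input) sym_one :: nat where "sym_one \<equiv> 2"
abbreviation (input) sym_minus :: nat where "sym_minus \<equiv> 3"
abbreviation (input) sym_slash :: nat where "sym_slash \<equiv> 4"
abbreviation (input) end_entry :: nat where "end_entry \<equiv> 5"
abbreviation (input) end_vec :: nat where "end_vec \<equiv> 6"
abbreviation (input) end_mat :: nat where "end_mat \<equiv> 7"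
abbreviation (input) end_list :: nat where "end_list \<equiv> 8"
abbreviation (input) end_unary :: nat where "end_unary \<equiv> 9"

definition enc_unary :: "nat \<Rightarrow> nat list" where
  "enc_unary n = replicate n sym_one @ [end_unary]"

text \<open>Most significant digit first, without leading zeros.\<close>

fun enc_binary :: "nat \<Rightarrow> nat list" where
  "enc_binary n =
     (if n < 2 then [] else enc_binary (n div 2)) @ [if even n then sym_zero else sym_one]"

declare enc_binary.simps [simp del]

definition enc_rat :: "rat \<Rightarrow> nat list" where
  "enc_rat r =
     (let (p, q) = quotient_of r
      in (if p < 0 then [sym_minus] else []) @ enc_binary (nat \<bar>p\<bar>) @ [sym_slash] @
         enc_binary (nat q) @ [end_entry])"

definition enc_vec :: "rat vec \<Rightarrow> nat list" where
  "enc_vec v = concat (map enc_rat (list_of_vec v)) @ [end_vec]"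

definition enc_mat :: "rat mat \<Rightarrow> nat list" where
  "enc_mat A = concat (map enc_vec (rows A)) @ [end_mat]"

definition enc_mats :: "rat mat list \<Rightarrow> nat list" where
  "enc_mats As = concat (map enc_mat As) @ [end_list]"


section \<open>Parameterized problems and reductions\<close>

text \<open>
  An instance of a parameterized problem is a pair of some \<open>x\<close> with \<open>instance_of P x\<close> and a
  parameter \<open>k\<close>, represented by a string in which \<open>k\<close> is written in unary.
\<close>

record 'x problem =
  instance_of :: "'x \<Rightarrow> bool"
  encode :: "'x \<Rightarrow> nat list"
  yes :: "'x \<Rightarrow> nat \<Rightarrow> bool"

definition encode_pair :: "'x problem \<Rightarrow> 'x \<Rightarrow> nat \<Rightarrow> nat list" where
  "encode_pair P x k = enc_unary k @ encode P x"

definition computable :: "(nat \<Rightarrow> nat) \<Rightarrow> bool" where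
  "computable f \<longleftrightarrow>
     (\<exists>M. wf_tm M \<and> (\<forall>n. \<exists>t. computes_within M (enc_unary n) (enc_unary (f n)) t))"

definition fpt_reducible :: "'x problem \<Rightarrow> 'y problem \<Rightarrow> bool" where
  "fpt_reducible P Q \<longleftrightarrow>
     (\<exists>M f g c. wf_tm M \<and> computable f \<and> computable g \<and>
        (\<forall>x k. instance_of P x \<longrightarrow>
           (\<exists>x' k'. instance_of Q x' \<and>
              computes_within M (encode_pair P x k) (encode_pair Q x' k')
                (f k * length (encode_pair P x k) ^ c) \<and>
              (yes P x k \<longleftrightarrow> yes Q x' k') \<and>
              k' \<le> g k)))"


section \<open>The two problems\<close>

definition mat_prod :: "nat \<Rightarrow> rat mat list \<Rightarrow> rat mat" where
  "mat_prod d As = foldr (*) As (1\<^sub>m d)"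

record vest =
  vest_d :: nat
  vest_h :: nat
  vest_v :: "rat vec"
  vest_T :: "rat mat list"
  vest_S :: "rat mat"

definition vest_instance :: "vest \<Rightarrow> bool" where
  "vest_instance x \<longleftrightarrow>
     vest_d x \<ge> 1 \<and> vest_h x \<ge> 1 \<and> length (vest_T x) \<ge> 1 \<and>
     vest_v x \<in> carrier_vec (vest_d x) \<and>
     set (vest_T x) \<subseteq> carrier_mat (vest_d x) (vest_d x) \<and>
     vest_S x \<in> carrier_mat (vest_h x) (vest_d x)"

text \<open>
  The number \<open>M\<^sub>k\<close>, with indices counted from 0.  The list is reversed because the first chosen
  matrix is the rightmost factor.
\<close>

definition vest_count :: "vest \<Rightarrow> nat \<Rightarrow> nat" where
  "vest_count x k =
     card {is. length is = k \<and> set is \<subseteq> {..<length (vest_T x)} \<and>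
       (vest_S x * mat_prod (vest_d x) (rev (map (\<lambda>i. vest_T x ! i) is))) *\<^sub>v vest_v x
         = 0\<^sub>v (vest_h x)}"

text \<open>
  The numbers \<open>d\<close>, \<open>h\<close> and the length of \<open>T\<close> can be read off the delimiters, so they are not
  written separately.
\<close>

definition VEST :: "vest problem" where
  "VEST = \<lparr>
     instance_of = vest_instance,
     encode = (\<lambda>x. enc_vec (vest_v x) @ enc_mats (vest_T x) @ enc_mat (vest_S x)),
     yes = (\<lambda>x k. vest_count x k > 0)\<rparr>"

text \<open>
  An instance is a dimension together with a list of matrices.  The dimension is part of the
  encoding because an empty list does not determine it.
\<close>

definition ZERO_PRODUCT :: "(nat \<times> rat mat list) problem" where
  "ZERO_PRODUCT = \<lparr>
     instance_of = (\<lambda>(d, As). d \<ge> 1 \<and> set As \<subseteq> carrier_mat d d),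
     encode = (\<lambda>(d, As). enc_unary d @ enc_mats As),
     yes = (\<lambda>(d, As) k.
       \<exists>Bs. length Bs = k \<and> set Bs \<subseteq> set As \<and> mat_prod d Bs = 0\<^sub>m d d)\<rparr>"

end

theory Submission
  imports Defs
begin

text \<open>
  From an instance of VEST to a product of \<open>k + 2\<close> matrices: \<open>v\<close> and \<open>S\<close> are combined into one
  separator matrix \<open>P\<close>, which maps a start coordinate to \<open>v\<close> and applies \<open>S\<close>, so that
  \<open>P T\<^sub>1 \<cdots> T\<^sub>k P\<close> contains the column \<open>S T\<^sub>1 \<cdots> T\<^sub>k v\<close>.  Two additional coordinates
  make every product vanish only if it has this shape: there the \<open>T\<^sub>i\<close> act as \<open>diag(1, 2)\<close> and
  \<open>P\<close> has rank one with image \<open>(- (2 ^ k), 1)\<close> and kernel \<open>(1, - 1)\<close>.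

  From a list of matrices to VEST: a product \<open>M\<close> of \<open>k\<close> of them has, after multiplication by a common
  denominator, integer entries smaller than \<open>2 ^ g\<close>, where \<open>g\<close> is polynomial in the length of the
  input.  Hence \<open>M = 0\<close> iff \<open>M v = 0\<close> for the single vector \<open>v\<close> with entries \<open>2 ^ (e + j g)\<close>.
  The identity matrix is added to the list because VEST requires at least one matrix.

  Both transductions are written in a small while language that compiles to Turing machines.
\<close>

section \<open>While programs as Turing machines\<close>

text \<open>In VEST the positions of \<open>v\<close> and \<open>S\<close> are fixed, whereas in a
  product every listed matrix may occur anywhere, so a product might vanish for an unintended
  reason. The two additional coordinates count: a separator leaves them proportional to
  \<open>(- (2 ^ k), 1)\<close>, each \<open>T\<close> doubles the second one, and the next
  separator, which forms their sum, yields 0 only after exactly \<open>k\<close> such factors. Two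
  separators with \<open>k\<close> factors between them already fill all \<open>k + 2\<close>
  positions, so no other word can vanish. As the parameter is given in unary, the
  \<open>k + 1\<close> binary digits of \<open>2 ^ k\<close> are written without arithmetic. In the
  other direction the entries of one row of \<open>M\<close>, scaled to integers, become digits in
  base \<open>2 ^ g\<close>, and digits smaller than the base in absolute value cannot cancel. A
  crude bound on the entries is enough, so \<open>g\<close> is chosen for the convenience of the
  machine: \<open>g = 2 (k + 1) n\<close>, with \<open>n\<close> the input length, results from
  nested loops over tapes that are already there.\<close>

datatype prog =
    Act "nat list \<Rightarrow> (nat \<times> move) list"
  | Seq prog prog (infixr ";;" 55)
  | Cond "nat list \<Rightarrow> bool" prog prog
  | While "nat list \<Rightarrow> bool" prog

fun psize :: "prog \<Rightarrow> nat" where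
  "psize (Act f) = 1"
| "psize (p ;; q) = psize p + psize q"
| "psize (Cond b p q) = Suc (psize p + psize q)"
| "psize (While b p) = Suc (psize p)"

definition stay :: "nat list \<Rightarrow> (nat \<times> move) list" where
  "stay xs = map (\<lambda>x. (x, Stay)) xs"

text \<open>\<open>code p s e\<close> is the transition function of \<open>p\<close> when its states start at \<open>s\<close>
  and \<open>e\<close> is the state to be entered on termination.\<close>

fun code :: "prog \<Rightarrow> nat \<Rightarrow> nat \<Rightarrow> nat \<Rightarrow> nat list \<Rightarrow> nat \<times> (nat \<times> move) list" where
  "code (Act f) s e q xs = (e, f xs)"
| "code (p ;; p') s e q xs =
     (if q < s + psize p then code p s (s + psize p) q xs else code p' (s + psize p) e q xs)"
| "code (Cond b p p') s e q xs =
     (if q = s then (if b xs then Suc s else Suc (s + psize p), stay xs)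
      else if q < Suc (s + psize p) then code p (Suc s) e q xs
      else code p' (Suc (s + psize p)) e q xs)"
| "code (While b p) s e q xs =
     (if q = s then (if b xs then Suc s else e, stay xs) else code p (Suc s) s q xs)"

fun wf_prog :: "nat \<Rightarrow> nat \<Rightarrow> prog \<Rightarrow> bool" where
  "wf_prog n m (Act f) \<longleftrightarrow> (\<forall>xs. length xs = n \<and> set xs \<subseteq> {..<m} \<longrightarrow>
     length (f xs) = n \<and> fst ` set (f xs) \<subseteq> {..<m})"
| "wf_prog n m (p ;; q) \<longleftrightarrow> wf_prog n m p \<and> wf_prog n m q"
| "wf_prog n m (Cond b p q) \<longleftrightarrow> wf_prog n m p \<and> wf_prog n m q"
| "wf_prog n m (While b p) \<longleftrightarrow> wf_prog n m p"

definition tm_of :: "nat \<Rightarrow> nat \<Rightarrow> prog \<Rightarrow> tm" where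
  "tm_of n m p = \<lparr>ntapes = n, nsyms = m, nstates = psize p, delta = code p 0 (psize p)\<rparr>"

lemma psize_pos: "psize p > 0"
  by (induction p) auto

text \<open>The exit state \<open>e\<close> may lie outside the interval of states of
  \<open>p\<close>; this is what lets the induction pass through sequences and loops. For a whole
  program \<open>e\<close> is the halting state \<open>psize p\<close>.\<close>

lemma code_wf:
  assumes "wf_prog n m p" "s \<le> q" "q < s + psize p" "length xs = n" "set xs \<subseteq> {..<m}"
  shows "fst (code p s e q xs) \<in> {s..s + psize p} \<union> {e} \<and> length (snd (code p s e q xs)) = n \<and>
    fst ` set (snd (code p s e q xs)) \<subseteq> {..<m}"
  using assms
proof (induction p arbitrary: s e q)
  case (Seq p p')
  show ?case
  proof (cases "q < s + psize p")
    case True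
    then show ?thesis using Seq.IH(1)[of s q "s + psize p"] Seq.prems by auto
  next
    case False
    then show ?thesis using Seq.IH(2)[of "s + psize p" q e] Seq.prems by auto
  qed
next
  case (Cond b p p')
  consider "q = s" | "q \<noteq> s" "q < Suc (s + psize p)" | "\<not> q < Suc (s + psize p)" by linarith
  then show ?case
  proof cases
    case 1
    then show ?thesis using Cond.prems by (auto simp: stay_def)
  next
    case 2
    then show ?thesis using Cond.IH(1)[of "Suc s" q e] Cond.prems by auto
  next
    case 3
    then show ?thesis using Cond.IH(2)[of "Suc (s + psize p)" q e] Cond.prems by auto
  qed
next
  case (While b p)
  show ?case
  proof (cases "q = s")
    case True
    then show ?thesis using While.prems by (auto simp: stay_def)
  next
    case False
    then show ?thesis using While.IH[of "Suc s" q s] While.prems by auto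
  qed
qed auto

lemma wf_tm_of:
  assumes "wf_prog n m p" "n \<ge> 2" "m \<ge> 1"
  shows "wf_tm (tm_of n m p)"
proof -
  have "fst (code p 0 (psize p) q xs) \<le> psize p \<and> length (snd (code p 0 (psize p) q xs)) = n \<and>
    fst ` set (snd (code p 0 (psize p) q xs)) \<subseteq> {..<m}"
    if "q < psize p" "length xs = n" "set xs \<subseteq> {..<m}" for q xs
    using code_wf[OF assms(1), of 0 q xs "psize p"] that by auto
  then show ?thesis using assms(2,3) unfolding wf_tm_def tm_of_def by simp
qed

section \<open>Timed semantics of programs and its simulation by machines\<close>

inductive eval :: "prog \<Rightarrow> tape list \<Rightarrow> tape list \<Rightarrow> nat \<Rightarrow> bool" where
  "eval (Act f) ts (map2 act (f (map read ts)) ts) 1"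
| "eval p ts us t \<Longrightarrow> eval q us vs t' \<Longrightarrow> eval (p ;; q) ts vs (t + t')"
| "b (map read ts) \<Longrightarrow> eval p ts us t \<Longrightarrow> eval (Cond b p q) ts us (Suc t)"
| "\<not> b (map read ts) \<Longrightarrow> eval q ts us t \<Longrightarrow> eval (Cond b p q) ts us (Suc t)"
| "\<not> b (map read ts) \<Longrightarrow> eval (While b p) ts ts 1"
| "b (map read ts) \<Longrightarrow> eval p ts us t \<Longrightarrow> eval (While b p) us vs t' \<Longrightarrow>
     eval (While b p) ts vs (Suc (t + t'))"

lemma act_stay: "map2 act (stay (map read ts)) ts = ts"
  unfolding stay_def by (induction ts) (auto simp: act_def read_def)

text \<open>\<open>M\<close> has to agree with the code of \<open>p\<close> only on the states
  reserved for \<open>p\<close>, so \<open>p\<close> may be a fragment of a larger program, as the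
  induction requires. The exit of a loop body is the state \<open>s\<close> that tests the guard
  again.\<close>

lemma eval_step:
  assumes "eval p ts us t"
    and "s + psize p \<le> nstates M"
    and "\<And>q xs. s \<le> q \<Longrightarrow> q < s + psize p \<Longrightarrow> delta M q xs = code p s e q xs"
  shows "(step M ^^ t) (s, ts) = (e, us)"
  using assms
proof (induction arbitrary: s e rule: eval.induct)
  case (1 f ts)
  then show ?case by (auto simp: step_def)
next
  case (2 p ts us t q vs t')
  have "(step M ^^ t) (s, ts) = (s + psize p, us)"
    by (rule 2(3)) (use 2(5,6) psize_pos in auto)
  moreover have "(step M ^^ t') (s + psize p, us) = (e, vs)"
    by (rule 2(4)) (use 2(5,6) psize_pos in auto)
  ultimately show ?case
    by (simp add: add.commute[of t t'] funpow_add)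
next
  case (3 b ts p us t q)
  have "(step M ^^ t) (Suc s, ts) = (e, us)"
    by (rule 3(3)) (use 3(4,5) in auto)
  moreover have "step M (s, ts) = (Suc s, ts)"
    using 3(1,4,5) by (auto simp: step_def act_stay)
  ultimately show ?case by (simp del: funpow.simps add: funpow_Suc_right)
next
  case (4 b ts q us t p)
  have "(step M ^^ t) (Suc (s + psize p), ts) = (e, us)"
    by (rule 4(3)) (use 4(4,5) in auto)
  moreover have "step M (s, ts) = (Suc (s + psize p), ts)"
    using 4(1,4,5) by (auto simp: step_def act_stay)
  ultimately show ?case by (simp del: funpow.simps add: funpow_Suc_right)
next
  case (5 b ts p)
  then show ?case by (auto simp: step_def act_stay)
next
  case (6 b ts p us t vs t')
  have "(step M ^^ t) (Suc s, ts) = (s, us)"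
    by (rule 6(4)) (use 6(6,7) in auto)
  moreover have "(step M ^^ t') (s, us) = (e, vs)"
    by (rule 6(5)) (use 6(6,7) in auto)
  moreover have "step M (s, ts) = (Suc s, ts)"
    using 6(1,6,7) by (auto simp: step_def act_stay)
  ultimately show ?case
    by (simp del: funpow.simps add: funpow_Suc_right add.commute[of t t'] funpow_add)
qed

text \<open>An upper bound instead of the exact number of steps, which would depend on the branches
  taken.\<close>

definition runs :: "prog \<Rightarrow> tape list \<Rightarrow> tape list \<Rightarrow> nat \<Rightarrow> bool" where
  "runs p ts us C \<longleftrightarrow> (\<exists>t\<le>C. eval p ts us t)"

text \<open>A tape as a zipper: \<open>u\<close> lies to the left of the head and \<open>v\<close>
  begins under it. \<open>Z [] s\<close> is a fresh input tape, and in \<open>Z w []\<close> the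
  head stands on the blank behind \<open>w\<close>, ready to append.\<close>

definition Z :: "nat list \<Rightarrow> nat list \<Rightarrow> tape" where
  "Z u v = (written (u @ v), int (length u))"

text \<open>The program may finish early; the halting configuration is a fixed point of
  \<open>step\<close>, so the remaining steps up to \<open>C'\<close> change nothing.\<close>

lemma computes_within_tm_of:
  assumes run: "runs p (Z [] s # replicate (n - 1) (Z [] [])) us C"
    and out: "us ! 1 = Z s' []" and syms: "set s \<union> set s' \<subseteq> {0<..<m}"
    and le: "C \<le> C'"
  shows "computes_within (tm_of n m p) s s' C'"
proof -
  let ?M = "tm_of n m p"
  obtain t where t: "t \<le> C" "eval p (Z [] s # replicate (n - 1) (Z [] [])) us t"
    using run by (auto simp: runs_def)
  have init: "init_config ?M s = (0, Z [] s # replicate (n - 1) (Z [] []))"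
    by (simp add: init_config_def Z_def tm_of_def)
  have halted: "(step ?M ^^ i) (psize p, us) = (psize p, us)" for i
    by (induction i) (auto simp: step_def tm_of_def)
  have "(step ?M ^^ t) (init_config ?M s) = (psize p, us)"
    unfolding init by (rule eval_step[OF t(2)]) (auto simp: tm_of_def)
  then have "(step ?M ^^ ((C' - t) + t)) (init_config ?M s) = (psize p, us)"
    by (simp only: funpow_add o_apply halted)
  then have "(step ?M ^^ C') (init_config ?M s) = (psize p, us)"
    using t(1) le by simp
  then show ?thesis
    using out syms by (simp add: computes_within_def Let_def tm_of_def Z_def)
qed

lemma runs_mono: "runs p ts us C \<Longrightarrow> C \<le> C' \<Longrightarrow> runs p ts us C'"
  unfolding runs_def by (meson le_trans)

lemma runs_Act: "runs (Act f) ts (map2 act (f (map read ts)) ts) 1"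
  unfolding runs_def using eval.intros(1) by blast

lemma runs_Seq: "runs p ts us C \<Longrightarrow> runs q us vs C' \<Longrightarrow> runs (p ;; q) ts vs (C + C')"
  unfolding runs_def by (meson add_mono eval.intros(2))

lemma runs_CondT: "b (map read ts) \<Longrightarrow> runs p ts us C \<Longrightarrow> runs (Cond b p q) ts us (Suc C)"
  unfolding runs_def by (meson Suc_le_mono eval.intros(3))

lemma runs_CondF: "\<not> b (map read ts) \<Longrightarrow> runs q ts us C \<Longrightarrow> runs (Cond b p q) ts us (Suc C)"
  unfolding runs_def by (meson Suc_le_mono eval.intros(4))

text \<open>Only the first \<open>n\<close> rounds are described, and the rest of the loop is a run
  of its own. This handles loops with several phases, whose rounds before, at and after a marked
  symbol differ.\<close>

lemma runs_While_prefix: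
  fixes n :: nat
  assumes "\<And>i. i < n \<Longrightarrow> b (map read (st i))"
    and "\<And>i. i < n \<Longrightarrow> runs p (st i) (st (Suc i)) B"
    and "runs (While b p) (st n) us C"
  shows "runs (While b p) (st 0) us (n * Suc B + C)"
  using assms
proof (induction n arbitrary: st)
  case (Suc n)
  have "runs (While b p) (st (Suc 0)) us (n * Suc B + C)"
    by (rule Suc.IH[of "\<lambda>i. st (Suc i)"]) (use Suc.prems in auto)
  then obtain t' where t': "t' \<le> n * Suc B + C" "eval (While b p) (st (Suc 0)) us t'"
    by (auto simp: runs_def)
  obtain t where t: "t \<le> B" "eval p (st 0) (st (Suc 0)) t"
    using Suc.prems(2)[of 0] by (auto simp: runs_def)
  have "eval (While b p) (st 0) us (Suc (t + t'))"
    by (rule eval.intros(6)) (use Suc.prems(1)[of 0] t t' in auto)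
  moreover have "Suc (t + t') \<le> Suc n * Suc B + C" using t t' by simp
  ultimately show ?case unfolding runs_def by blast
qed simp

lemma runs_While:
  fixes n :: nat
  assumes "\<And>i. i < n \<Longrightarrow> b (map read (st i))"
    and "\<And>i. i < n \<Longrightarrow> runs p (st i) (st (Suc i)) B"
    and "\<not> b (map read (st n))"
  shows "runs (While b p) (st 0) (st n) (n * Suc B + 1)"
proof (rule runs_While_prefix)
  show "runs (While b p) (st n) (st n) 1"
    using eval.intros(5)[of b "st n" p] assms(3) unfolding runs_def by blast
qed (use assms in auto)

text \<open>Item \<open>x\<close> occupies \<open>f x\<close> on the tape that is read and produces \<open>g x\<close>.\<close>

lemma runs_While_list:
  assumes guard: "\<And>x u v w. x \<in> set xs \<Longrightarrow> b (map read (st u (f x @ v) w))"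
    and body: "\<And>x u v w. x \<in> set xs \<Longrightarrow> runs p (st u (f x @ v) w) (st (u @ f x) v (w @ g x)) B"
    and exit: "\<And>u w. \<not> b (map read (st u v w))"
  shows "runs (While b p) (st u (concat (map f xs) @ v) w)
    (st (u @ concat (map f xs)) v (w @ concat (map g xs))) (length xs * Suc B + 1)"
proof -
  define s where "s i = st (u @ concat (map f (take i xs))) (concat (map f (drop i xs)) @ v)
    (w @ concat (map g (take i xs)))" for i
  have "runs (While b p) (s 0) (s (length xs)) (length xs * Suc B + 1)"
  proof (rule runs_While)
    fix i assume i: "i < length xs"
    have si: "s i = st (u @ concat (map f (take i xs))) (f (xs ! i) @ concat (map f (drop (Suc i) xs)) @ v)
      (w @ concat (map g (take i xs)))"
      unfolding s_def by (simp add: Cons_nth_drop_Suc[OF i, symmetric])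
    have sSi: "s (Suc i) = st ((u @ concat (map f (take i xs))) @ f (xs ! i)) (concat (map f (drop (Suc i) xs)) @ v)
      ((w @ concat (map g (take i xs))) @ g (xs ! i))"
      unfolding s_def by (simp add: take_Suc_conv_app_nth[OF i])
    show "b (map read (s i))" unfolding si by (rule guard) (use i in auto)
    show "runs p (s i) (s (Suc i)) B" unfolding si sSi by (rule body) (use i in auto)
  next
    show "\<not> b (map read (s (length xs)))" unfolding s_def by (simp add: exit)
  qed
  then show ?thesis by (simp add: s_def)
qed

section \<open>Elementary operations on zipper tapes and loops over a tape\<close>

lemma read_Z [simp]: "read (Z u (x # v)) = x" "read (Z u []) = 0"
  by (auto simp: read_def Z_def written_def nth_append)

lemma written_snoc: "(written u)(int (length u) := a) = written (u @ [a])"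
  by (rule ext) (auto simp: written_def nth_append nat_less_iff)

lemma written_update:
  "(written (u @ x # v))(int (length u) := a) = written (u @ a # v)"
  by (rule ext) (auto simp: written_def nth_append nat_less_iff nth_Cons split: nat.splits)

lemma act_right [simp]:
  "act (a, Rightwards) (Z u (x # v)) = Z (u @ [a]) v"
  "act (a, Rightwards) (Z u []) = Z (u @ [a]) []"
  using written_update[of u x v a] written_snoc[of u a] by (auto simp: act_def Z_def)

lemma act_stay_Z [simp]: "act (a, Stay) (Z u (x # v)) = Z u (a # v)"
  using written_update[of u x v a] by (auto simp: act_def Z_def)

text \<open>Only tape \<open>j\<close> acts; the others write back the symbol that they read. The
  action may depend on the symbols of all tapes, which makes copying a symbol between tapes one
  step.\<close>

definition single :: "nat \<Rightarrow> (nat list \<Rightarrow> nat \<times> move) \<Rightarrow> prog" where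
  "single j f = Act (\<lambda>xs. (stay xs)[j := f xs])"

abbreviation "mv j m \<equiv> single j (\<lambda>xs. (xs ! j, m))"
abbreviation "rt j \<equiv> mv j Rightwards"
abbreviation "lf j \<equiv> mv j Leftwards"
abbreviation "put j a \<equiv> single j (\<lambda>xs. (a, Rightwards))"
abbreviation "mark j a \<equiv> single j (\<lambda>xs. (a, Stay))"
abbreviation "cp i j \<equiv> single j (\<lambda>xs. (xs ! i, Rightwards))"

abbreviation "until j a p \<equiv> While (\<lambda>xs. xs ! j \<noteq> a) p"

lemma runs_single:
  assumes "j < length ts" "us = ts[j := act (f (map read ts)) (ts ! j)]"
  shows "runs (single j f) ts us 1"
proof -
  have "map2 act ((stay (map read ts))[j := f (map read ts)]) ts = us"
  proof (rule nth_equalityI)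
    show "length (map2 act ((stay (map read ts))[j := f (map read ts)]) ts) = length us"
      using assms by (simp add: stay_def)
    fix i assume "i < length (map2 act ((stay (map read ts))[j := f (map read ts)]) ts)"
    then have i: "i < length ts" by (simp add: stay_def)
    show "map2 act ((stay (map read ts))[j := f (map read ts)]) ts ! i = us ! i"
      using i assms by (auto simp: stay_def nth_list_update act_def read_def)
  qed
  then show ?thesis
    using runs_Act[of "\<lambda>xs. (stay xs)[j := f xs]" ts] by (simp add: single_def)
qed

lemma wf_single:
  assumes "\<And>xs. length xs = n \<Longrightarrow> set xs \<subseteq> {..<m} \<Longrightarrow> fst (f xs) < m"
  shows "wf_prog n m (single j f)"
proof -
  have "fst ` set ((stay xs)[j := f xs]) \<subseteq> {..<m}" if "length xs = n" "set xs \<subseteq> {..<m}" for xs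
  proof -
    have "set ((stay xs)[j := f xs]) \<subseteq> insert (f xs) (set (stay xs))"
      by (rule set_update_subset_insert)
    then show ?thesis using assms[OF that] that by (fastforce simp: stay_def)
  qed
  then show ?thesis by (auto simp: single_def stay_def)
qed

text \<open>The unconditional first step matters: the head often stands on the blank behind the
  contents, where the loop would stop at once. The loop ends on the blank at position -1, whence the
  final step to the right.\<close>

definition rew :: "nat \<Rightarrow> prog" where
  "rew j = lf j ;; until j 0 (lf j) ;; rt j"

lemma runs_rew:
  assumes st: "\<And>t. st t ! j = t" "\<And>t t'. (st t)[j := t'] = st t'" "\<And>t. j < length (st t)"
    and nz: "0 \<notin> set u"
  shows "runs (rew j) (st (Z u v)) (st (Z [] (u @ v))) (2 * length u + 3)"
proof -
  \<comment> \<open>The head passes to position -1, which no \<open>Z u v\<close> describes, so its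
    position is given explicitly.\<close>
  define t where "t i = st (written (u @ v), int (length u) - 1 - int i)" for i
  have 1: "runs (lf j) (st (Z u v)) (t 0) 1"
    by (rule runs_single) (use st in \<open>auto simp: t_def act_def Z_def read_def\<close>)
  have 2: "runs (until j 0 (lf j)) (t 0) (t (length u)) (length u * Suc 1 + 1)"
  proof (rule runs_While)
    fix i assume i: "i < length u"
    have "u ! (length u - Suc i) \<noteq> 0" using i nz nth_mem[of "length u - Suc i" u] by (metis diff_less length_greater_0_conv list.size(3) not_less0 zero_less_Suc)
    then show "map read (t i) ! j \<noteq> 0"
      using i st by (auto simp: t_def read_def written_def nth_append nat_diff_distrib Suc_diff_Suc)
    show "runs (lf j) (t i) (t (Suc i)) 1"
      by (rule runs_single) (use st in \<open>auto simp: t_def act_def read_def\<close>)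
  next
    show "\<not> map read (t (length u)) ! j \<noteq> 0" using st by (auto simp: t_def read_def written_def)
  qed
  have 3: "runs (rt j) (t (length u)) (st (Z [] (u @ v))) 1"
    by (rule runs_single) (use st in \<open>auto simp: t_def act_def read_def Z_def\<close>)
  show ?thesis
    unfolding rew_def by (rule runs_mono[OF runs_Seq[OF 1 runs_Seq[OF 2 3]]]) simp
qed

text \<open>The tape serves as a unary counter; rewinding it at the end makes it ready for the next
  loop.\<close>

definition foreach :: "nat \<Rightarrow> prog \<Rightarrow> prog" where
  "foreach j p = until j 0 (p ;; rt j) ;; rew j"

text \<open>\<open>st\<close> is the tape list with a hole at tape \<open>j\<close>, indexed by the
  number of completed rounds, so the effect of the body may differ from round to round. Of the four
  extra steps per symbol, two belong to the loop and two to rewinding.\<close>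

lemma runs_foreach_nth:
  assumes st: "\<And>t i. st t i ! j = t" "\<And>t t' i. (st t i)[j := t'] = st t' i" "\<And>t i. j < length (st t i)"
    and nz: "0 \<notin> set c"
    and body: "\<And>i. i < length c \<Longrightarrow>
      runs p (st (Z (take i c) (drop i c)) i) (st (Z (take i c) (drop i c)) (Suc i)) B"
  shows "runs (foreach j p) (st (Z [] c) 0) (st (Z [] c) (length c)) (length c * (B + 4) + 4)"
proof -
  let ?s = "\<lambda>i. st (Z (take i c) (drop i c)) i"
  have 1: "runs (until j 0 (p ;; rt j)) (?s 0) (?s (length c)) (length c * Suc (B + 1) + 1)"
  proof (rule runs_While)
    fix i assume i: "i < length c"
    have d: "drop i c = c ! i # drop (Suc i) c" using i by (simp add: Cons_nth_drop_Suc)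
    have "c ! i \<noteq> 0" using i nz by (metis nth_mem)
    then show "map read (?s i) ! j \<noteq> 0" using st by (simp add: d)
    have "runs (rt j) (st (Z (take i c) (drop i c)) (Suc i)) (?s (Suc i)) 1"
      by (rule runs_single) (use st i in \<open>simp_all add: d take_Suc_conv_app_nth\<close>)
    then show "runs (p ;; rt j) (?s i) (?s (Suc i)) (B + 1)" by (rule runs_Seq[OF body[OF i]])
  next
    show "\<not> map read (?s (length c)) ! j \<noteq> 0" using st by simp
  qed
  have 2: "runs (rew j) (?s (length c)) (st (Z [] (c @ [])) (length c)) (2 * length c + 3)"
    unfolding take_all[OF order_refl] drop_all[OF order_refl] by (rule runs_rew[where st = "\<lambda>t. st t (length c)"]) (use st nz in auto)
  show ?thesis unfolding foreach_def
    by (rule runs_mono[OF runs_Seq[OF 1 2, unfolded take_0 drop_0 append_Nil2]]) (simp add: algebra_simps)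
qed

lemma runs_foreach:
  assumes st: "\<And>t w. st t w ! j = t" "\<And>t t' w. (st t w)[j := t'] = st t' w" "\<And>t w. j < length (st t w)"
    and nz: "0 \<notin> set c"
    and body: "\<And>x u v w. x \<in> set c \<Longrightarrow> runs p (st (Z u (x # v)) w) (st (Z u (x # v)) (w @ g x)) B"
  shows "runs (foreach j p) (st (Z [] c) w) (st (Z [] c) (w @ concat (map g c))) (length c * (B + 4) + 4)"
proof -
  define s where "s t i = st t (w @ concat (map g (take i c)))" for t i
  have "runs (foreach j p) (s (Z [] c) 0) (s (Z [] c) (length c)) (length c * (B + 4) + 4)"
  proof (rule runs_foreach_nth)
    fix i assume i: "i < length c"
    have "drop i c = c ! i # drop (Suc i) c" using i by (simp add: Cons_nth_drop_Suc)
    then show "runs p (s (Z (take i c) (drop i c)) i) (s (Z (take i c) (drop i c)) (Suc i)) B"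
      using body[OF nth_mem[OF i], of "take i c" "drop (Suc i) c" "w @ concat (map g (take i c))"] i
      by (simp add: s_def take_Suc_conv_app_nth)
  qed (use st nz in \<open>simp_all add: s_def\<close>)
  then show ?thesis by (simp add: s_def)
qed

lemma wf_rew: "j < n \<Longrightarrow> wf_prog n m (rew j)"
  unfolding rew_def by (auto intro!: wf_single) (meson lessThan_iff nth_mem subsetD)+

lemma wf_foreach: "j < n \<Longrightarrow> wf_prog n m (foreach j p) \<longleftrightarrow> wf_prog n m p"
  unfolding foreach_def by (auto intro!: wf_single simp: wf_rew) (meson lessThan_iff nth_mem subsetD)+

section \<open>Basic routines\<close>

lemma list_update_Cons_numeral [simp]:
  "(x # xs)[numeral n := y] = x # xs[pred_numeral n := y]"
  by (simp add: numeral_eq_Suc)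

lemma runs_SeqI:
  "runs p ts us C \<Longrightarrow> runs q us vs C' \<Longrightarrow> C + C' \<le> C'' \<Longrightarrow> runs (p ;; q) ts vs C''"
  using runs_Seq runs_mono by blast

lemma runs_cong: "runs p ts us C \<Longrightarrow> us = vs \<Longrightarrow> C \<le> C' \<Longrightarrow> runs p ts vs C'"
  using runs_mono by blast

text \<open>The empty word costs one idle step, so \<open>emit []\<close> can serve as the branch of
  a \<open>Cond\<close> that does nothing.\<close>

fun emit :: "nat list \<Rightarrow> prog" where
  "emit [] = Act stay"
| "emit (a # as) = put 1 a ;; emit as"

lemma runs_emit:
  "runs (emit as) [t0, Z w [], t2, t3, t4, t5] [t0, Z (w @ as) [], t2, t3, t4, t5] (length as + 1)"
proof (induction as arbitrary: w)
  case Nil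
  show ?case
    using runs_Act[of stay "[t0, Z w [], t2, t3, t4, t5]"] by (simp only: act_stay) simp
next
  case (Cons a as)
  show ?case unfolding emit.simps
  proof (rule runs_SeqI)
    show "runs (put 1 a) [t0, Z w [], t2, t3, t4, t5] [t0, Z (w @ [a]) [], t2, t3, t4, t5] 1"
      by (rule runs_single) simp_all
    show "runs (emit as) [t0, Z (w @ [a]) [], t2, t3, t4, t5] [t0, Z (w @ a # as) [], t2, t3, t4, t5] (length as + 1)"
      using Cons[of "w @ [a]"] by simp
  qed simp
qed

declare emit.simps [simp del]

lemma runs_put_1:
  "runs (put (Suc 0) a) [t0, Z w [], t2, t3, t4, t5] [t0, Z (w @ [a]) [], t2, t3, t4, t5] (Suc 0)"
  by (rule runs_mono[OF runs_single]) simp_all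

text \<open>The rationals 0, 1 and 2 in encoded form: the symbols 1 and 2 are the binary digits 0
  and 1, followed by the slash 4, the denominator 1 and the end marker 5.\<close>

abbreviation "zero_entry \<equiv> [1, 4, 2, 5 :: nat]"
abbreviation "one_entry \<equiv> [2, 4, 2, 5 :: nat]"
abbreviation "two_entry \<equiv> [2, 1, 4, 2, 5 :: nat]"

definition zs :: "nat \<Rightarrow> nat list" where
  "zs n = concat (replicate n zero_entry)"

lemma concat_map_const: "concat (map (\<lambda>x. a) c) = concat (replicate (length c) a)"
  by (induction c) auto

definition zeros :: "nat \<Rightarrow> prog" where
  "zeros j = foreach j (emit zero_entry)"

lemma runs_zeros_2:
  assumes "0 \<notin> set c"
  shows "runs (zeros 2) [t0, Z w [], Z [] c, t3, t4, t5] [t0, Z (w @ zs (length c)) [], Z [] c, t3, t4, t5]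
    (9 * length c + 4)"
proof -
  have "runs (zeros 2) [t0, Z w [], Z [] c, t3, t4, t5]
    [t0, Z (w @ concat (map (\<lambda>_. zero_entry) c)) [], Z [] c, t3, t4, t5] (length c * (5 + 4) + 4)"
    unfolding zeros_def
    by (rule runs_foreach[where st = "\<lambda>t w. [t0, Z w [], t, t3, t4, t5]"])
      (use assms in \<open>auto intro!: runs_mono[OF runs_emit]\<close>)
  then show ?thesis by (simp add: concat_map_const zs_def mult.commute)
qed

lemma runs_zeros_3:
  assumes "0 \<notin> set c"
  shows "runs (zeros 3) [t0, Z w [], t2, Z [] c, t4, t5] [t0, Z (w @ zs (length c)) [], t2, Z [] c, t4, t5]
    (9 * length c + 4)"
proof -
  have "runs (zeros 3) [t0, Z w [], t2, Z [] c, t4, t5]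
    [t0, Z (w @ concat (map (\<lambda>_. zero_entry) c)) [], t2, Z [] c, t4, t5] (length c * (5 + 4) + 4)"
    unfolding zeros_def
    by (rule runs_foreach[where st = "\<lambda>t w. [t0, Z w [], t2, t, t4, t5]"])
      (use assms in \<open>auto intro!: runs_mono[OF runs_emit]\<close>)
  then show ?thesis by (simp add: concat_map_const zs_def mult.commute)
qed

lemma runs_rt:
  "runs (rt 0) [Z u (x # v), t1, t2, t3, t4, t5] [Z (u @ [x]) v, t1, t2, t3, t4, t5] 1"
  by (rule runs_single) simp_all

lemma runs_rew0:
  "0 \<notin> set u \<Longrightarrow> runs (rew 0) [Z u v, t1, t2, t3, t4, t5] [Z [] (u @ v), t1, t2, t3, t4, t5] (2 * length u + 3)"
  by (rule runs_rew[where st = "\<lambda>t. [t, t1, t2, t3, t4, t5]"]) auto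

lemma runs_rew2:
  "0 \<notin> set u \<Longrightarrow> runs (rew 2) [t0, t1, Z u v, t3, t4, t5] [t0, t1, Z [] (u @ v), t3, t4, t5] (2 * length u + 3)"
  by (rule runs_rew[where st = "\<lambda>t. [t0, t1, t, t3, t4, t5]"]) auto

lemma runs_rew3:
  "0 \<notin> set u \<Longrightarrow> runs (rew 3) [t0, t1, t2, Z u v, t4, t5] [t0, t1, t2, Z [] (u @ v), t4, t5] (2 * length u + 3)"
  by (rule runs_rew[where st = "\<lambda>t. [t0, t1, t2, t, t4, t5]"]) auto

lemma runs_rew4:
  "0 \<notin> set u \<Longrightarrow> runs (rew 4) [t0, t1, t2, t3, Z u v, t5] [t0, t1, t2, t3, Z [] (u @ v), t5] (2 * length u + 3)"
  by (rule runs_rew[where st = "\<lambda>t. [t0, t1, t2, t3, t, t5]"]) auto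

lemma runs_rew5:
  "0 \<notin> set u \<Longrightarrow> runs (rew 5) [t0, t1, t2, t3, t4, Z u v] [t0, t1, t2, t3, t4, Z [] (u @ v)] (2 * length u + 3)"
  by (rule runs_rew[where st = "\<lambda>t. [t0, t1, t2, t3, t4, t]"]) auto

lemma concat_map_single: "concat (map (\<lambda>x. [x]) xs) = xs"
  by (induction xs) auto

definition skip_to :: "nat \<Rightarrow> prog" where
  "skip_to a = until 0 a (rt 0) ;; rt 0"

lemma runs_skip_to:
  assumes "a \<notin> set xs"
  shows "runs (skip_to a) [Z u (xs @ a # v), t1, t2, t3, t4, t5] [Z (u @ xs @ [a]) v, t1, t2, t3, t4, t5]
    (2 * length xs + 2)"
  unfolding skip_to_def
proof (rule runs_SeqI)
  have "runs (until 0 a (rt 0)) [Z u (concat (map (\<lambda>x. [x]) xs) @ a # v), t1, t2, t3, t4, t5]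
    [Z (u @ concat (map (\<lambda>x. [x]) xs)) (a # v), t1, t2, t3, t4, t5] (length xs * Suc 1 + 1)"
    by (rule runs_While_list[where st = "\<lambda>u v w. [Z u v, t1, t2, t3, t4, t5]"])
      (use assms runs_rt in auto)
  then show "runs (until 0 a (rt 0)) [Z u (xs @ a # v), t1, t2, t3, t4, t5]
    [Z (u @ xs) (a # v), t1, t2, t3, t4, t5] (2 * length xs + 1)"
    unfolding concat_map_single by (rule runs_mono) simp
  show "runs (rt 0) [Z (u @ xs) (a # v), t1, t2, t3, t4, t5]
    [Z (u @ xs @ [a]) v, t1, t2, t3, t4, t5] 1"
    using runs_rt[of "u @ xs"] by simp
qed simp

text \<open>The delimiter is passed over but not copied, so that further symbols can be appended
  before it is emitted.\<close>

definition copy_to :: "nat \<Rightarrow> prog" where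
  "copy_to a = until 0 a (cp 0 1 ;; rt 0) ;; rt 0"

lemma runs_copy_to:
  assumes "a \<notin> set xs"
  shows "runs (copy_to a) [Z u (xs @ a # v), Z w [], t2, t3, t4, t5]
    [Z (u @ xs @ [a]) v, Z (w @ xs) [], t2, t3, t4, t5] (3 * length xs + 2)"
  unfolding copy_to_def
proof (rule runs_SeqI)
  have *: "runs (cp 0 1 ;; rt 0) [Z u (x # v), Z w [], t2, t3, t4, t5]
    [Z (u @ [x]) v, Z (w @ [x]) [], t2, t3, t4, t5] 2" for u x v w
    by (rule runs_SeqI[OF runs_single runs_rt]) simp_all
  have "runs (until 0 a (cp 0 1 ;; rt 0)) [Z u (concat (map (\<lambda>x. [x]) xs) @ a # v), Z w [], t2, t3, t4, t5]
    [Z (u @ concat (map (\<lambda>x. [x]) xs)) (a # v), Z (w @ concat (map (\<lambda>x. [x]) xs)) [], t2, t3, t4, t5] (length xs * Suc 2 + 1)"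
    by (rule runs_While_list[where st = "\<lambda>u v w. [Z u v, Z w [], t2, t3, t4, t5]"])
      (use assms * in auto)
  then show "runs (until 0 a (cp 0 1 ;; rt 0)) [Z u (xs @ a # v), Z w [], t2, t3, t4, t5]
    [Z (u @ xs) (a # v), Z (w @ xs) [], t2, t3, t4, t5] (3 * length xs + 1)"
    unfolding concat_map_single by (rule runs_mono) simp
  show "runs (rt 0) [Z (u @ xs) (a # v), Z (w @ xs) [], t2, t3, t4, t5]
    [Z (u @ xs @ [a]) v, Z (w @ xs) [], t2, t3, t4, t5] 1"
    using runs_rt[of "u @ xs"] by simp
qed simp

section \<open>The machine from VEST to matrix products\<close>

text \<open>Every row of the new matrices consists of \<open>d\<close> entries, then
  \<open>h\<close> entries, then three. The middle block is zero in all of them, so a row is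
  determined by its first block and the final triple \<open>as\<close>.\<close>

definition row_end :: "nat list \<Rightarrow> prog" where
  "row_end as = zeros 3 ;; emit (as @ [6])"

definition zero_row :: "nat list \<Rightarrow> prog" where
  "zero_row as = zeros 2 ;; row_end as"

definition copy_row :: "nat list \<Rightarrow> prog" where
  "copy_row as = copy_to 6 ;; row_end as"

lemma runs_row_end:
  assumes "0 \<notin> set c3" "length c3 \<le> N" "length as \<le> 30"
  shows "runs (row_end as) [t0, Z w [], t2, Z [] c3, t4, t5]
    [t0, Z (w @ zs (length c3) @ as @ [6]) [], t2, Z [] c3, t4, t5] (9 * N + 40)"
  unfolding row_end_def
  by (rule runs_SeqI[OF runs_zeros_3[OF assms(1)] runs_emit[where w = "w @ zs (length c3)" and as = "as @ [6]", unfolded append_assoc]])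
    (use assms in simp)

lemma runs_zero_row:
  assumes "0 \<notin> set c2" "0 \<notin> set c3" "length c2 \<le> N" "length c3 \<le> N" "length as \<le> 30"
  shows "runs (zero_row as) [t0, Z w [], Z [] c2, Z [] c3, t4, t5]
    [t0, Z (w @ zs (length c2) @ zs (length c3) @ as @ [6]) [], Z [] c2, Z [] c3, t4, t5] (18 * N + 50)"
  unfolding zero_row_def
  by (rule runs_SeqI[OF runs_zeros_2[OF assms(1)]
      runs_row_end[OF assms(2,4,5), where w = "w @ zs (length c2)", unfolded append_assoc]])
    (use assms in simp)

lemma runs_copy_row:
  assumes "0 \<notin> set c3" "length c3 \<le> N" "length as \<le> 30" "6 \<notin> set r" "length r \<le> N"
  shows "runs (copy_row as) [Z u (r @ 6 # v), Z w [], t2, Z [] c3, t4, t5]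
    [Z (u @ r @ [6]) v, Z (w @ r @ zs (length c3) @ as @ [6]) [], t2, Z [] c3, t4, t5] (12 * N + 50)"
  unfolding copy_row_def
  by (rule runs_SeqI[OF runs_copy_to[OF assms(4)]
      runs_row_end[OF assms(1,2,3), where w = "w @ r", unfolded append_assoc]])
    (use assms in simp)

definition rows_code :: "nat list list \<Rightarrow> nat list" where
  "rows_code rs = concat (map (\<lambda>r. r @ [6]) rs)"

definition rows_out :: "nat \<Rightarrow> nat list list \<Rightarrow> nat list" where
  "rows_out h rs = concat (map (\<lambda>r. r @ zs h @ zero_entry @ zero_entry @ zero_entry @ [6]) rs)"

definition copy_rows :: prog where
  "copy_rows = until 0 7 (copy_row (zero_entry @ zero_entry @ zero_entry))"

text \<open>A single number \<open>N\<close>, later the input length, bounds all sizes, so that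
  running times become polynomials in \<open>N\<close>.\<close>

definition row_ok :: "nat \<Rightarrow> nat list \<Rightarrow> bool" where
  "row_ok N r \<longleftrightarrow> set r \<subseteq> {1..5} \<and> length r \<le> N"

lemma runs_copy_rows:
  assumes "0 \<notin> set c3" "length c3 \<le> N" "\<forall>r\<in>set rs. row_ok N r" "length rs \<le> N"
  shows "runs copy_rows [Z u (rows_code rs @ 7 # v), Z w [], t2, Z [] c3, t4, t5]
    [Z (u @ rows_code rs) (7 # v), Z (w @ rows_out (length c3) rs) [], t2, Z [] c3, t4, t5]
    (N * Suc (12 * N + 50) + 1)"
  unfolding rows_code_def copy_rows_def rows_out_def
proof (rule runs_mono, rule runs_While_list[where st = "\<lambda>u v w. [Z u v, Z w [], t2, Z [] c3, t4, t5]"])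
  fix r u v w assume r: "r \<in> set rs"
  then have ok: "6 \<notin> set r" "length r \<le> N" "7 \<notin> set r" using assms(3) by (force simp: row_ok_def)+
  then show "map read [Z u ((r @ [6]) @ v), Z w [], t2, Z [] c3, t4, t5] ! 0 \<noteq> 7"
    by (cases r) auto
  show "runs (copy_row (zero_entry @ zero_entry @ zero_entry))
    [Z u ((r @ [6]) @ v), Z w [], t2, Z [] c3, t4, t5]
    [Z (u @ r @ [6]) v, Z (w @ r @ zs (length c3) @ zero_entry @ zero_entry @ zero_entry @ [6]) [], t2, Z [] c3, t4, t5]
    (12 * N + 50)"
    using runs_copy_row[OF assms(1,2) _ ok(1,2), of "zero_entry @ zero_entry @ zero_entry"] by simp
qed (use assms(4) in \<open>simp_all del: mult_Suc_right add: mult_right_mono\<close>)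

definition zero_row_out :: "nat \<Rightarrow> nat \<Rightarrow> nat list \<Rightarrow> nat list" where
  "zero_row_out d h as = zs d @ zs h @ as @ [6]"

text \<open>The block diagonal matrix with blocks \<open>T\<close>, a zero matrix of size
  \<open>h + 1\<close> and \<open>diag(1, 2)\<close>, row by row.\<close>

definition mat_out :: "nat \<Rightarrow> nat \<Rightarrow> nat list list \<Rightarrow> nat list" where
  "mat_out d h rs = rows_out h rs @
     concat (replicate h (zero_row_out d h (zero_entry @ zero_entry @ zero_entry))) @
     zero_row_out d h (zero_entry @ zero_entry @ zero_entry) @
     zero_row_out d h (zero_entry @ one_entry @ zero_entry) @
     zero_row_out d h (zero_entry @ zero_entry @ two_entry) @ [7]"

text \<open>\<open>copy_rows\<close> stops on the end marker of the matrix without passing it, hence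
  \<open>rt 0\<close>. The rows added below depend on \<open>d\<close> and \<open>h\<close>
  only.\<close>

definition extend_mat :: prog where
  "extend_mat = copy_rows ;; rt 0 ;;
     foreach 5 (zero_row (zero_entry @ zero_entry @ zero_entry)) ;;
     zero_row (zero_entry @ zero_entry @ zero_entry) ;;
     zero_row (zero_entry @ one_entry @ zero_entry) ;;
     zero_row (zero_entry @ zero_entry @ two_entry) ;; emit [7]"

lemma runs_extend_mat:
  assumes "0 \<notin> set c2" "length c2 \<le> N" "0 \<notin> set c3" "length c3 \<le> N" "0 \<notin> set c5" "length c5 = length c3"
    "\<forall>r\<in>set rs. row_ok N r" "length rs \<le> N"
  shows "runs extend_mat [Z u (rows_code rs @ 7 # v), Z w [], Z [] c2, Z [] c3, t4, Z [] c5]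
    [Z (u @ rows_code rs @ [7]) v, Z (w @ mat_out (length c2) (length c3) rs) [],
     Z [] c2, Z [] c3, t4, Z [] c5]
    (30 * (N * N) + 200 * N + 200)"
proof -
  let ?h = "length c3" and ?d = "length c2"
  note zrow = runs_zero_row[OF assms(1,3,2,4)]
  let ?z = "zero_entry @ zero_entry @ zero_entry"
  have fe: "runs (foreach 5 (zero_row ?z)) [t0, Z w [], Z [] c2, Z [] c3, t4, Z [] c5]
     [t0, Z (w @ concat (map (\<lambda>_. zero_row_out ?d ?h ?z) c5)) [], Z [] c2, Z [] c3, t4, Z [] c5]
     (length c5 * (18 * N + 50 + 4) + 4)" for t0 w
    by (rule runs_foreach[where st = "\<lambda>t w. [t0, Z w [], Z [] c2, Z [] c3, t4, t]"])
      (use assms zrow[of ?z] in \<open>auto simp: zero_row_out_def\<close>)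
  have fe': "runs (foreach 5 (zero_row ?z)) [t0, Z w [], Z [] c2, Z [] c3, t4, Z [] c5]
     [t0, Z (w @ concat (replicate ?h (zero_row_out ?d ?h ?z))) [], Z [] c2, Z [] c3, t4, Z [] c5]
     (18 * (N * N) + 54 * N + 4)" for t0 w
    using fe[of t0 w] unfolding concat_map_const assms(6)
  proof (rule runs_mono)
    have "?h * (18 * N + 50 + 4) \<le> N * (18 * N + 50 + 4)" using assms(4) by (rule mult_right_mono) simp
    then show "?h * (18 * N + 50 + 4) + 4 \<le> 18 * (N * N) + 54 * N + 4" by (simp add: algebra_simps)
  qed
  show ?thesis
    unfolding extend_mat_def
    apply (rule runs_cong)
     apply (rule runs_Seq[OF runs_copy_rows[OF assms(3,4,7,8)]])
     apply (rule runs_Seq[OF runs_rt])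
     apply (rule runs_Seq[OF fe'])
     apply (rule runs_Seq[OF zrow], simp)
     apply (rule runs_Seq[OF zrow], simp)
     apply (rule runs_Seq[OF zrow], simp)
     apply (rule runs_emit)
    apply (simp add: mat_out_def zero_row_out_def)
    apply (simp add: algebra_simps)
    done
qed

section \<open>Reading the parameter and the dimensions; emitting the parts of the separator\<close>

definition read_param :: prog where
  "read_param = until 0 9 (cp 0 1 ;; cp 0 4 ;; rt 0)"

lemma runs_read_param:
  "runs read_param [Z [] (replicate k 2 @ 9 # v), Z [] [], t2, t3, Z [] [], t5]
    [Z (replicate k 2) (9 # v), Z (replicate k 2) [], t2, t3, Z (replicate k 2) [], t5] (4 * k + 1)"
proof -
  have *: "runs (cp 0 1 ;; cp 0 4 ;; rt 0) [Z u (x # v), Z w [], t2, t3, Z w [], t5]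
      [Z (u @ [x]) v, Z (w @ [x]) [], t2, t3, Z (w @ [x]) [], t5] 3" for u x v w
    by (rule runs_mono, rule runs_Seq[OF runs_single runs_Seq[OF runs_single runs_rt]]) simp+
  have "runs read_param [Z [] (concat (map (\<lambda>x. [x]) (replicate k 2)) @ 9 # v), Z [] [], t2, t3, Z [] [], t5]
     [Z ([] @ concat (map (\<lambda>x. [x]) (replicate k 2))) (9 # v), Z ([] @ concat (map (\<lambda>x. [x]) (replicate k 2))) [], t2, t3,
      Z ([] @ concat (map (\<lambda>x. [x]) (replicate k 2))) [], t5] (length (replicate k (2::nat)) * Suc 3 + 1)"
    unfolding read_param_def
    by (rule runs_While_list[where st = "\<lambda>u v w. [Z u v, Z w [], t2, t3, Z w [], t5]"])
      (use * in \<open>auto split: if_splits\<close>)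
  then show ?thesis unfolding concat_map_single append_Nil by (rule runs_mono) simp
qed

definition entries_code :: "nat list list \<Rightarrow> nat list" where
  "entries_code xs = concat (map (\<lambda>x. x @ [5]) xs)"

lemma count_entries:
  "\<forall>x\<in>set xs. 5 \<notin> set x \<Longrightarrow>
     concat (map (\<lambda>s. if s = 5 then [2] else []) (entries_code xs)) = replicate (length xs) 2"
proof (induction xs)
  case (Cons x xs)
  moreover have "concat (map (\<lambda>s. if s = 5 then [2] else []) x) = []" using Cons.prems by auto
  ultimately show ?case by (simp add: entries_code_def)
qed (simp add: entries_code_def)

lemma count_rows:
  "\<forall>x\<in>set xs. 6 \<notin> set x \<Longrightarrow>
     concat (map (\<lambda>s. if s = 6 then [2] else []) (rows_code xs)) = replicate (length xs) 2"
proof (induction xs)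
  case (Cons x xs)
  moreover have "concat (map (\<lambda>s. if s = 6 then [2] else []) x) = []" using Cons.prems by auto
  ultimately show ?case by (simp add: rows_code_def)
qed (simp add: rows_code_def)

text \<open>The dimensions are recovered by counting delimiters: the entries of \<open>v\<close>
  give \<open>d\<close>, and below the rows of \<open>S\<close> give \<open>h\<close>.\<close>

definition count_cols :: prog where
  "count_cols = until 0 6 (Cond (\<lambda>xs. xs ! 0 = 5) (put 2 2) (emit []) ;; rt 0)"

lemma runs_count_cols:
  assumes "6 \<notin> set xs"
  shows "runs count_cols [Z u (xs @ 6 # v), Z w [], Z [] [], t3, t4, t5]
    [Z (u @ xs) (6 # v), Z w [], Z (concat (map (\<lambda>s. if s = 5 then [2] else []) xs)) [], t3, t4, t5]
    (4 * length xs + 1)"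
proof -
  have *: "runs (Cond (\<lambda>xs. xs ! 0 = 5) (put 2 2) (emit []) ;; rt 0) [Z u (x # v), Z w [], Z c [], t3, t4, t5]
      [Z (u @ [x]) v, Z w [], Z (c @ (if x = 5 then [2] else [])) [], t3, t4, t5] 3" for u x v c
  proof (rule runs_SeqI[OF _ runs_rt])
    show "runs (Cond (\<lambda>xs. xs ! 0 = 5) (put 2 2) (emit [])) [Z u (x # v), Z w [], Z c [], t3, t4, t5]
      [Z u (x # v), Z w [], Z (c @ (if x = 5 then [2] else [])) [], t3, t4, t5] 2"
    proof (cases "x = 5")
      case True
      show ?thesis
        by (rule runs_mono[OF runs_CondT[OF _ runs_single]]) (use True in simp_all)
    next
      case False
      show ?thesis
        by (rule runs_mono[OF runs_CondF[OF _ runs_cong[OF runs_emit _ order_refl]]]) (use False in simp_all)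
    qed
  qed simp
  have "runs count_cols [Z u (concat (map (\<lambda>x. [x]) xs) @ 6 # v), Z w [], Z [] [], t3, t4, t5]
     [Z (u @ concat (map (\<lambda>x. [x]) xs)) (6 # v), Z w [],
      Z ([] @ concat (map (\<lambda>s. if s = 5 then [2] else []) xs)) [], t3, t4, t5] (length xs * Suc 3 + 1)"
    unfolding count_cols_def
    by (rule runs_While_list[where st = "\<lambda>u v c. [Z u v, Z w [], Z c [], t3, t4, t5]"])
      (use * assms in auto)
  then show ?thesis unfolding concat_map_single append_Nil by (rule runs_mono) simp
qed

definition count_rows_prog :: prog where
  "count_rows_prog = until 0 7 (Cond (\<lambda>xs. xs ! 0 = 6) (put 3 2 ;; put 5 2) (emit []) ;; rt 0)"

lemma runs_count_rows:
  assumes "7 \<notin> set xs"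
  shows "runs count_rows_prog [Z u (xs @ 7 # v), Z w [], t2, Z [] [], t4, Z [] []]
    [Z (u @ xs) (7 # v), Z w [], t2, Z (concat (map (\<lambda>s. if s = 6 then [2] else []) xs)) [], t4,
     Z (concat (map (\<lambda>s. if s = 6 then [2] else []) xs)) []]
    (5 * length xs + 1)"
proof -
  have *: "runs (Cond (\<lambda>xs. xs ! 0 = 6) (put 3 2 ;; put 5 2) (emit []) ;; rt 0) [Z u (x # v), Z w [], t2, Z c [], t4, Z c []]
      [Z (u @ [x]) v, Z w [], t2, Z (c @ (if x = 6 then [2] else [])) [], t4, Z (c @ (if x = 6 then [2] else [])) []] 4" for u x v c
  proof (rule runs_SeqI[OF _ runs_rt])
    show "runs (Cond (\<lambda>xs. xs ! 0 = 6) (put 3 2 ;; put 5 2) (emit [])) [Z u (x # v), Z w [], t2, Z c [], t4, Z c []]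
      [Z u (x # v), Z w [], t2, Z (c @ (if x = 6 then [2] else [])) [], t4, Z (c @ (if x = 6 then [2] else [])) []] 3"
    proof (cases "x = 6")
      case True
      show ?thesis
        by (rule runs_mono[OF runs_CondT[OF _ runs_Seq[OF runs_single runs_single]]]) (simp add: True)+
    next
      case False
      show ?thesis
        by (rule runs_mono[OF runs_CondF[OF _ runs_cong[OF runs_emit _ order_refl]]]) (use False in simp_all)
    qed
  qed simp
  have "runs count_rows_prog [Z u (concat (map (\<lambda>x. [x]) xs) @ 7 # v), Z w [], t2, Z [] [], t4, Z [] []]
     [Z (u @ concat (map (\<lambda>x. [x]) xs)) (7 # v), Z w [], t2,
      Z ([] @ concat (map (\<lambda>s. if s = 6 then [2] else []) xs)) [], t4,
      Z ([] @ concat (map (\<lambda>s. if s = 6 then [2] else []) xs)) []] (length xs * Suc 4 + 1)"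
    unfolding count_rows_prog_def
    by (rule runs_While_list[where st = "\<lambda>u v c. [Z u v, Z w [], t2, Z c [], t4, Z c []]"])
      (use * assms in auto)
  then show ?thesis unfolding concat_map_single append_Nil by (rule runs_mono) simp
qed

text \<open>The encoded rational \<open>- (2 ^ k)\<close>: minus sign, digit 1, one digit 0 for each
  symbol of the unary counter, and denominator 1.\<close>

definition neg_pow :: prog where
  "neg_pow = emit [3, 2] ;; foreach 4 (put 1 1) ;; emit [4, 2, 5]"

definition neg_pow_out :: "nat \<Rightarrow> nat list" where
  "neg_pow_out k = [3, 2] @ replicate k 1 @ [4, 2, 5]"

lemma runs_neg_pow:
  assumes "0 \<notin> set c"
  shows "runs neg_pow [t0, Z w [], t2, t3, Z [] c, t5] [t0, Z (w @ neg_pow_out (length c)) [], t2, t3, Z [] c, t5]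
    (5 * length c + 11)"
proof -
  have r: "concat (replicate n [1::nat]) = replicate n 1" for n by (induction n) auto
  have "runs (foreach 4 (put 1 1)) [t0, Z w [], t2, t3, Z [] c, t5]
     [t0, Z (w @ concat (map (\<lambda>_. [1]) c)) [], t2, t3, Z [] c, t5] (length c * (1 + 4) + 4)" for w
    by (rule runs_foreach[where st = "\<lambda>t w. [t0, Z w [], t2, t3, t, t5]"])
      (use assms in \<open>simp_all add: runs_put_1\<close>)
  note * = this[unfolded concat_map_const r]
  show ?thesis
    unfolding neg_pow_def neg_pow_out_def
    apply (rule runs_cong)
      apply (rule runs_Seq[OF runs_emit])
      apply (rule runs_Seq[OF *])
      apply (rule runs_emit)
     apply (simp_all add: concat_map_const r)
    done
qed

text \<open>In the upper rows of the separator the only entry that may be nonzero is one of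
  \<open>v\<close>, in the column of the start coordinate: behind \<open>d + h\<close> zeros and in
  front of the two automaton columns.\<close>

definition vec_row :: prog where
  "vec_row = zeros 2 ;; zeros 3 ;; copy_to 5 ;; emit (5 # zero_entry @ zero_entry @ [6])"

definition vec_rows_out :: "nat \<Rightarrow> nat \<Rightarrow> nat list list \<Rightarrow> nat list" where
  "vec_rows_out d h xs = concat (map (\<lambda>x. zs d @ zs h @ x @ 5 # zero_entry @ zero_entry @ [6]) xs)"

lemma runs_vec_rows:
  assumes "0 \<notin> set c2" "length c2 \<le> N" "0 \<notin> set c3" "length c3 \<le> N"
    "\<forall>x\<in>set xs. set x \<subseteq> {1..4} \<and> length x \<le> N" "length xs \<le> N"
  shows "runs (until 0 6 vec_row) [Z u (entries_code xs @ 6 # v), Z w [], Z [] c2, Z [] c3, t4, t5]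
    [Z (u @ entries_code xs) (6 # v), Z (w @ vec_rows_out (length c2) (length c3) xs) [], Z [] c2, Z [] c3, t4, t5]
    (N * Suc (21 * N + 30) + 1)"
  unfolding entries_code_def vec_rows_out_def
proof (rule runs_mono, rule runs_While_list[where st = "\<lambda>u v w. [Z u v, Z w [], Z [] c2, Z [] c3, t4, t5]"])
  fix x u v w assume x: "x \<in> set xs"
  then have ok: "5 \<notin> set x" "length x \<le> N" "6 \<notin> set x" using assms(5) by force+
  then show "map read [Z u ((x @ [5]) @ v), Z w [], Z [] c2, Z [] c3, t4, t5] ! 0 \<noteq> 6"
    by (cases x) auto
  show "runs vec_row
    [Z u ((x @ [5]) @ v), Z w [], Z [] c2, Z [] c3, t4, t5]
    [Z (u @ x @ [5]) v, Z (w @ zs (length c2) @ zs (length c3) @ x @ 5 # zero_entry @ zero_entry @ [6]) [], Z [] c2, Z [] c3, t4, t5]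
    (21 * N + 30)"
    unfolding vec_row_def append_assoc append_Cons append_Nil
    apply (rule runs_cong)
      apply (rule runs_Seq[OF runs_zeros_2[OF assms(1)]])
      apply (rule runs_Seq[OF runs_zeros_3[OF assms(3)]])
      apply (rule runs_Seq[OF runs_copy_to[OF ok(1)]])
      apply (rule runs_emit)
     apply simp
    using assms(2,4) ok(2) apply simp
    done
qed (use assms(6) in \<open>simp_all del: mult_Suc_right add: mult_right_mono\<close>)

definition mats_code :: "nat list list list \<Rightarrow> nat list" where
  "mats_code ms = concat (map (\<lambda>rs. rows_code rs @ [7]) ms)"

definition mats_out :: "nat \<Rightarrow> nat \<Rightarrow> nat list list list \<Rightarrow> nat list" where
  "mats_out d h ms = concat (map (mat_out d h) ms)"

lemma runs_extend_mats:
  assumes c: "0 \<notin> set c2" "length c2 \<le> N" "0 \<notin> set c3" "length c3 \<le> N" "0 \<notin> set c5" "length c5 = length c3"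
    and ms: "\<forall>rs\<in>set ms. length rs \<le> N \<and> (\<forall>r\<in>set rs. row_ok N r)" "length ms \<le> N"
  shows "runs (until 0 8 extend_mat) [Z u (mats_code ms @ 8 # v), Z w [], Z [] c2, Z [] c3, t4, Z [] c5]
    [Z (u @ mats_code ms) (8 # v), Z (w @ mats_out (length c2) (length c3) ms) [],
     Z [] c2, Z [] c3, t4, Z [] c5]
    (N * Suc (30 * (N * N) + 200 * N + 200) + 1)"
  unfolding mats_code_def mats_out_def
proof (rule runs_mono, rule runs_While_list[where st = "\<lambda>u v w. [Z u v, Z w [], Z [] c2, Z [] c3, t4, Z [] c5]"])
  fix rs u v w assume rs: "rs \<in> set ms"
  have "8 \<notin> set r" if "r \<in> set rs" for r using ms(1) rs that by (force simp: row_ok_def)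
  then show "map read [Z u ((rows_code rs @ [7]) @ v), Z w [], Z [] c2, Z [] c3, t4, Z [] c5] ! 0 \<noteq> 8"
    by (cases rs; cases "hd rs") (force simp: rows_code_def)+
  show "runs extend_mat
    [Z u ((rows_code rs @ [7]) @ v), Z w [], Z [] c2, Z [] c3, t4, Z [] c5]
    [Z (u @ rows_code rs @ [7]) v, Z (w @ mat_out (length c2) (length c3) rs) [], Z [] c2, Z [] c3, t4, Z [] c5]
    (30 * (N * N) + 200 * N + 200)"
    using runs_extend_mat[OF c, of rs u v w t4] ms rs by simp
qed (use ms(2) in \<open>simp_all del: mult_Suc_right add: mult_right_mono\<close>)

definition put_each :: "nat \<Rightarrow> prog" where
  "put_each j = foreach j (put 1 2)"

lemma runs_put_each_2:
  assumes "0 \<notin> set c"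
  shows "runs (put_each 2) [t0, Z w [], Z [] c, t3, t4, t5] [t0, Z (w @ replicate (length c) 2) [], Z [] c, t3, t4, t5]
    (5 * length c + 4)"
proof -
  have *: "runs (put_each 2) [t0, Z w [], Z [] c, t3, t4, t5]
     [t0, Z (w @ concat (map (\<lambda>_. [2]) c)) [], Z [] c, t3, t4, t5] (length c * (1 + 4) + 4)"
    unfolding put_each_def
    by (rule runs_foreach[where st = "\<lambda>t w. [t0, Z w [], t, t3, t4, t5]"])
      (use assms in \<open>simp_all add: runs_put_1\<close>)
  have r: "concat (replicate n [2::nat]) = replicate n 2" for n by (induction n) auto
  show ?thesis using * unfolding concat_map_const r by (rule runs_mono) simp
qed

lemma runs_put_each_3:
  assumes "0 \<notin> set c"
  shows "runs (put_each 3) [t0, Z w [], t2, Z [] c, t4, t5] [t0, Z (w @ replicate (length c) 2) [], t2, Z [] c, t4, t5]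
    (5 * length c + 4)"
proof -
  have *: "runs (put_each 3) [t0, Z w [], t2, Z [] c, t4, t5]
     [t0, Z (w @ concat (map (\<lambda>_. [2]) c)) [], t2, Z [] c, t4, t5] (length c * (1 + 4) + 4)"
    unfolding put_each_def
    by (rule runs_foreach[where st = "\<lambda>t w. [t0, Z w [], t2, t, t4, t5]"])
      (use assms in \<open>simp_all add: runs_put_1\<close>)
  have r: "concat (replicate n [2::nat]) = replicate n 2" for n by (induction n) auto
  show ?thesis using * unfolding concat_map_const r by (rule runs_mono) simp
qed

text \<open>Tapes 2, 3 and 4 hold \<open>d\<close>, \<open>h\<close> and \<open>k\<close> in unary; tape 5 holds \<open>h\<close> again for the nested loops
  over \<open>h\<close> and \<open>h\<close>.\<close>

definition vest_prep :: prog where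
  "vest_prep = read_param ;; emit [2, 2, 9] ;; rt 0 ;; count_cols ;; skip_to 8 ;; count_rows_prog ;;
     rew 0 ;; rew 2 ;; rew 3 ;; rew 4 ;; rew 5 ;; put_each 2 ;; put_each 3 ;; emit [2, 2, 2, 9]"

definition vest_mats :: prog where
  "vest_mats = skip_to 6 ;; until 0 8 extend_mat ;; rew 0"

definition vest_last :: prog where
  "vest_last = skip_to 9 ;; until 0 6 vec_row ;; skip_to 8 ;; copy_rows ;;
     zero_row (zero_entry @ zero_entry @ zero_entry) ;;
     zeros 2 ;; zeros 3 ;; emit zero_entry ;; neg_pow ;; neg_pow ;; emit [6] ;;
     zero_row (zero_entry @ one_entry @ one_entry) ;; emit [7, 8]"

text \<open>The input is read three times. The dimension of the output comes first, but
  \<open>h\<close> is known only after reading \<open>S\<close> at the end of the input; and the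
  separator, which needs \<open>v\<close> and \<open>S\<close>, is emitted after the extended
  \<open>T\<close>, although \<open>v\<close> precedes the \<open>T\<close> in the input.\<close>

definition vest_prog :: prog where
  "vest_prog = vest_prep ;; vest_mats ;; vest_last"

definition vest_in :: "nat \<Rightarrow> nat list list \<Rightarrow> nat list list list \<Rightarrow> nat list list \<Rightarrow> nat list" where
  "vest_in k xs ms rs = replicate k 2 @ 9 # entries_code xs @ 6 # mats_code ms @ 8 # rows_code rs @ [7]"

definition vest_out :: "nat \<Rightarrow> nat list list \<Rightarrow> nat list list list \<Rightarrow> nat list list \<Rightarrow> nat list" where
  "vest_out k xs ms rs = (let d = length xs; h = length rs in
     replicate k 2 @ [2, 2, 9] @ replicate d 2 @ replicate h 2 @ [2, 2, 2, 9] @ mats_out d h ms @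
     vec_rows_out d h xs @ rows_out h rs @
     zero_row_out d h (zero_entry @ zero_entry @ zero_entry) @
     zero_row_out d h (zero_entry @ neg_pow_out k @ neg_pow_out k) @
     zero_row_out d h (zero_entry @ one_entry @ one_entry) @ [7, 8])"

text \<open>Applied to items that end with a delimiter: there are at most as many of them as
  symbols, which bounds all counts by \<open>N\<close>.\<close>

lemma length_concat_ge: "(\<And>x. x \<in> set xs \<Longrightarrow> 1 \<le> length (f x)) \<Longrightarrow> length xs \<le> length (concat (map f xs))"
proof (induction xs)
  case (Cons x xs)
  then have "length xs \<le> length (concat (map f xs))" "1 \<le> length (f x)" by auto
  then show ?case by simp
qed simp

lemma length_concat_mem: "x \<in> set xs \<Longrightarrow> length (f x) \<le> length (concat (map f xs))"
  by (induction xs) auto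

lemma runs_vest_prog:
  assumes xs: "\<forall>x\<in>set xs. set x \<subseteq> {1..4}"
    and ms: "\<forall>ra\<in>set ms. \<forall>r\<in>set ra. set r \<subseteq> {1..5}" and rs: "\<forall>r\<in>set rs. set r \<subseteq> {1..5}"
    and N: "N = length (vest_in k xs ms rs)"
  shows "\<exists>us. runs vest_prog (Z [] (vest_in k xs ms rs) # replicate 5 (Z [] [])) us (2000 * N ^ 3) \<and>
    us ! 1 = Z (vest_out k xs ms rs) []"
proof -
  define d h where "d = length xs" and "h = length rs"
  let ?c = "\<lambda>n. replicate n (2 :: nat)"
  have len: "k \<le> N" "length (entries_code xs) \<le> N" "length (mats_code ms) \<le> N" "length (rows_code rs) \<le> N"
    by (auto simp: N vest_in_def)
  have N1: "1 \<le> N" by (simp add: N vest_in_def)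
  have dN: "d \<le> N" using length_concat_ge[of xs "\<lambda>x. x @ [5]"] len(2) by (simp add: d_def entries_code_def)
  have hN: "h \<le> N" using length_concat_ge[of rs "\<lambda>x. x @ [6]"] len(4) by (simp add: h_def rows_code_def)
  have mN: "length ms \<le> N" using length_concat_ge[of ms "\<lambda>rs. rows_code rs @ [7]"] len(3) by (simp add: mats_code_def)
  have xN: "length x \<le> N" if "x \<in> set xs" for x
    using length_concat_mem[OF that, of "\<lambda>x. x @ [5]"] len(2) by (simp add: entries_code_def)
  have rN: "length r \<le> N" if "r \<in> set rs" for r
    using length_concat_mem[OF that, of "\<lambda>x. x @ [6]"] len(4) by (simp add: rows_code_def)
  have mrN: "length (rows_code ra) \<le> N" if "ra \<in> set ms" for ra
    using length_concat_mem[OF that, of "\<lambda>rs. rows_code rs @ [7]"] len(3) by (simp add: mats_code_def)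
  have mrN1: "length ra \<le> N" if "ra \<in> set ms" for ra
    using length_concat_ge[of ra "\<lambda>x. x @ [6]"] mrN[OF that] by (simp add: rows_code_def)
  have mrN2: "length r \<le> N" if "ra \<in> set ms" "r \<in> set ra" for ra r
    using length_concat_mem[OF that(2), of "\<lambda>x. x @ [6]"] mrN[OF that(1)] by (simp add: rows_code_def)
  have e: "set (entries_code xs) \<subseteq> {1..5}"
  proof -
    have "{1..4} \<subseteq> {1..5::nat}" by auto
    then have "\<forall>x\<in>set xs. set x \<subseteq> {1..5}" using xs by blast
    then show ?thesis by (auto simp: entries_code_def)
  qed
  have six: "set (rows_code ra) \<subseteq> {1..6}" if "\<forall>r\<in>set ra. set r \<subseteq> {1..5}" for ra
  proof -
    have "{1..5} \<subseteq> {1..6::nat}" by auto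
    then have "\<forall>r\<in>set ra. set r \<subseteq> {1..6}" using that by blast
    then show ?thesis by (auto simp: rows_code_def)
  qed
  have r: "set (rows_code rs) \<subseteq> {1..6}" using six rs by blast
  have mr: "set (rows_code ra) \<subseteq> {1..7}" if "ra \<in> set ms" for ra
    using six[of ra] ms that by (force simp del: One_nat_def)
  have m: "set (mats_code ms) \<subseteq> {1..7}"
  proof -
    have "set (rows_code ra @ [7]) \<subseteq> {1..7}" if "ra \<in> set ms" for ra using mr[OF that] by simp
    then show ?thesis unfolding mats_code_def by (simp only: set_concat set_map) blast
  qed
  have x5: "\<forall>x\<in>set xs. 5 \<notin> set x" using xs by force
  have r6: "\<forall>x\<in>set rs. 6 \<notin> set x" using rs by force
  have A: "6 \<notin> set (entries_code xs)" "8 \<notin> set (6 # mats_code ms)" "7 \<notin> set (rows_code rs)"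
    "6 \<notin> set (?c k @ 9 # entries_code xs)" "9 \<notin> set (?c k)"
    using e r m by force+
  have z: "0 \<notin> set (?c n)" "0 \<notin> set (entries_code xs)" "0 \<notin> set (mats_code ms)" "0 \<notin> set (rows_code rs)" for n
    using e r m by force+
  define IN where "IN = vest_in k xs ms rs"
  have in1: "?c k @ 9 # entries_code xs @ 6 # mats_code ms @ 8 # rows_code rs @ [7] = IN"
    by (simp add: IN_def vest_in_def)
  have in2: "(?c k @ 9 # entries_code xs) @ 6 # mats_code ms @ 8 # rows_code rs @ [7] = IN"
    by (simp add: IN_def vest_in_def)
  define w1 where "w1 = ?c k @ [2, 2, 9] @ ?c d @ ?c h @ [2, 2, 2, 9]"
  \<comment> \<open>The head stands on the end marker 6 of the vector, which is therefore skipped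
    together with the matrices.\<close>
  have skip8: "runs (skip_to 8) [Z u (6 # mats_code ms @ 8 # v), t1, t2, t3, t4, t5]
      [Z (u @ 6 # mats_code ms @ [8]) v, t1, t2, t3, t4, t5] (2 * N + 4)" for u v t1 t2 t3 t4 t5
    using runs_skip_to[OF A(2), of u v t1 t2 t3 t4 t5, unfolded append_Cons]
    by (rule runs_mono) (use len(3) in simp)
  note cnt = count_entries[OF x5] count_rows[OF r6] d_def[symmetric] h_def[symmetric]
  have 1: "runs vest_prep [Z [] IN, Z [] [], Z [] [], Z [] [], Z [] [], Z [] []]
    [Z [] IN, Z w1 [], Z [] (?c d), Z [] (?c h), Z [] (?c k), Z [] (?c h)] (100 * N)"
    unfolding vest_prep_def in1[symmetric]
    apply (rule runs_cong)
      apply (rule runs_Seq[OF runs_read_param])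
      apply (rule runs_Seq[OF runs_emit])
      apply (rule runs_Seq[OF runs_rt])
      apply (rule runs_Seq[OF runs_count_cols[OF A(1)]])
      apply (rule runs_Seq[OF skip8])
      apply (rule runs_Seq[OF runs_count_rows[OF A(3)]])
      apply (rule runs_Seq[OF runs_rew0], simp add: z)
      apply (rule runs_Seq[OF runs_rew2], simp add: z cnt)
      apply (rule runs_Seq[OF runs_rew3], simp add: z cnt)
      apply (rule runs_Seq[OF runs_rew4], simp add: z cnt)
      apply (rule runs_Seq[OF runs_rew5], simp add: z cnt)
      apply (rule runs_Seq[OF runs_put_each_2], simp add: z cnt)
      apply (rule runs_Seq[OF runs_put_each_3], simp add: z cnt)
      apply (rule runs_emit)
     apply (simp add: cnt w1_def)
    using len dN hN N1 by (simp add: cnt)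
  have mats_ok: "\<forall>ra\<in>set ms. length ra \<le> N \<and> (\<forall>r\<in>set ra. row_ok N r)"
    using mrN1 mrN2 ms by (auto simp: row_ok_def)
  have rows_ok: "\<forall>r\<in>set rs. row_ok N r" using rs rN by (auto simp: row_ok_def)
  have N2: "N \<le> N * N" "N * N \<le> N * (N * N)" using N1 by simp_all
  \<comment> \<open>Naming the powers of \<open>N\<close> makes the remaining bounds linear in
    \<open>N\<close>, \<open>Q\<close> and \<open>R\<close>, with \<open>N \<le> Q \<le> R\<close>
    as the only facts needed about them.\<close>
  obtain Q R where Q: "Q = N * N" and R: "R = N * (N * N)" and QR: "N \<le> Q" "Q \<le> R"
    using N2 by blast
  have eq: "N * Suc (30 * (N * N) + 200 * N + 200) = 30 * (N * (N * N)) + 200 * (N * N) + 201 * N"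
    by (simp add: algebra_simps)
  have eq2: "N * Suc (21 * N + 30) = 21 * (N * N) + 31 * N" "N * Suc (12 * N + 50) = 12 * (N * N) + 51 * N"
    by (simp_all add: algebra_simps)
  have 2: "runs vest_mats [Z [] IN, Z w1 [], Z [] (?c d), Z [] (?c h), Z [] (?c k), Z [] (?c h)]
    [Z [] IN, Z (w1 @ mats_out d h ms) [], Z [] (?c d), Z [] (?c h), Z [] (?c k), Z [] (?c h)] (600 * (N * (N * N)))"
    unfolding vest_mats_def
    apply (subst in2[symmetric])
    apply (rule runs_cong)
      apply (rule runs_Seq[OF runs_skip_to[OF A(4)]])
      apply (rule runs_Seq[OF runs_extend_mats[OF z(1) _ z(1) _ z(1) _ mats_ok mN]])
         apply (simp_all add: dN hN)[3]
      apply (rule runs_rew0)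
      apply (simp add: z)
     apply (simp add: in1)
    unfolding eq unfolding R[symmetric] unfolding Q[symmetric] using len QR N1 by simp
  have hNN: "length rs \<le> N" "length xs \<le> N" using hN dN by (simp_all add: h_def d_def)
  have xs_ok: "\<forall>x\<in>set xs. set x \<subseteq> {1..4} \<and> length x \<le> N" using xs xN by blast
  define S2 where "S2 = [Z [] IN, Z (w1 @ mats_out d h ms) [], Z [] (?c d), Z [] (?c h), Z [] (?c k), Z [] (?c h)]"
  have 3: "\<exists>us. runs vest_last S2 us (400 * (N * N)) \<and> us ! 1 = Z (vest_out k xs ms rs) []"
    unfolding vest_last_def S2_def in1[symmetric]
    \<comment> \<open>The final tapes stay schematic and are instantiated by the run; only the
      output tape is inspected.\<close>
    apply (intro exI conjI)
     apply (rule runs_mono)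
      apply (rule runs_Seq[OF runs_skip_to[OF A(5)]])
      apply (rule runs_Seq[OF runs_vec_rows[OF z(1) _ z(1) _ xs_ok hNN(2)]])
        apply (simp_all add: dN hN)[2]
      apply (rule runs_Seq[OF skip8])
      apply (rule runs_Seq[OF runs_copy_rows[OF z(1) _ rows_ok hNN(1)]])
       apply (simp add: hN)
      apply (rule runs_Seq[OF runs_zero_row[OF z(1) z(1), where N = N]])
         apply (simp_all add: dN hN)[3]
      apply (rule runs_Seq[OF runs_zeros_2[OF z(1)]])
      apply (rule runs_Seq[OF runs_zeros_3[OF z(1)]])
      apply (rule runs_Seq[OF runs_emit])
      apply (rule runs_Seq[OF runs_neg_pow[OF z(1)]])
      apply (rule runs_Seq[OF runs_neg_pow[OF z(1)]])
      apply (rule runs_Seq[OF runs_emit])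
      apply (rule runs_Seq[OF runs_zero_row[OF z(1) z(1), where N = N]])
         apply (simp_all add: dN hN)[3]
      apply (rule runs_emit)
     subgoal unfolding eq2 unfolding Q[symmetric] using len QR N1 dN hN by simp
    apply (simp add: vest_out_def Let_def zero_row_out_def w1_def d_def h_def)
    done
  then obtain us where us: "runs vest_last S2 us (400 * (N * N))" "us ! 1 = Z (vest_out k xs ms rs) []"
    by blast
  have "runs vest_prog [Z [] IN, Z [] [], Z [] [], Z [] [], Z [] [], Z [] []] us (2000 * N ^ 3)"
    unfolding vest_prog_def
    apply (rule runs_mono[OF runs_Seq[OF 1 runs_Seq[OF 2[folded S2_def] us(1)]]])
    unfolding power3_eq_cube mult.assoc unfolding R[symmetric] unfolding Q[symmetric] using QR by simp
  then show ?thesis using us(2) by (auto simp: IN_def numeral_eq_Suc)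
qed

section \<open>The machine from matrix products to VEST\<close>

text \<open>One pass over tape 5 emits a row and also prepares the next one: when the 3 is met, it
  is replaced by 2 and written again one cell further to the right, unless the tape ends
  there.\<close>

definition id_row :: prog where
  "id_row = until 5 0 (Cond (\<lambda>xs. xs ! 5 = 3)
       (emit one_entry ;; put 5 2 ;; Cond (\<lambda>xs. xs ! 5 \<noteq> 0) (emit zero_entry ;; put 5 3) (emit []))
       (emit zero_entry ;; rt 5)) ;; rew 5 ;; emit [6]"

text \<open>The symbol 3 marks the position of the one in the current row of the identity matrix.\<close>

definition marked :: "nat \<Rightarrow> nat \<Rightarrow> nat list" where
  "marked d i = (if i < d then replicate i 2 @ 3 # replicate (d - Suc i) 2 else replicate d 2)"

lemma zs_0 [simp]: "zs 0 = []"
  by (simp add: zs_def)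

lemma zs_Suc': "zs (Suc n) = zero_entry @ zs n"
  by (simp add: zs_def)

lemma zs_Suc: "zs (Suc n) = zs n @ zero_entry"
  by (induction n) (simp_all add: zs_Suc')

lemma runs_id_row:
  assumes i: "i < d"
  shows "runs id_row [t0, Z w [], t2, t3, t4, Z [] (marked d i)]
    [t0, Z (w @ zs i @ one_entry @ zs (d - Suc i) @ [6]) [], t2, t3, t4, Z [] (marked d (Suc i))]
    (20 * d + 30)"
proof -
  let ?b = "\<lambda>xs :: nat list. xs ! 5 \<noteq> 0"
  define p where "p = Cond (\<lambda>xs. xs ! 5 = 3)
       (emit one_entry ;; put 5 2 ;; Cond (\<lambda>xs. xs ! 5 \<noteq> 0) (emit zero_entry ;; put 5 3) (emit []))
       (emit zero_entry ;; rt 5)"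
  define m where "m = d - Suc i"
  let ?c = "\<lambda>n. replicate n (2 :: nat)"
  have zero: "runs p [t0, Z w [], t2, t3, t4, Z u (2 # v)]
      [t0, Z (w @ zero_entry) [], t2, t3, t4, Z (u @ [2]) v] 7" for w u v
    unfolding p_def
    apply (rule runs_cong)
      apply (rule runs_CondF, simp)
      apply (rule runs_Seq[OF runs_emit])
      apply (rule runs_single, simp)
      apply (rule refl)
     apply simp_all
    done
  have one0: "runs p [t0, Z w [], t2, t3, t4, Z u [3]]
      [t0, Z (w @ one_entry) [], t2, t3, t4, Z (u @ [2]) []] 14" for w u
    unfolding p_def
    apply (rule runs_cong)
      apply (rule runs_CondT, simp)
      apply (rule runs_Seq[OF runs_emit])
      apply (rule runs_Seq)
       apply (rule runs_single, simp)
       apply (rule refl)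
      apply (rule runs_CondF, simp)
      apply simp
      apply (rule runs_emit)
     apply simp_all
    done
  have one1: "runs p [t0, Z w [], t2, t3, t4, Z u (3 # 2 # v)]
      [t0, Z (w @ one_entry @ zero_entry) [], t2, t3, t4, Z (u @ [2, 3]) v] 14" for w u v
    unfolding p_def
    apply (rule runs_cong)
      apply (rule runs_CondT, simp)
      apply (rule runs_Seq[OF runs_emit])
      apply (rule runs_Seq)
       apply (rule runs_single, simp)
       apply (rule refl)
      apply (rule runs_CondT, simp)
      apply (rule runs_Seq)
       apply simp
       apply (rule runs_emit)
      apply (rule runs_single, simp)
      apply (rule refl)
     apply simp_all
    done
  have tail: "runs (While ?b p) [t0, Z w [], t2, t3, t4, Z u (?c n)]
     [t0, Z (w @ zs n) [], t2, t3, t4, Z (u @ ?c n) []] (n * Suc 7 + 1)" for w u n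
  proof -
    have "runs (While ?b p) ((\<lambda>u v w. [t0, Z w [], t2, t3, t4, Z u v]) u (concat (map (\<lambda>x. [x]) (?c n)) @ []) w)
       ((\<lambda>u v w. [t0, Z w [], t2, t3, t4, Z u v]) (u @ concat (map (\<lambda>x. [x]) (?c n))) []
         (w @ concat (map (\<lambda>x. zero_entry) (?c n)))) (length (?c n) * Suc 7 + 1)"
      by (rule runs_While_list) (use zero in auto)
    then show ?thesis unfolding concat_map_single by (simp add: zs_def)
  qed
  \<comment> \<open>The round that meets the mark also consumes the following symbol in order to
    move the mark there; only if the mark is last does it consume a single symbol. So rounds and
    positions do not correspond, and the loop is split at this round.\<close>
  have middle: "runs (While ?b p) [t0, Z w [], t2, t3, t4, Z (?c i) (3 # ?c m)]
     [t0, Z (w @ one_entry @ zs m) [], t2, t3, t4, Z (marked d (Suc i)) []] (8 * m + 16)" for w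
  proof (cases m)
    case 0
    define s :: "nat \<Rightarrow> tape list" where "s = (\<lambda>j. if j = 0 then [t0, Z w [], t2, t3, t4, Z (?c i) [3]]
      else [t0, Z (w @ one_entry) [], t2, t3, t4, Z (?c i @ [2]) []])"
    have "runs (While ?b p) (s 0) [t0, Z (w @ one_entry @ zs 0) [], t2, t3, t4, Z ((?c i @ [2]) @ ?c 0) []]
        (1 * Suc 14 + (0 * Suc 7 + 1))"
      by (rule runs_While_prefix) (use one0 tail[of "w @ one_entry" "?c i @ [2]" 0] in \<open>auto simp: s_def\<close>)
    moreover have "marked d (Suc i) = ?c i @ [2]"
      using 0 i unfolding marked_def m_def by (metis Suc_leI diff_is_0_eq le_antisym not_less replicate_Suc replicate_append_same)
    ultimately show ?thesis using 0 by (simp add: s_def runs_mono)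
  next
    case (Suc m')
    define s :: "nat \<Rightarrow> tape list" where "s = (\<lambda>j. if j = 0 then [t0, Z w [], t2, t3, t4, Z (?c i) (3 # ?c m)]
      else [t0, Z (w @ one_entry @ zero_entry) [], t2, t3, t4, Z (?c i @ [2, 3]) (?c m')])"
    have "runs (While ?b p) (s 0) [t0, Z ((w @ one_entry @ zero_entry) @ zs m') [], t2, t3, t4, Z ((?c i @ [2, 3]) @ ?c m') []]
        (1 * Suc 14 + (m' * Suc 7 + 1))"
      by (rule runs_While_prefix)
        (use one1 tail[of "w @ one_entry @ zero_entry" "?c i @ [2, 3]" m'] in \<open>auto simp: s_def Suc\<close>)
    moreover have "marked d (Suc i) = ?c i @ [2, 3] @ ?c m'"
    proof -
      have "d - Suc (Suc i) = m'" "Suc i < d" using Suc m_def by auto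
      then show ?thesis by (simp add: marked_def replicate_app_Cons_same)
    qed
    ultimately show ?thesis using Suc by (simp add: s_def runs_mono zs_Suc')
  qed
  have 1: "runs (While ?b p) [t0, Z w [], t2, t3, t4, Z [] (?c i @ 3 # ?c m)]
     [t0, Z ((w @ zs i) @ one_entry @ zs m) [], t2, t3, t4, Z (marked d (Suc i)) []] (i * Suc 7 + (8 * m + 16))"
  proof -
    define s :: "nat \<Rightarrow> tape list" where "s = (\<lambda>j. [t0, Z (w @ zs j) [], t2, t3, t4, Z (?c j) (?c (i - j) @ 3 # ?c m)])"
    have "runs (While ?b p) (s 0) [t0, Z ((w @ zs i) @ one_entry @ zs m) [], t2, t3, t4, Z (marked d (Suc i)) []]
       (i * Suc 7 + (8 * m + 16))"
    proof (rule runs_While_prefix)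
      fix j assume j: "j < i"
      then have c: "?c (i - j) = 2 # ?c (i - Suc j)"
        by (metis Suc_diff_Suc replicate_Suc)
      show "map read (s j) ! 5 \<noteq> 0" by (simp add: s_def c)
      show "runs p (s j) (s (Suc j)) 7"
        using zero[of "w @ zs j" "?c j" "?c (i - Suc j) @ 3 # ?c m"]
        by (simp add: s_def c zs_Suc replicate_append_same)
    next
      show "runs (While ?b p) (s i) [t0, Z ((w @ zs i) @ one_entry @ zs m) [], t2, t3, t4, Z (marked d (Suc i)) []]
         (8 * m + 16)"
        using middle[of "w @ zs i"] by (simp add: s_def)
    qed
    then show ?thesis by (simp add: s_def)
  qed
  have mk: "marked d i = ?c i @ 3 # ?c m" using i by (simp add: marked_def m_def)
  have z: "0 \<notin> set (marked d (Suc i))" by (auto simp: marked_def)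
  have l: "length (marked d (Suc i)) = d" by (auto simp: marked_def)
  show ?thesis
    unfolding id_row_def p_def[symmetric] mk
    apply (rule runs_cong)
      apply (rule runs_Seq[OF 1])
      apply (rule runs_Seq[OF runs_rew5[OF z]])
      apply (rule runs_emit)
     apply (simp add: m_def)
    using i by (simp add: l m_def)
qed

section \<open>Unary arithmetic for the exponents of the test vector\<close>

definition read_dim :: prog where
  "read_dim = until 0 9 (cp 0 2 ;; cp 0 5 ;; rt 0)"

lemma runs_read_dim:
  "runs read_dim [Z u (replicate d 2 @ 9 # v), t1, Z [] [], t3, t4, Z [] []]
    [Z (u @ replicate d 2) (9 # v), t1, Z (replicate d 2) [], t3, t4, Z (replicate d 2) []] (4 * d + 1)"
proof -
  have *: "runs (cp 0 2 ;; cp 0 5 ;; rt 0) [Z u (x # v), t1, Z w [], t3, t4, Z w []]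
      [Z (u @ [x]) v, t1, Z (w @ [x]) [], t3, t4, Z (w @ [x]) []] 3" for u x v w
    by (rule runs_mono, rule runs_Seq[OF runs_single runs_Seq[OF runs_single runs_rt]]) simp+
  have "runs read_dim [Z u (concat (map (\<lambda>x. [x]) (replicate d 2)) @ 9 # v), t1, Z [] [], t3, t4, Z [] []]
     [Z (u @ concat (map (\<lambda>x. [x]) (replicate d 2))) (9 # v), t1, Z ([] @ concat (map (\<lambda>x. [x]) (replicate d 2))) [], t3, t4,
      Z ([] @ concat (map (\<lambda>x. [x]) (replicate d 2))) []] (length (replicate d (2::nat)) * Suc 3 + 1)"
    unfolding read_dim_def
    by (rule runs_While_list[where st = "\<lambda>u v w. [Z u v, t1, Z w [], t3, t4, Z w []]"])
      (use * in \<open>auto split: if_splits\<close>)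
  then show ?thesis unfolding concat_map_single append_Nil by (rule runs_mono) simp
qed

text \<open>Multiplication by nested loops: the outer one over the unary counter
  \<open>k + 1\<close>, the inner one over the whole input, which thereby acts as a unary number.
  The counter is \<open>k + 1\<close> rather than \<open>k\<close> so that the gap exceeds the
  required bound strictly, even for \<open>k = 0\<close>.\<close>

definition make_gap :: prog where
  "make_gap = foreach 4 (foreach 0 (put 3 2 ;; put 3 2))"

lemma concat_replicate_replicate: "concat (replicate m (replicate n x)) = replicate (m * n) x"
  by (induction m) (simp_all add: replicate_add)

lemma runs_make_gap:
  assumes "0 \<notin> set s" "0 \<notin> set c"
  shows "runs make_gap [Z [] s, t1, t2, Z [] [], Z [] c, t5]
    [Z [] s, t1, t2, Z (replicate (length c * (length s * 2)) 2) [], Z [] c, t5]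
    (length c * (6 * length s + 8) + 4)"
proof -
  have *: "runs (put 3 2 ;; put 3 2) [t0, t1, t2, Z w [], t4, t5] [t0, t1, t2, Z (w @ replicate 2 2) [], t4, t5] 2"
    for t0 t4 w by (rule runs_mono, rule runs_Seq[OF runs_single runs_single]) (simp add: numeral_2_eq_2)+
  have "runs (foreach 0 (put 3 2 ;; put 3 2)) [Z [] s, t1, t2, Z w [], t4, t5]
     [Z [] s, t1, t2, Z (w @ concat (map (\<lambda>_. replicate 2 2) s)) [], t4, t5] (length s * (2 + 4) + 4)" for w t4
    by (rule runs_foreach[where st = "\<lambda>t w. [t, t1, t2, Z w [], t4, t5]"])
      (use assms * in \<open>simp_all\<close>)
  note inner = this[unfolded concat_map_const concat_replicate_replicate]
  have "runs make_gap [Z [] s, t1, t2, Z [] [], Z [] c, t5]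
     [Z [] s, t1, t2, Z ([] @ concat (map (\<lambda>_. replicate (length s * 2) 2) c)) [], Z [] c, t5]
     (length c * ((length s * (2 + 4) + 4) + 4) + 4)"
    unfolding make_gap_def
    by (rule runs_foreach[where st = "\<lambda>t w. [Z [] s, t1, t2, Z w [], t, t5]"])
      (use assms inner in \<open>simp_all\<close>)
  then show ?thesis unfolding concat_map_const concat_replicate_replicate append_Nil
    by (rule runs_mono) (simp add: algebra_simps)
qed

definition to_end :: prog where
  "to_end = until 4 0 (rt 4)"

lemma runs_to_end:
  assumes "0 \<notin> set c"
  shows "runs to_end [t0, t1, t2, t3, Z [] c, t5] [t0, t1, t2, t3, Z c [], t5] (2 * length c + 1)"
proof -
  have "runs to_end [t0, t1, t2, t3, Z [] (concat (map (\<lambda>x. [x]) c) @ []), t5]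
     [t0, t1, t2, t3, Z ([] @ concat (map (\<lambda>x. [x]) c)) [], t5] (length c * Suc 1 + 1)"
    unfolding to_end_def
    by (rule runs_While_list[where st = "\<lambda>u v w. [t0, t1, t2, t3, Z u v, t5]"])
      (use assms in \<open>auto intro!: runs_mono[OF runs_single] gr0I\<close>)
  then show ?thesis unfolding concat_map_single append_Nil append_Nil2 by (rule runs_mono) simp
qed

text \<open>Tapes 2 and 5 hold \<open>d\<close> in unary, tape 4 the current exponent, and tape 3 the gap between
  consecutive exponents.\<close>

definition zp_prep :: prog where
  "zp_prep = read_param ;; emit [9] ;; put 4 2 ;; rt 0 ;; read_dim ;; rew 0 ;; rew 2 ;; rew 4 ;; rew 5 ;;
     make_gap ;; rew 3 ;; to_end"

text \<open>The encoded rational \<open>2 ^ e\<close>.\<close>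

definition pow_entry :: "nat \<Rightarrow> nat list" where
  "pow_entry e = 2 # replicate e 1 @ [4, 2, 5]"

lemma runs_put_4:
  "runs (put 4 a) [t0, t1, t2, t3, Z w [], t5] [t0, t1, t2, t3, Z (w @ [a]) [], t5] 1"
  by (rule runs_single) simp_all

text \<open>The exponent on tape 4 is never cleared; every entry appends one more gap to it. Since
  the tape still holds the \<open>k + 1\<close> symbols from which the gap was computed, all
  exponents are shifted by \<open>k + 1\<close>. This common power of two does not affect whether a
  product vanishes.\<close>

definition zp_entry :: prog where
  "zp_entry = foreach 3 (put 4 2) ;; rew 4 ;; put 1 2 ;; until 4 0 (put 1 1 ;; rt 4) ;; emit [4, 2, 5]"

lemma runs_zp_entry:
  assumes "g \<le> E" "e + g \<le> E"
  shows "runs zp_entry [t0, Z w [], t2, Z [] (replicate g 2), Z (replicate e 2) [], t5]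
    [t0, Z (w @ pow_entry (e + g)) [], t2, Z [] (replicate g 2), Z (replicate (e + g) 2) [], t5] (10 * E + 20)"
proof -
  have "runs (foreach 3 (put 4 2)) [t0, Z w [], t2, Z [] (replicate g 2), Z (replicate e 2) [], t5]
     [t0, Z w [], t2, Z [] (replicate g 2), Z (replicate e 2 @ concat (map (\<lambda>_. replicate 1 2) (replicate g (2::nat)))) [], t5]
     (length (replicate g (2::nat)) * (1 + 4) + 4)"
    by (rule runs_foreach[where st = "\<lambda>t c. [t0, Z w [], t2, t, Z c [], t5]"])
      (auto intro!: runs_mono[OF runs_single])
  note 1 = this[unfolded concat_map_const concat_replicate_replicate length_replicate mult_1_right replicate_add[symmetric]]
  define c where "c = replicate (e + g) (2 :: nat)"
  have z: "0 \<notin> set c" by (simp add: c_def)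
  have "runs (until 4 0 (put 1 1 ;; rt 4)) [t0, Z (w @ [2]) [], t2, t3, Z [] (concat (map (\<lambda>x. [x]) c) @ []), t5]
     [t0, Z ((w @ [2]) @ concat (map (\<lambda>_. replicate 1 1) c)) [], t2, t3, Z ([] @ concat (map (\<lambda>x. [x]) c)) [], t5]
     (length c * Suc 2 + 1)" for t3
    by (rule runs_While_list[where st = "\<lambda>u v w. [t0, Z w [], t2, t3, Z u v, t5]"])
      (use z in \<open>auto intro!: runs_mono[OF runs_Seq[OF runs_single runs_single]] gr0I\<close>)
  note 2 = this[unfolded concat_map_single concat_map_const concat_replicate_replicate append_Nil append_Nil2 mult_1_right]
  show ?thesis
    unfolding zp_entry_def
    apply (rule runs_cong)
      apply (rule runs_Seq[OF 1[folded c_def]])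
      apply (rule runs_Seq[OF runs_rew4[OF z, where v = "[]", unfolded append_Nil2]])
      apply (rule runs_Seq[OF runs_put_1[folded One_nat_def]])
      apply (rule runs_Seq[OF 2])
      apply (rule runs_emit)
     apply (simp add: c_def pow_entry_def)
    using assms by (simp add: c_def)
qed

definition zp_vec :: prog where
  "zp_vec = foreach 2 zp_entry ;; emit [6]"

lemma runs_zp_vec:
  assumes E: "g \<le> E" "e + d * g \<le> E"
  shows "runs zp_vec [t0, Z w [], Z [] (replicate d 2), Z [] (replicate g 2), Z (replicate e 2) [], t5]
    [t0, Z (w @ concat (map (\<lambda>j. pow_entry (e + Suc j * g)) [0..<d]) @ [6]) [], Z [] (replicate d 2),
     Z [] (replicate g 2), Z (replicate (e + d * g) 2) [], t5] (d * (10 * E + 24) + 6)"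
proof -
  define st where "st = (\<lambda>t i. [t0, Z (w @ concat (map (\<lambda>j. pow_entry (e + Suc j * g)) [0..<i])) [], t,
     Z [] (replicate g 2), Z (replicate (e + i * g) 2) [], t5])"
  have "runs (foreach 2 zp_entry) (st (Z [] (replicate d 2)) 0) (st (Z [] (replicate d 2)) (length (replicate d (2::nat))))
     (length (replicate d (2::nat)) * ((10 * E + 20) + 4) + 4)"
  proof (rule runs_foreach_nth)
    fix i assume "i < length (replicate d (2::nat))"
    then have "Suc i * g \<le> d * g" by (intro mult_right_mono) auto
    then have "e + i * g + g \<le> E" using E by simp
    then show "runs zp_entry (st (Z (take i (replicate d 2)) (drop i (replicate d 2))) i)
       (st (Z (take i (replicate d 2)) (drop i (replicate d 2))) (Suc i)) (10 * E + 20)"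
      unfolding st_def by (rule runs_cong[OF runs_zp_entry[OF E(1)]]) (simp_all add: algebra_simps)
  qed (auto simp: st_def)
  note 1 = this[unfolded st_def length_replicate]
  show ?thesis unfolding zp_vec_def
    by (rule runs_cong[OF runs_Seq[OF 1[simplified] runs_emit]]) (simp_all add: algebra_simps)
qed

definition id_mat :: prog where
  "id_mat = mark 5 3 ;; foreach 2 id_row ;; emit [7]"

definition id_out :: "nat \<Rightarrow> nat list" where
  "id_out d = concat (map (\<lambda>i. zs i @ one_entry @ zs (d - Suc i) @ [6]) [0..<d]) @ [7]"

text \<open>After the last row the mark has run off the tape, so tape 5 is restored to
  \<open>d\<close> in unary and the routine can be called again. For \<open>d = 0\<close> no row
  would remove the mark.\<close>

lemma runs_id_mat:
  assumes d: "d \<ge> 1"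
  shows "runs id_mat [t0, Z w [], Z [] (replicate d 2), t3, t4, Z [] (replicate d 2)]
    [t0, Z (w @ id_out d) [], Z [] (replicate d 2), t3, t4, Z [] (replicate d 2)] (d * (20 * d + 34) + 7)"
proof -
  define st where "st = (\<lambda>t i. [t0, Z (w @ concat (map (\<lambda>i. zs i @ one_entry @ zs (d - Suc i) @ [6]) [0..<i])) [], t,
     t3, t4, Z [] (marked d i)])"
  have "runs (foreach 2 id_row) (st (Z [] (replicate d 2)) 0) (st (Z [] (replicate d 2)) (length (replicate d (2::nat))))
     (length (replicate d (2::nat)) * ((20 * d + 30) + 4) + 4)"
  proof (rule runs_foreach_nth)
    fix i assume "i < length (replicate d (2::nat))"
    then have "i < d" by simp
    then show "runs id_row (st (Z (take i (replicate d 2)) (drop i (replicate d 2))) i)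
       (st (Z (take i (replicate d 2)) (drop i (replicate d 2))) (Suc i)) (20 * d + 30)"
      unfolding st_def by (rule runs_cong[OF runs_id_row]) simp_all
  qed (auto simp: st_def)
  moreover have "st t 0 = [t0, Z w [], t, t3, t4, Z [] (marked d 0)]" for t by (simp add: st_def)
  moreover have "st t d = [t0, Z (w @ concat (map (\<lambda>i. zs i @ one_entry @ zs (d - Suc i) @ [6]) [0..<d])) [], t, t3, t4,
     Z [] (replicate d 2)]" for t by (simp add: st_def marked_def)
  ultimately have 2: "runs (foreach 2 id_row) [t0, Z w [], Z [] (replicate d 2), t3, t4, Z [] (marked d 0)]
    [t0, Z (w @ concat (map (\<lambda>i. zs i @ one_entry @ zs (d - Suc i) @ [6]) [0..<d])) [], Z [] (replicate d 2), t3, t4, Z [] (replicate d 2)]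
    (d * (20 * d + 30 + 4) + 4)"
    by (simp only: length_replicate)
  have 1: "runs (mark 5 3) [t0, Z w [], Z [] (replicate d 2), t3, t4, Z [] (replicate d 2)]
    [t0, Z w [], Z [] (replicate d 2), t3, t4, Z [] (marked d 0)] 1"
    by (rule runs_single) (use d in \<open>cases d; simp add: marked_def\<close>)+
  show ?thesis unfolding id_mat_def
    by (rule runs_cong[OF runs_Seq[OF 1 runs_Seq[OF 2 runs_emit]]]) (simp_all add: id_out_def)
qed

text \<open>The identity is emitted twice: as the additional first matrix of the list, and at the
  end as \<open>S\<close>. Both unary numbers of the input are skipped before the matrices are
  copied.\<close>

definition zp_prog :: prog where
  "zp_prog = zp_prep ;; zp_vec ;; id_mat ;; skip_to 9 ;; skip_to 9 ;; copy_to 8 ;; emit [8] ;; id_mat"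

definition zp_in :: "nat \<Rightarrow> nat \<Rightarrow> nat list \<Rightarrow> nat list" where
  "zp_in k d s = replicate k 2 @ 9 # replicate d 2 @ 9 # s @ [8]"

definition zp_out :: "nat \<Rightarrow> nat \<Rightarrow> nat list \<Rightarrow> nat list" where
  "zp_out k d s = (let g = Suc k * (length (zp_in k d s) * 2) in
     replicate k 2 @ [9] @ concat (map (\<lambda>j. pow_entry (Suc k + Suc j * g)) [0..<d]) @ [6] @
     id_out d @ s @ [8] @ id_out d)"

lemma runs_zp_prog:
  assumes s: "set s \<subseteq> {1..7}" and d: "d \<ge> 1" and N: "N = length (zp_in k d s)"
  shows "\<exists>us. runs zp_prog (Z [] (zp_in k d s) # replicate 5 (Z [] [])) us (400 * N ^ 4) \<and>
    us ! 1 = Z (zp_out k d s) []"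
proof -
  let ?c = "\<lambda>n. replicate n (2 :: nat)"
  define g where "g = Suc k * (N * 2)"
  define IN where "IN = zp_in k d s"
  have s': "0 \<notin> set s" "8 \<notin> set s" using s by force+
  have z: "0 \<notin> set (?c n)" "0 \<notin> set IN" "9 \<notin> set (?c n)" for n
    using s' by (auto simp: IN_def zp_in_def)
  have len: "Suc k \<le> N" "d \<le> N" "length s \<le> N" "length IN = N" "1 \<le> N"
    by (auto simp: N zp_in_def IN_def)
  have in1: "?c k @ 9 # ?c d @ 9 # s @ [8] = IN" by (simp add: IN_def zp_in_def)
  have kc: "?c k @ [2] = ?c (Suc k)" by (simp add: replicate_append_same)
  obtain Q R P where Q: "Q = N * N" and R: "R = N * Q" and P: "P = N * R" and le: "N \<le> Q" "Q \<le> R" "R \<le> P"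
    using len(5) by simp
  have kQ: "Suc k * N \<le> Q" using len(1) unfolding Q by (rule mult_right_mono) simp
  then have gQ: "g \<le> 2 * Q" unfolding g_def by simp
  have gap: "runs make_gap [Z [] IN, t1, t2, Z [] [], Z [] (?c (Suc k)), t5]
    [Z [] IN, t1, t2, Z (?c g) [], Z [] (?c (Suc k)), t5] (6 * Q + 8 * N + 4)" for t1 t2 t5
  proof (rule runs_cong[OF runs_make_gap])
    have "Suc k * (6 * N + 8) = 6 * (Suc k * N) + 8 * Suc k" by (simp only: distrib_left mult.commute mult.left_commute)
    also have "\<dots> \<le> 6 * Q + 8 * N" by (intro add_mono mult_left_mono kQ len(1)) simp_all
    finally show "length (?c (Suc k)) * (6 * length IN + 8) + 4 \<le> 6 * Q + 8 * N + 4"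
      unfolding length_replicate len(4) by linarith
  qed (use z in \<open>simp_all add: g_def len\<close>)
  have rew: "runs (rew 0) [Z ((?c k @ [9]) @ ?c d) (9 # s @ [8]), t1, t2, t3, t4, t5] [Z [] IN, t1, t2, t3, t4, t5] (4 * N + 5)"
    for t1 t2 t3 t4 t5
    by (rule runs_cong[OF runs_rew0]) (use len in \<open>simp_all add: in1\<close>)
  have 1: "runs zp_prep [Z [] IN, Z [] [], Z [] [], Z [] [], Z [] [], Z [] []]
    [Z [] IN, Z (?c k @ [9]) [], Z [] (?c d), Z [] (?c g), Z (?c (Suc k)) [], Z [] (?c d)] (100 * Q)"
    unfolding zp_prep_def
    apply (subst in1[symmetric])
    apply (rule runs_cong)
      apply (rule runs_Seq[OF runs_read_param])
      apply (rule runs_Seq[OF runs_emit])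
      apply (rule runs_Seq[OF runs_put_4[where w = "?c k" and a = 2, unfolded kc]])
      apply (rule runs_Seq[OF runs_rt])
      apply (rule runs_Seq[OF runs_read_dim])
      apply (rule runs_Seq[OF rew])
      apply (rule runs_Seq[OF runs_rew2[OF z(1), where v = "[]", unfolded append_Nil2]])
      apply (rule runs_Seq[OF runs_rew4[OF z(1), where v = "[]", unfolded append_Nil2]])
      apply (rule runs_Seq[OF runs_rew5[OF z(1), where v = "[]", unfolded append_Nil2]])
      apply (rule runs_Seq[OF gap])
      apply (rule runs_Seq[OF runs_rew3[OF z(1), where v = "[]", unfolded append_Nil2]])
      apply (rule runs_to_end[OF z(1)])
     apply simp
    using len gQ le by simp
  \<comment> \<open>A bound for the largest exponent \<open>Suc k + d * g\<close>:
    \<open>Suc k\<close> and \<open>d\<close> are at most \<open>N\<close>, and \<open>g\<close> is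
    at most \<open>2 * Q\<close>.\<close>
  define E where "E = N + 2 * R"
  have E: "g \<le> E" "Suc k + d * g \<le> E"
  proof -
    show "g \<le> E" using gQ le unfolding E_def by linarith
    have "d * g \<le> N * (2 * Q)" using len(2) gQ by (rule mult_mono) simp_all
    also have "\<dots> = 2 * R" by (simp add: R)
    finally show "Suc k + d * g \<le> E" using len(1) unfolding E_def by linarith
  qed
  note vec = runs_mono[OF runs_zp_vec[OF E], of "34 * Q + 20 * P + 6"]
  have vec_le: "d * (10 * E + 24) + 6 \<le> 34 * Q + 20 * P + 6"
  proof -
    have "d * (10 * E + 24) \<le> N * (10 * E + 24)" using len(2) by (rule mult_right_mono) simp
    also have "\<dots> = 10 * Q + 20 * P + 24 * N" by (simp add: E_def Q P algebra_simps)
    finally show ?thesis using le by linarith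
  qed
  have id_le: "d * (20 * d + 34) + 7 \<le> 54 * Q + 7"
  proof -
    have "d * (20 * d + 34) \<le> N * (20 * N + 34)" using len(2) by (intro mult_mono) simp_all
    also have "\<dots> = 20 * Q + 34 * N" by (simp add: Q algebra_simps)
    finally show ?thesis using le by linarith
  qed
  have in2: "?c k @ 9 # (?c d @ 9 # s @ [8]) = IN" by (simp add: IN_def zp_in_def)
  define S where "S = [Z [] IN, Z (?c k @ [9]) [], Z [] (?c d), Z [] (?c g), Z (?c (Suc k)) [], Z [] (?c d)]"
  have 2: "\<exists>us. runs (zp_vec ;; id_mat ;; skip_to 9 ;; skip_to 9 ;; copy_to 8 ;; emit [8] ;; id_mat) S us (300 * P) \<and>
     us ! 1 = Z (zp_out k d s) []"
    unfolding S_def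
    apply (subst in2[symmetric])
    apply (intro exI conjI)
     apply (rule runs_mono)
      apply (rule runs_Seq[OF vec[OF vec_le]])
      apply (rule runs_Seq[OF runs_mono[OF runs_id_mat[OF d] id_le]])
      apply (rule runs_Seq[OF runs_skip_to[OF z(3)]])
      apply (rule runs_Seq[OF runs_skip_to[OF z(3)]])
      apply (rule runs_Seq[OF runs_copy_to[OF s'(2)]])
      apply (rule runs_Seq[OF runs_emit])
      apply (rule runs_mono[OF runs_id_mat[OF d] id_le])
     subgoal using len le by simp
    apply (simp add: zp_out_def Let_def g_def N)
    done
  then obtain us where us: "runs (zp_vec ;; id_mat ;; skip_to 9 ;; skip_to 9 ;; copy_to 8 ;; emit [8] ;; id_mat) S us (300 * P)"
    "us ! 1 = Z (zp_out k d s) []" by blast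
  have "N ^ 4 = P" by (simp add: P R Q numeral_eq_Suc)
  then have "100 * Q + 300 * P \<le> 400 * N ^ 4" using le by linarith
  from runs_mono[OF runs_Seq[OF 1 us(1)[unfolded S_def]] this]
  have "runs zp_prog [Z [] IN, Z [] [], Z [] [], Z [] [], Z [] [], Z [] []] us (400 * N ^ 4)"
    unfolding zp_prog_def .
  then show ?thesis using us(2) by (auto simp: IN_def numeral_eq_Suc)
qed

section \<open>Testing a matrix for zero on one vector\<close>

lemma mat_prod_Nil [simp]: "mat_prod d [] = 1\<^sub>m d"
  and mat_prod_Cons [simp]: "mat_prod d (A # As) = A * mat_prod d As"
  by (simp_all add: mat_prod_def)

lemma mat_prod_carrier: "set As \<subseteq> carrier_mat d d \<Longrightarrow> mat_prod d As \<in> carrier_mat d d"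
  by (induction As) auto

lemma mat_prod_append:
  "set As \<subseteq> carrier_mat d d \<Longrightarrow> set Bs \<subseteq> carrier_mat d d \<Longrightarrow>
     mat_prod d (As @ Bs) = mat_prod d As * mat_prod d Bs"
proof (induction As)
  case Nil
  then show ?case using left_mult_one_mat[OF mat_prod_carrier] by simp
next
  case (Cons A As)
  then have c: "A \<in> carrier_mat d d" "mat_prod d As \<in> carrier_mat d d" "mat_prod d Bs \<in> carrier_mat d d"
    by (simp_all add: mat_prod_carrier)
  have "mat_prod d ((A # As) @ Bs) = A * (mat_prod d As * mat_prod d Bs)" using Cons by simp
  also have "\<dots> = A * mat_prod d As * mat_prod d Bs" using c by (rule assoc_mult_mat[symmetric])
  finally show ?case by simp
qed

lemma vest_count_pos:
  assumes "vest_instance x"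
  shows "vest_count x k > 0 \<longleftrightarrow> (\<exists>Bs. length Bs = k \<and> set Bs \<subseteq> set (vest_T x) \<and>
    (vest_S x * mat_prod (vest_d x) Bs) *\<^sub>v vest_v x = 0\<^sub>v (vest_h x))"
proof -
  let ?T = "vest_T x"
  let ?P = "\<lambda>Bs. (vest_S x * mat_prod (vest_d x) Bs) *\<^sub>v vest_v x = 0\<^sub>v (vest_h x)"
  let ?I = "{is. length is = k \<and> set is \<subseteq> {..<length ?T} \<and> ?P (rev (map (\<lambda>i. ?T ! i) is))}"
  have "finite ?I"
    by (rule finite_subset[OF _ finite_lists_length_eq[of "{..<length ?T}" k]]) auto
  then have "vest_count x k > 0 \<longleftrightarrow> ?I \<noteq> {}" unfolding vest_count_def by (simp add: card_gt_0_iff)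
  also have "\<dots> \<longleftrightarrow> (\<exists>Bs. length Bs = k \<and> set Bs \<subseteq> set ?T \<and> ?P Bs)"
  proof
    assume "?I \<noteq> {}"
    then obtain ns where ns: "length ns = k" "set ns \<subseteq> {..<length ?T}" "?P (rev (map (\<lambda>i. ?T ! i) ns))" by blast
    show "\<exists>Bs. length Bs = k \<and> set Bs \<subseteq> set ?T \<and> ?P Bs"
      by (intro exI[of _ "rev (map (\<lambda>i. ?T ! i) ns)"]) (use ns in auto)
  next
    assume "\<exists>Bs. length Bs = k \<and> set Bs \<subseteq> set ?T \<and> ?P Bs"
    then obtain Bs where Bs: "length Bs = k" "set Bs \<subseteq> set ?T" "?P Bs" by blast
    \<comment> \<open>A matrix may be listed at several indices; any one of them serves.\<close>
    define f where "f B = (SOME i. i < length ?T \<and> ?T ! i = B)" for B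
    have f: "f B < length ?T \<and> ?T ! f B = B" if "B \<in> set Bs" for B
      unfolding f_def by (rule someI_ex) (use that Bs(2) in \<open>auto simp: in_set_conv_nth dest!: subsetD\<close>)
    then have "rev (map (\<lambda>i. ?T ! i) (rev (map f Bs))) = Bs"
      by (simp add: rev_map map_idI)
    then have "rev (map f Bs) \<in> ?I" using Bs f by auto
    then show "?I \<noteq> {}" by blast
  qed
  finally show ?thesis .
qed

text \<open>Identity factors are deleted from a vanishing product. Since \<open>1 \<noteq> 0\<close>
  for \<open>d \<ge> 1\<close>, some factor \<open>A\<close> remains, and copies of \<open>A\<close>
  on the left restore the length while the product stays zero.\<close>

lemma zero_product_insert_one:
  assumes As: "set As \<subseteq> carrier_mat d d" and d: "d \<ge> 1"
  shows "(\<exists>Bs. length Bs = k \<and> set Bs \<subseteq> set (1\<^sub>m d # As) \<and> mat_prod d Bs = 0\<^sub>m d d) \<longleftrightarrow>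
    (\<exists>Bs. length Bs = k \<and> set Bs \<subseteq> set As \<and> mat_prod d Bs = 0\<^sub>m d d)"
    (is "?l \<longleftrightarrow> ?r")
proof
  assume ?l
  then obtain Bs where Bs: "length Bs = k" "set Bs \<subseteq> set (1\<^sub>m d # As)" "mat_prod d Bs = 0\<^sub>m d d" by blast
  define Cs where "Cs = filter (\<lambda>B. B \<noteq> 1\<^sub>m d) Bs"
  have c: "set Xs \<subseteq> carrier_mat d d" if "set Xs \<subseteq> set (1\<^sub>m d # As)" for Xs using that As by auto
  have "mat_prod d (filter (\<lambda>B. B \<noteq> 1\<^sub>m d) Xs) = mat_prod d Xs" if "set Xs \<subseteq> set (1\<^sub>m d # As)" for Xs
    using that
  proof (induction Xs)
    case (Cons X Xs)
    have "mat_prod d Xs \<in> carrier_mat d d" by (rule mat_prod_carrier, rule c) (use Cons.prems in auto)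
    then show ?case using Cons by auto
  qed simp
  then have Cs0: "mat_prod d Cs = 0\<^sub>m d d" using Bs by (simp add: Cs_def)
  have one: "(1\<^sub>m d :: rat mat) \<noteq> 0\<^sub>m d d"
  proof
    assume "(1\<^sub>m d :: rat mat) = 0\<^sub>m d d"
    then have "(1\<^sub>m d :: rat mat) $$ (0, 0) = 0\<^sub>m d d $$ (0, 0)" by simp
    then show False using d by simp
  qed
  then obtain A Cs' where Cs: "Cs = A # Cs'" using Cs0 by (cases Cs) auto
  have sub: "set Cs \<subseteq> set As" using Bs(2) by (auto simp: Cs_def)
  have len: "length Cs \<le> k" using Bs(1) by (auto simp: Cs_def)
  define Ds where "Ds = replicate (k - length Cs) A @ Cs"
  have A: "set (replicate (k - length Cs) A) \<subseteq> set As" using sub Cs by auto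
  have "mat_prod d Ds = mat_prod d (replicate (k - length Cs) A) * mat_prod d Cs"
    unfolding Ds_def by (rule mat_prod_append) (use A sub As in auto)
  also have "\<dots> = 0\<^sub>m d d" unfolding Cs0
    by (rule right_mult_zero_mat[OF mat_prod_carrier]) (use A As in auto)
  finally show ?r using A sub len by (intro exI[of _ Ds]) (auto simp: Ds_def)
qed auto

text \<open>The lowest digit is divisible by the base and smaller in absolute value, hence 0;
  dividing by the base leaves the same situation with one digit less. Digits may be
  negative.\<close>

lemma signed_digits_zero:
  fixes a :: "nat \<Rightarrow> int"
  assumes "\<And>j. j < n \<Longrightarrow> \<bar>a j\<bar> < b" "(\<Sum>j<n. a j * b ^ j) = 0" "j < n"
  shows "a j = 0"
  using assms
proof (induction n arbitrary: a j)
  case (Suc n)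
  have s: "a 0 + b * (\<Sum>j<n. a (Suc j) * b ^ j) = 0"
    using Suc.prems(2) by (simp add: sum.lessThan_Suc_shift sum_distrib_left mult.left_commute del: sum.lessThan_Suc)
  then have "a 0 = b * (- (\<Sum>j<n. a (Suc j) * b ^ j))" by (simp add: eq_neg_iff_add_eq_0)
  then have "b dvd a 0" by (rule dvdI)
  moreover have "\<bar>a 0\<bar> < b" using Suc.prems(1)[of 0] by simp
  ultimately have a0: "a 0 = 0" using dvd_imp_le_int[of "a 0" b] by linarith
  have "b \<noteq> 0" using Suc.prems(1)[of 0] by auto
  then have "(\<Sum>j<n. a (Suc j) * b ^ j) = 0" using s a0 by simp
  then have "a (Suc j') = 0" if "j' < n" for j'
    using Suc.IH[of "\<lambda>j. a (Suc j)" j'] Suc.prems(1) that by simp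
  then show ?case using a0 Suc.prems(3) by (cases j) auto
qed simp

text \<open>Combines a common denominator \<open>q\<close> with a size bound \<open>c\<close> for
  the resulting integer, because both have to be carried through a product.\<close>

definition scaled :: "int \<Rightarrow> int \<Rightarrow> rat \<Rightarrow> bool" where
  "scaled q c r \<longleftrightarrow> (\<exists>z. of_int q * r = of_int z \<and> \<bar>z\<bar> \<le> c)"

lemma scaled_sum_mult:
  assumes "\<And>j. j < n \<Longrightarrow> scaled q c (a j)" "\<And>j. j < n \<Longrightarrow> scaled q' c' (b j)" "0 \<le> c"
  shows "scaled (q * q') (int n * c * c') (\<Sum>j<n. a j * b j)"
proof -
  have "\<forall>j\<in>{..<n}. \<exists>z. of_int q * a j = of_int z \<and> \<bar>z\<bar> \<le> c" using assms(1) by (simp add: scaled_def)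
  then obtain za where za: "\<forall>j\<in>{..<n}. of_int q * a j = of_int (za j) \<and> \<bar>za j\<bar> \<le> c"
    by (rule bchoice[THEN exE])
  have "\<forall>j\<in>{..<n}. \<exists>z. of_int q' * b j = of_int z \<and> \<bar>z\<bar> \<le> c'" using assms(2) by (simp add: scaled_def)
  then obtain zb where zb: "\<forall>j\<in>{..<n}. of_int q' * b j = of_int (zb j) \<and> \<bar>zb j\<bar> \<le> c'"
    by (rule bchoice[THEN exE])
  have "of_int (q * q') * (\<Sum>j<n. a j * b j) = (\<Sum>j<n. (of_int q * a j) * (of_int q' * b j))"
    by (simp add: sum_distrib_left algebra_simps)
  also have "\<dots> = (\<Sum>j<n. of_int (za j) * of_int (zb j))" using za zb by simp
  also have "\<dots> = of_int (\<Sum>j<n. za j * zb j)" by simp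
  finally have 1: "of_int (q * q') * (\<Sum>j<n. a j * b j) = of_int (\<Sum>j<n. za j * zb j)" .
  have "\<bar>\<Sum>j<n. za j * zb j\<bar> \<le> (\<Sum>j<n. \<bar>za j * zb j\<bar>)" by (rule sum_abs)
  also have "\<dots> \<le> (\<Sum>j<n. c * c')"
    by (rule sum_mono) (use za zb assms(3) in \<open>auto simp: abs_mult intro!: mult_mono\<close>)
  finally have "\<bar>\<Sum>j<n. za j * zb j\<bar> \<le> int n * c * c'" by simp
  with 1 show ?thesis unfolding scaled_def by blast
qed

definition scaled_mat :: "nat \<Rightarrow> int \<Rightarrow> int \<Rightarrow> rat mat \<Rightarrow> bool" where
  "scaled_mat d q c A \<longleftrightarrow> (\<forall>i<d. \<forall>j<d. scaled q c (A $$ (i, j)))"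

text \<open>An entry of a product is a sum of \<open>d\<close> products, so each factor multiplies
  the size bound by \<open>int d * c\<close> and the denominator by \<open>q\<close>.\<close>

lemma scaled_mat_prod:
  assumes "\<forall>A\<in>set As. A \<in> carrier_mat d d \<and> scaled_mat d q c A" "0 \<le> c"
  shows "scaled_mat d (q ^ length As) ((int d * c) ^ length As) (mat_prod d As)"
  using assms
proof (induction As)
  case Nil
  have "scaled 1 1 0" "scaled 1 1 1" by (auto simp: scaled_def intro: exI[of _ 0] exI[of _ 1])
  then show ?case by (auto simp: scaled_mat_def)
next
  case (Cons A As)
  then have A: "A \<in> carrier_mat d d" "mat_prod d As \<in> carrier_mat d d"
    by (auto intro!: mat_prod_carrier)
  have "scaled (q * q ^ length As) (int d * c * (int d * c) ^ length As) ((A * mat_prod d As) $$ (i, j))"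
    if ij: "i < d" "j < d" for i j
  proof -
    have "(A * mat_prod d As) $$ (i, j) = (\<Sum>l<d. A $$ (i, l) * mat_prod d As $$ (l, j))"
      using A ij by (simp add: scalar_prod_def atLeast0LessThan)
    moreover have "scaled (q * q ^ length As) (int d * c * (int d * c) ^ length As)
        (\<Sum>l<d. A $$ (i, l) * mat_prod d As $$ (l, j))"
      by (rule scaled_sum_mult) (use Cons ij in \<open>auto simp: scaled_mat_def\<close>)
    ultimately show ?thesis by simp
  qed
  then show ?case by (simp add: scaled_mat_def)
qed

section \<open>Size of rationals in terms of the length of their encoding\<close>

lemma enc_binary_bound: "n < 2 ^ length (enc_binary n)"
proof (induction n rule: enc_binary.induct)
  case (1 n)
  show ?case
  proof (cases "n < 2")
    case True
    then show ?thesis by (subst enc_binary.simps) auto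
  next
    case False
    then have "n div 2 < 2 ^ length (enc_binary (n div 2))" by (rule 1)
    then have "n < 2 * 2 ^ length (enc_binary (n div 2))" by linarith
    then show ?thesis using False by (subst enc_binary.simps) simp
  qed
qed

lemma quotient_bound:
  assumes "quotient_of r = (p, q)"
  shows "\<bar>p\<bar> \<le> 2 ^ length (enc_rat r)" "q \<le> 2 ^ length (enc_rat r)" "q > 0" "of_int q * r = of_int p"
proof -
  show q: "q > 0" using assms by (rule quotient_of_denom_pos)
  have len: "length (enc_binary (nat \<bar>p\<bar>)) \<le> length (enc_rat r)" "length (enc_binary (nat q)) \<le> length (enc_rat r)"
    using assms by (simp_all add: enc_rat_def)
  have *: "int n \<le> 2 ^ m" if "length (enc_binary n) \<le> m" for n m
  proof -
    have "n \<le> 2 ^ m" using enc_binary_bound[of n] power_increasing[OF that, of "2::nat"] by linarith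
    then show ?thesis by (metis of_nat_le_iff of_nat_numeral of_nat_power)
  qed
  show "\<bar>p\<bar> \<le> 2 ^ length (enc_rat r)" using *[OF len(1)] by simp
  show "q \<le> 2 ^ length (enc_rat r)" using *[OF len(2)] q by simp
  show "of_int q * r = of_int p" using quotient_of_div[OF assms] q by simp
qed

definition denom :: "rat \<Rightarrow> int" where
  "denom r = snd (quotient_of r)"

text \<open>The product of all denominators is taken as common denominator instead of the least one:
  each factor is at most 2 to the length of its encoding, and the lengths add up.\<close>

lemma prod_denom_bound:
  "0 < prod_list (map denom rs) \<and> prod_list (map denom rs) \<le> 2 ^ length (concat (map enc_rat rs))"
proof (induction rs)
  case (Cons r rs)
  have d: "0 < denom r" "denom r \<le> 2 ^ length (enc_rat r)"
    using quotient_bound[of r "fst (quotient_of r)" "denom r"] by (simp_all add: denom_def)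
  show ?case using Cons d by (simp add: power_add mult_mono)
qed simp

text \<open>For \<open>r = p / q\<close> and the product \<open>Q\<close> of all denominators,
  \<open>Q r = (Q / q) p\<close>. Both factors are at most \<open>2 ^ w\<close> in absolute value,
  whence the exponent \<open>2 * w\<close>.\<close>

lemma scaled_entry:
  assumes "r \<in> set rs" "length (concat (map enc_rat rs)) \<le> w"
  shows "scaled (prod_list (map denom rs)) (2 ^ (2 * w)) r"
proof -
  let ?Q = "prod_list (map denom rs)"
  obtain p q where pq: "quotient_of r = (p, q)" by fastforce
  obtain xs ys where rs: "rs = xs @ r # ys" using assms(1) by (meson split_list)
  then have "q dvd ?Q" using pq by (simp add: denom_def)
  then obtain m where m: "?Q = q * m" by blast
  have Q: "0 < ?Q" "?Q \<le> 2 ^ w"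
    using prod_denom_bound[of rs] power_increasing[OF assms(2), of "2::int"] by (auto intro: order_trans)
  have q: "q > 0" using quotient_bound[OF pq] by simp
  have m0: "0 < m" "m \<le> ?Q" using m q Q(1) by (auto simp: zero_less_mult_iff)
  have "length (enc_rat r) \<le> w" using assms(2) rs by simp
  then have p: "\<bar>p\<bar> \<le> 2 ^ w" using quotient_bound(1)[OF pq] power_increasing[of "length (enc_rat r)" w "2::int"] by linarith
  have "of_int ?Q * r = of_int (m * p)" using quotient_bound(4)[OF pq] by (simp add: m mult.assoc mult.left_commute)
  moreover have "\<bar>m * p\<bar> \<le> 2 ^ w * 2 ^ w"
    unfolding abs_mult using m0 Q p by (intro mult_mono) auto
  ultimately show ?thesis unfolding scaled_def mult_2 power_add by blast
qed

definition mat_entries :: "rat mat list \<Rightarrow> rat list" where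
  "mat_entries As = concat (map (\<lambda>A. concat (map list_of_vec (rows A))) As)"

lemma length_enc_entries: "length (concat (map enc_rat (mat_entries As))) \<le> length (enc_mats As)"
proof -
  have *: "length (concat (map enc_rat (concat (map list_of_vec vs)))) \<le> length (concat (map enc_vec vs))" for vs
    by (induction vs) (simp_all add: enc_vec_def)
  show ?thesis
  proof (induction As)
    case (Cons A As)
    then show ?case using *[of "rows A"] by (simp add: mat_entries_def enc_mats_def enc_mat_def)
  qed (simp add: mat_entries_def)
qed

lemma index_mem_mat_entries:
  assumes "A \<in> set As" "A \<in> carrier_mat d d" "i < d" "j < d"
  shows "A $$ (i, j) \<in> set (mat_entries As)"
proof -
  have "row A i \<in> set (rows A)" using assms by (auto simp: rows_def)
  moreover have "A $$ (i, j) \<in> set (list_of_vec (row A i))"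
    using assms by (auto simp: set_list_of_vec vec_set_def intro!: image_eqI[of _ _ j])
  ultimately show ?thesis using assms(1) by (auto simp: mat_entries_def)
qed

definition pow_vec :: "nat \<Rightarrow> nat \<Rightarrow> nat \<Rightarrow> rat vec" where
  "pow_vec d e g = vec d (\<lambda>j. 2 ^ (e + Suc j * g))"

text \<open>Coordinate \<open>i\<close> of the product, multiplied by \<open>q\<close>, is
  \<open>2 ^ (e + g)\<close> times a number whose digits in base \<open>2 ^ g\<close> are the scaled
  entries of row \<open>i\<close>. They are smaller than the base, so
  \<open>signed_digits_zero\<close> applies.\<close>

lemma mult_pow_vec_eq_0:
  assumes M: "M \<in> carrier_mat d d" "scaled_mat d q c M" and q: "q > 0" and c: "c < 2 ^ g"
    and zero: "M *\<^sub>v pow_vec d e g = 0\<^sub>v d"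
  shows "M = 0\<^sub>m d d"
proof (rule eq_matI)
  fix i j assume ij': "i < dim_row (0\<^sub>m d d :: rat mat)" "j < dim_col (0\<^sub>m d d :: rat mat)"
  then have ij: "i < d" "j < d" by simp_all
  have "\<forall>j\<in>{..<d}. \<exists>z. of_int q * M $$ (i, j) = of_int z \<and> \<bar>z\<bar> \<le> c"
    using M(2) ij by (simp add: scaled_mat_def scaled_def)
  then obtain z where z: "\<forall>j\<in>{..<d}. of_int q * M $$ (i, j) = of_int (z j) \<and> \<bar>z j\<bar> \<le> c"
    by (rule bchoice[THEN exE])
  have "(\<Sum>j<d. M $$ (i, j) * 2 ^ (e + Suc j * g)) = (M *\<^sub>v pow_vec d e g) $ i"
    using M(1) ij by (simp add: pow_vec_def scalar_prod_def atLeast0LessThan)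
  also have "\<dots> = 0" using zero ij by simp
  finally have "0 = of_int q * (\<Sum>j<d. M $$ (i, j) * 2 ^ (e + Suc j * g))" by simp
  also have "\<dots> = (\<Sum>j<d. of_int (z j) * 2 ^ (e + Suc j * g))"
    using z by (simp add: sum_distrib_left mult.assoc[symmetric])
  also have "\<dots> = 2 ^ (e + g) * of_int (\<Sum>j<d. z j * (2 ^ g) ^ j)"
  proof -
    have "2 ^ (e + Suc j * g) = (2 ^ (e + g) * (2 ^ g) ^ j :: rat)" for j
      by (simp only: power_mult[symmetric] power_add[symmetric]) (simp add: mult.commute)
    then show ?thesis by (simp add: sum_distrib_left mult_ac)
  qed
  finally have "rat_of_int (\<Sum>j<d. z j * (2 ^ g) ^ j) = 0" by (simp del: of_int_sum of_int_mult of_int_power)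
  then have "(\<Sum>j<d. z j * (2 ^ g) ^ j) = 0" by (simp only: of_int_eq_0_iff)
  then have "z j = 0" by (rule signed_digits_zero[rotated]) (use z c ij in \<open>auto intro: le_less_trans\<close>)
  then have "of_int q * M $$ (i, j) = 0" using z ij by simp
  then show "M $$ (i, j) = 0\<^sub>m d d $$ (i, j)" using ij q by simp
qed (use M in auto)

definition vest_of_zp :: "nat \<Rightarrow> nat \<Rightarrow> nat \<Rightarrow> rat mat list \<Rightarrow> vest" where
  "vest_of_zp e g d As = \<lparr>vest_d = d, vest_h = d, vest_v = pow_vec d e g,
     vest_T = 1\<^sub>m d # As, vest_S = 1\<^sub>m d\<rparr>"

lemma vest_of_zp_instance:
  "d \<ge> 1 \<Longrightarrow> set As \<subseteq> carrier_mat d d \<Longrightarrow> vest_instance (vest_of_zp e g d As)"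
  by (simp add: vest_instance_def vest_of_zp_def pow_vec_def)

text \<open>The condition on \<open>g\<close> comes from the bound for a product of \<open>k\<close>
  matrices: with \<open>w\<close> the encoding length of the list,
  \<open>(d * 2 ^ (2 * w)) ^ k\<close> is at most \<open>2 ^ ((d + 2 * w) * k)\<close>, because
  \<open>d \<le> 2 ^ d\<close>. Strictness is what the digit argument needs.\<close>

lemma vest_of_zp_yes:
  assumes d: "d \<ge> 1" and As: "set As \<subseteq> carrier_mat d d"
    and g: "(d + 2 * length (enc_mats As)) * k < g"
  shows "vest_count (vest_of_zp e g d As) k > 0 \<longleftrightarrow>
    (\<exists>Bs. length Bs = k \<and> set Bs \<subseteq> set As \<and> mat_prod d Bs = 0\<^sub>m d d)"
proof -
  let ?w = "length (enc_mats As)"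
  let ?Q = "prod_list (map denom (mat_entries As))"
  have Q: "0 < ?Q" "?Q \<le> 2 ^ (2 * ?w)"
  proof -
    show "0 < ?Q" using prod_denom_bound by blast
    have "?Q \<le> 2 ^ length (concat (map enc_rat (mat_entries As)))" using prod_denom_bound by blast
    also have "\<dots> \<le> 2 ^ (2 * ?w)" using length_enc_entries[of As] by (intro power_increasing) simp_all
    finally show "?Q \<le> 2 ^ (2 * ?w)" .
  qed
  have sc: "\<forall>A\<in>set (1\<^sub>m d # As). A \<in> carrier_mat d d \<and> scaled_mat d ?Q (2 ^ (2 * ?w)) A"
  proof
    fix A assume A: "A \<in> set (1\<^sub>m d # As)"
    have "scaled_mat d ?Q (2 ^ (2 * ?w)) (1\<^sub>m d)"
    proof -
      have "scaled ?Q (2 ^ (2 * ?w)) 0" "scaled ?Q (2 ^ (2 * ?w)) 1"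
        unfolding scaled_def using Q by (auto intro: exI[of _ 0] exI[of _ ?Q])
      then show ?thesis by (auto simp: scaled_mat_def)
    qed
    moreover have "scaled_mat d ?Q (2 ^ (2 * ?w)) A" if "A \<in> set As"
      unfolding scaled_mat_def
      using that As by (auto intro!: scaled_entry[OF _ length_enc_entries] index_mem_mat_entries)
    ultimately show "A \<in> carrier_mat d d \<and> scaled_mat d ?Q (2 ^ (2 * ?w)) A" using A As by auto
  qed
  have key: "mat_prod d Bs *\<^sub>v pow_vec d e g = 0\<^sub>v d \<longleftrightarrow> mat_prod d Bs = 0\<^sub>m d d"
    if Bs: "length Bs = k" "set Bs \<subseteq> set (1\<^sub>m d # As)" for Bs
  proof
    have c: "mat_prod d Bs \<in> carrier_mat d d" by (rule mat_prod_carrier) (use Bs As in auto)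
    have s: "scaled_mat d (?Q ^ k) ((int d * 2 ^ (2 * ?w)) ^ k) (mat_prod d Bs)"
    proof -
      have "\<forall>A\<in>set Bs. A \<in> carrier_mat d d \<and> scaled_mat d ?Q (2 ^ (2 * ?w)) A" using sc Bs(2) by blast
      from scaled_mat_prod[OF this] show ?thesis using Bs(1) by simp
    qed
    have "int d \<le> 2 ^ d" by (metis less_exp less_imp_le of_nat_le_iff of_nat_numeral of_nat_power)
    then have "(int d * 2 ^ (2 * ?w)) ^ k \<le> (2 ^ d * 2 ^ (2 * ?w)) ^ k"
      by (intro power_mono mult_right_mono) simp_all
    also have "\<dots> = 2 ^ ((d + 2 * ?w) * k)" by (simp only: power_add[symmetric] power_mult[symmetric])
    also have "\<dots> < 2 ^ g" using g by (intro power_strict_increasing) simp_all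
    finally show "mat_prod d Bs = 0\<^sub>m d d" if "mat_prod d Bs *\<^sub>v pow_vec d e g = 0\<^sub>v d"
      using mult_pow_vec_eq_0[OF c s _ _ that] Q by simp
    show "mat_prod d Bs *\<^sub>v pow_vec d e g = 0\<^sub>v d" if "mat_prod d Bs = 0\<^sub>m d d"
      unfolding that by (intro eq_vecI) (simp_all add: pow_vec_def)
  qed
  have left: "1\<^sub>m d * mat_prod d Bs = mat_prod d Bs" if "set Bs \<subseteq> set (1\<^sub>m d # As)" for Bs
    by (rule left_mult_one_mat[OF mat_prod_carrier]) (use that As in auto)
  have "vest_count (vest_of_zp e g d As) k > 0 \<longleftrightarrow>
      (\<exists>Bs. length Bs = k \<and> set Bs \<subseteq> set (1\<^sub>m d # As) \<and> (1\<^sub>m d * mat_prod d Bs) *\<^sub>v pow_vec d e g = 0\<^sub>v d)"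
    using vest_count_pos[OF vest_of_zp_instance[OF d As]] by (simp add: vest_of_zp_def)
  also have "\<dots> \<longleftrightarrow> (\<exists>Bs. length Bs = k \<and> set Bs \<subseteq> set (1\<^sub>m d # As) \<and> mat_prod d Bs = 0\<^sub>m d d)"
    using key left by (metis (no_types, lifting))
  also have "\<dots> \<longleftrightarrow> (\<exists>Bs. length Bs = k \<and> set Bs \<subseteq> set As \<and> mat_prod d Bs = 0\<^sub>m d d)"
    by (rule zero_product_insert_one[OF As d])
  finally show ?thesis .
qed

section \<open>The separator matrix\<close>

lemma mat_of_rows_mult_vec:
  assumes "set vs \<subseteq> carrier_vec n" "x \<in> carrier_vec n"
  shows "mat_of_rows n vs *\<^sub>v x = vec_of_list (map (\<lambda>r. r \<bullet> x) vs)"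
proof (rule eq_vecI)
  fix i assume i: "i < dim_vec (vec_of_list (map (\<lambda>r. r \<bullet> x) vs))"
  then have i: "i < length vs" by simp
  then have "vs ! i \<in> carrier_vec n" using assms(1) by auto
  then show "(mat_of_rows n vs *\<^sub>v x) $ i = vec_of_list (map (\<lambda>r. r \<bullet> x) vs) $ i"
    using i by (simp add: vec_of_list_index)
qed simp

lemma vec_of_list_append: "vec_of_list (xs @ ys) = vec_of_list xs @\<^sub>v vec_of_list ys"
  by (rule eq_vecI) (auto simp: vec_of_list_index nth_append)

lemma rows_mult_vec: "vec_of_list (map (\<lambda>r. r \<bullet> x) (rows A)) = A *\<^sub>v x"
  by (rule eq_vecI) (auto simp: vec_of_list_index)

text \<open>The blocks are the space of the \<open>T\<close>, the space that receives the values of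
  \<open>S\<close>, and a list with the start coordinate followed by the two automaton
  coordinates.\<close>

definition join :: "rat vec \<Rightarrow> rat vec \<Rightarrow> rat list \<Rightarrow> rat vec" where
  "join a b cs = a @\<^sub>v (b @\<^sub>v vec_of_list cs)"

lemma join_scalar_prod:
  assumes "a \<in> carrier_vec d" "a' \<in> carrier_vec d" "b \<in> carrier_vec h" "b' \<in> carrier_vec h"
  shows "join a b [x, y, z] \<bullet> join a' b' [x', y', z'] = a \<bullet> a' + b \<bullet> b' + (x * x' + y * y' + z * z')"
proof -
  have c: "vec_of_list [p, q, r] \<in> carrier_vec 3" for p q r :: rat by (rule carrier_vecI) simp
  have "vec_of_list [x, y, z] \<bullet> vec_of_list [x', y', z'] = x * x' + y * y' + z * z'"
  proof -
    have "{0..<length [x', y', z']} = {0, 1, 2}" by auto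
    then show ?thesis unfolding scalar_prod_def dim_vec_of_list vec_of_list_index by simp
  qed
  then show ?thesis
    unfolding join_def
      scalar_prod_append[OF assms(1) append_carrier_vec[OF assms(3) c] assms(2) append_carrier_vec[OF assms(4) c]]
      scalar_prod_append[OF assms(3) c assms(4) c] by simp
qed

lemma join_carrier: "a \<in> carrier_vec d \<Longrightarrow> b \<in> carrier_vec h \<Longrightarrow> join a b [x, y, z] \<in> carrier_vec (d + h + 3)"
  unfolding join_def by (rule carrier_vecI) simp

lemma join_cases:
  assumes "x \<in> carrier_vec (d + h + 3)"
  obtains a b p q r where "a \<in> carrier_vec d" "b \<in> carrier_vec h" "x = join a b [p, q, r]"
proof
  show "vec d (\<lambda>i. x $ i) \<in> carrier_vec d" "vec h (\<lambda>i. x $ (d + i)) \<in> carrier_vec h" by auto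
  show "x = join (vec d (\<lambda>i. x $ i)) (vec h (\<lambda>i. x $ (d + i))) [x $ (d + h), x $ (d + h + 1), x $ (d + h + 2)]"
  proof (rule eq_vecI)
    fix i assume "i < dim_vec (join (vec d (\<lambda>i. x $ i)) (vec h (\<lambda>i. x $ (d + i))) [x $ (d + h), x $ (d + h + 1), x $ (d + h + 2)])"
    then have i: "i < d + h + 3" by (simp add: join_def)
    show "x $ i = join (vec d (\<lambda>i. x $ i)) (vec h (\<lambda>i. x $ (d + i))) [x $ (d + h), x $ (d + h + 1), x $ (d + h + 2)] $ i"
    proof (cases "i < d + h")
      case True
      then show ?thesis by (auto simp: join_def)
    next
      case False
      then consider "i = d + h" | "i = d + h + 1" | "i = d + h + 2" using i by linarith
      then show ?thesis by cases (simp_all add: join_def vec_of_list_index del: vec_of_list_Cons)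
    qed
  qed (use assms in \<open>simp add: join_def\<close>)
qed

lemma join_eq_0_iff:
  assumes "a \<in> carrier_vec d" "b \<in> carrier_vec h"
  shows "join a b [x, y, z] = 0\<^sub>v (d + h + 3) \<longleftrightarrow> a = 0\<^sub>v d \<and> b = 0\<^sub>v h \<and> x = 0 \<and> y = 0 \<and> z = 0"
proof -
  have "0\<^sub>v (d + h + 3) = join (0\<^sub>v d) (0\<^sub>v h) [0, 0, 0 :: rat]"
    by (rule eq_vecI) (auto simp: join_def vec_of_list_index nth_Cons simp del: vec_of_list_Cons split: nat.splits)
  moreover have "join a b [x, y, z] = join (0\<^sub>v d) (0\<^sub>v h) [0, 0, 0] \<longleftrightarrow>
      a = 0\<^sub>v d \<and> b = 0\<^sub>v h \<and> vec_of_list [x, y, z] = vec_of_list [0, 0, 0]"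
    unfolding join_def append_vec_eq[OF assms(1) zero_carrier_vec] append_vec_eq[OF assms(2) zero_carrier_vec] by simp
  moreover have "vec_of_list [x, y, z] = vec_of_list [0, 0, 0] \<longleftrightarrow> x = 0 \<and> y = 0 \<and> z = 0"
  proof
    assume "vec_of_list [x, y, z] = vec_of_list [0, 0, 0]"
    then have "list_of_vec (vec_of_list [x, y, z]) = list_of_vec (vec_of_list [0, 0, 0])" by (rule arg_cong)
    then show "x = 0 \<and> y = 0 \<and> z = 0" unfolding list_vec by simp
  qed simp
  ultimately show ?thesis by simp
qed

text \<open>Given by rows and not by blocks, because the encoding and the machine produce matrices
  row by row.\<close>

definition ext_mat :: "nat \<Rightarrow> nat \<Rightarrow> rat mat \<Rightarrow> rat mat" where
  "ext_mat d h T = mat_of_rows (d + h + 3)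
     (map (\<lambda>r. join r (0\<^sub>v h) [0, 0, 0]) (rows T) @
      replicate h (join (0\<^sub>v d) (0\<^sub>v h) [0, 0, 0]) @
      [join (0\<^sub>v d) (0\<^sub>v h) [0, 0, 0], join (0\<^sub>v d) (0\<^sub>v h) [0, 1, 0], join (0\<^sub>v d) (0\<^sub>v h) [0, 0, 2]])"

text \<open>Among all new matrices the start coordinate is only read and the \<open>h\<close> block
  only written: \<open>v\<close> is loaded from the former, and the value of \<open>S\<close> is
  stored in the latter, where no later factor can use it.\<close>

definition sep_mat :: "nat \<Rightarrow> nat \<Rightarrow> nat \<Rightarrow> rat vec \<Rightarrow> rat mat \<Rightarrow> rat mat" where
  "sep_mat k d h v S = mat_of_rows (d + h + 3)
     (map (\<lambda>x. join (0\<^sub>v d) (0\<^sub>v h) [x, 0, 0]) (list_of_vec v) @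
      map (\<lambda>r. join r (0\<^sub>v h) [0, 0, 0]) (rows S) @
      [join (0\<^sub>v d) (0\<^sub>v h) [0, 0, 0], join (0\<^sub>v d) (0\<^sub>v h) [0, - (2 ^ k), - (2 ^ k)],
       join (0\<^sub>v d) (0\<^sub>v h) [0, 1, 1]])"

lemma set_rows_carrier: "A \<in> carrier_mat n m \<Longrightarrow> set (rows A) \<subseteq> carrier_vec m"
  by (auto simp: rows_def)

lemma ext_mat_carrier: "T \<in> carrier_mat d d \<Longrightarrow> ext_mat d h T \<in> carrier_mat (d + h + 3) (d + h + 3)"
  unfolding ext_mat_def by (rule carrier_matI) simp_all

lemma sep_mat_carrier:
  "v \<in> carrier_vec d \<Longrightarrow> S \<in> carrier_mat h d \<Longrightarrow> sep_mat k d h v S \<in> carrier_mat (d + h + 3) (d + h + 3)"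
  unfolding sep_mat_def by (rule carrier_matI) simp_all

lemma ext_mat_mult:
  assumes T: "T \<in> carrier_mat d d" and a: "a \<in> carrier_vec d" and b: "b \<in> carrier_vec h"
  shows "ext_mat d h T *\<^sub>v join a b [x, y, z] = join (T *\<^sub>v a) (0\<^sub>v h) [0, y, 2 * z]"
proof -
  let ?vs = "map (\<lambda>r. join r (0\<^sub>v h) [0, 0, 0]) (rows T) @
      replicate h (join (0\<^sub>v d) (0\<^sub>v h) [0, 0, 0]) @
      [join (0\<^sub>v d) (0\<^sub>v h) [0, 0, 0], join (0\<^sub>v d) (0\<^sub>v h) [0, 1, 0], join (0\<^sub>v d) (0\<^sub>v h) [0, 0, 2]]"
  have c: "set ?vs \<subseteq> carrier_vec (d + h + 3)"
    using set_rows_carrier[OF T] by (auto intro!: join_carrier)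
  note sp = join_scalar_prod[OF _ a _ b]
  have r: "map (\<lambda>r. join r (0\<^sub>v h) [0, 0, 0] \<bullet> join a b [x, y, z]) (rows T) = map (\<lambda>r. r \<bullet> a) (rows T)"
    using set_rows_carrier[OF T] b by (auto simp: sp)
  have "ext_mat d h T *\<^sub>v join a b [x, y, z] = vec_of_list (map (\<lambda>r. r \<bullet> join a b [x, y, z]) ?vs)"
    unfolding ext_mat_def by (rule mat_of_rows_mult_vec[OF c join_carrier[OF a b]])
  also have "map (\<lambda>r. r \<bullet> join a b [x, y, z]) ?vs = map (\<lambda>r. r \<bullet> a) (rows T) @ replicate h 0 @ [0, y, 2 * z]"
    using a b r by (simp add: sp o_def)
  also have "vec_of_list \<dots> = join (T *\<^sub>v a) (0\<^sub>v h) [0, y, 2 * z]"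
  proof -
    have "vec_of_list (replicate h 0) = (0\<^sub>v h :: rat vec)" by (rule eq_vecI) (auto simp: vec_of_list_index)
    then show ?thesis unfolding join_def by (simp only: vec_of_list_append rows_mult_vec)
  qed
  finally show ?thesis .
qed

lemma sep_mat_mult:
  assumes v: "v \<in> carrier_vec d" and S: "S \<in> carrier_mat h d" and a: "a \<in> carrier_vec d" and b: "b \<in> carrier_vec h"
  shows "sep_mat k d h v S *\<^sub>v join a b [x, y, z] = join (x \<cdot>\<^sub>v v) (S *\<^sub>v a) [0, - (2 ^ k) * (y + z), y + z]"
proof -
  let ?vs = "map (\<lambda>x. join (0\<^sub>v d) (0\<^sub>v h) [x, 0, 0]) (list_of_vec v) @
      map (\<lambda>r. join r (0\<^sub>v h) [0, 0, 0]) (rows S) @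
      [join (0\<^sub>v d) (0\<^sub>v h) [0, 0, 0], join (0\<^sub>v d) (0\<^sub>v h) [0, - (2 ^ k), - (2 ^ k)],
       join (0\<^sub>v d) (0\<^sub>v h) [0, 1, 1]]"
  have c: "set ?vs \<subseteq> carrier_vec (d + h + 3)"
    unfolding set_append set_map Un_subset_iff image_subset_iff list.set insert_subset
    by (intro conjI ballI join_carrier empty_subsetI zero_carrier_vec subsetD[OF set_rows_carrier[OF S]])
  note sp = join_scalar_prod[OF _ a _ b]
  have r: "map (\<lambda>r. join r (0\<^sub>v h) [0, 0, 0] \<bullet> join a b [x, y, z]) (rows S) = map (\<lambda>r. r \<bullet> a) (rows S)"
    using set_rows_carrier[OF S] b by (auto simp: sp)
  have "sep_mat k d h v S *\<^sub>v join a b [x, y, z] = vec_of_list (map (\<lambda>r. r \<bullet> join a b [x, y, z]) ?vs)"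
    unfolding sep_mat_def by (rule mat_of_rows_mult_vec[OF c join_carrier[OF a b]])
  also have "map (\<lambda>r. r \<bullet> join a b [x, y, z]) ?vs =
      map (\<lambda>t. x * t) (list_of_vec v) @ map (\<lambda>r. r \<bullet> a) (rows S) @ [0, - (2 ^ k) * (y + z), y + z]"
    using a b r by (simp add: sp o_def distrib_left)
  also have "vec_of_list \<dots> = join (x \<cdot>\<^sub>v v) (S *\<^sub>v a) [0, - (2 ^ k) * (y + z), y + z]"
  proof -
    have "vec_of_list (map (\<lambda>t. x * t) (list_of_vec v)) = x \<cdot>\<^sub>v v"
      by (rule eq_vecI) (auto simp: vec_of_list_index list_of_vec_index)
    then show ?thesis unfolding join_def by (simp only: vec_of_list_append rows_mult_vec)
  qed
  finally show ?thesis .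
qed

section \<open>Words in the separator and the extended matrices\<close>

lemma mat_prod_Cons_mult_vec:
  assumes "A \<in> carrier_mat n n" "set As \<subseteq> carrier_mat n n" "x \<in> carrier_vec n"
  shows "mat_prod n (A # As) *\<^sub>v x = A *\<^sub>v (mat_prod n As *\<^sub>v x)"
  using assoc_mult_mat_vec[OF assms(1) mat_prod_carrier[OF assms(2)] assms(3)] by simp

lemma mat_eq_0I:
  fixes A :: "rat mat"
  assumes A: "A \<in> carrier_mat n n" and zero: "\<And>x. x \<in> carrier_vec n \<Longrightarrow> A *\<^sub>v x = 0\<^sub>v n"
  shows "A = 0\<^sub>m n n"
proof (rule eq_matI)
  fix i j assume "i < dim_row (0\<^sub>m n n :: rat mat)" "j < dim_col (0\<^sub>m n n :: rat mat)"
  then have ij: "i < n" "j < n" by simp_all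
  have "A $$ (i, j) = (A *\<^sub>v unit_vec n j) $ i" using A ij by simp
  then show "A $$ (i, j) = 0\<^sub>m n n $$ (i, j)" using zero[of "unit_vec n j"] ij by simp
qed (use A in auto)

text \<open>\<open>None\<close> stands for the separator. Words over options record which factors
  are separators, so that the shape of a product can be discussed without comparing
  matrices.\<close>

definition letter :: "nat \<Rightarrow> nat \<Rightarrow> nat \<Rightarrow> rat vec \<Rightarrow> rat mat \<Rightarrow> rat mat option \<Rightarrow> rat mat" where
  "letter k d h v S w = (case w of None \<Rightarrow> sep_mat k d h v S | Some T \<Rightarrow> ext_mat d h T)"

context
  fixes k d h :: nat and v :: "rat vec" and S :: "rat mat" and Ts :: "rat mat list"
  assumes v: "v \<in> carrier_vec d" and S: "S \<in> carrier_mat h d" and Ts: "set Ts \<subseteq> carrier_mat d d"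
begin

private abbreviation "D \<equiv> d + h + 3"
private abbreviation "L \<equiv> letter k d h v S"
private abbreviation "letters \<equiv> insert None (Some ` set Ts)"

lemma letter_carrier: "w \<in> letters \<Longrightarrow> L w \<in> carrier_mat D D"
  using sep_mat_carrier[OF v S] ext_mat_carrier Ts by (auto simp: letter_def)

lemma word_carrier: "set ws \<subseteq> letters \<Longrightarrow> set (map L ws) \<subseteq> carrier_mat D D"
  using letter_carrier by auto

lemma word_Cons_mult_vec:
  assumes "set (w # ws) \<subseteq> letters" "x \<in> carrier_vec D"
  shows "mat_prod D (map L (w # ws)) *\<^sub>v x = L w *\<^sub>v (mat_prod D (map L ws) *\<^sub>v x)"
proof -
  have "L w \<in> carrier_mat D D" by (rule letter_carrier) (use assms(1) in simp)
  moreover have "set (map L ws) \<subseteq> carrier_mat D D" by (rule word_carrier) (use assms(1) in simp)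
  ultimately show ?thesis using mat_prod_Cons_mult_vec assms(2) by simp
qed

text \<open>The last two coordinates form an automaton: after a separator followed by \<open>j\<close> other
  factors they are proportional to \<open>(- (2 ^ k), 2 ^ j)\<close>, and the next separator annihilates them
  iff \<open>j = k\<close>.\<close>

lemma word_automaton:
  assumes "set ws \<subseteq> letters"
  shows "(\<exists>xs us zs. ws = xs @ None # map Some us @ None # zs \<and> length us = k) \<or>
    (\<exists>a b x l y. a \<in> carrier_vec d \<and> b \<in> carrier_vec h \<and> l \<noteq> 0 \<and>
       mat_prod D (map L ws) *\<^sub>v join (0\<^sub>v d) (0\<^sub>v h) [0, 0, 1] = join a b [x, y, l] \<and>
       (y = 0 \<or> (\<exists>us zs. ws = map Some us @ None # zs \<and> 2 ^ length us * y = - (2 ^ k) * l)))"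
  using assms
proof (induction ws)
  case Nil
  have c: "join (0\<^sub>v d) (0\<^sub>v h) [0, 0, 1] \<in> carrier_vec D" by (rule join_carrier) simp_all
  have "mat_prod D (map L []) *\<^sub>v join (0\<^sub>v d) (0\<^sub>v h) [0, 0, 1] = join (0\<^sub>v d) (0\<^sub>v h) [0, 0, 1]"
    using one_mult_mat_vec[OF c] by simp
  \<comment> \<open>No separator has acted yet, so \<open>y = 0\<close> and
    \<open>l = 1\<close>.\<close>
  then show ?case
    by (intro disjI2 exI[of _ "0\<^sub>v d"] exI[of _ "0\<^sub>v h"] exI[of _ "0::rat"] exI[of _ "1::rat"]) auto
next
  case (Cons w ws)
  have c: "join (0\<^sub>v d) (0\<^sub>v h) [0, 0, 1] \<in> carrier_vec D" by (rule join_carrier) simp_all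
  note IH = Cons.IH
  from Cons.prems have "set ws \<subseteq> letters" by simp
  from IH[OF this] show ?case
  proof (elim disjE)
    assume "\<exists>xs us zs. ws = xs @ None # map Some us @ None # zs \<and> length us = k"
    then obtain xs us zs where "ws = xs @ None # map Some us @ None # zs" "length us = k" by blast
    then have "w # ws = (w # xs) @ None # map Some us @ None # zs \<and> length us = k" by simp
    then show ?thesis by blast
  next
    assume "\<exists>a b x l y. a \<in> carrier_vec d \<and> b \<in> carrier_vec h \<and> l \<noteq> 0 \<and>
       mat_prod D (map L ws) *\<^sub>v join (0\<^sub>v d) (0\<^sub>v h) [0, 0, 1] = join a b [x, y, l] \<and>
       (y = 0 \<or> (\<exists>us zs. ws = map Some us @ None # zs \<and> 2 ^ length us * y = - (2 ^ k) * l))"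
    then obtain a b x l y where ab: "a \<in> carrier_vec d" "b \<in> carrier_vec h" and l: "l \<noteq> 0" and
      eq: "mat_prod D (map L ws) *\<^sub>v join (0\<^sub>v d) (0\<^sub>v h) [0, 0, 1] = join a b [x, y, l]" and
      y: "y = 0 \<or> (\<exists>us zs. ws = map Some us @ None # zs \<and> 2 ^ length us * y = - (2 ^ k) * l)"
      by blast
    note step = word_Cons_mult_vec[OF Cons.prems c, unfolded eq]
    show ?thesis
    proof (cases w)
      case (Some T)
      then have T: "T \<in> carrier_mat d d" using Cons.prems Ts by auto
      have 1: "mat_prod D (map L (w # ws)) *\<^sub>v join (0\<^sub>v d) (0\<^sub>v h) [0, 0, 1] = join (T *\<^sub>v a) (0\<^sub>v h) [0, y, 2 * l]"
        using step ext_mat_mult[OF T ab] Some by (simp add: letter_def)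
      have 2: "y = 0 \<or> (\<exists>us zs. w # ws = map Some us @ None # zs \<and> 2 ^ length us * y = - (2 ^ k) * (2 * l))"
        using y
      proof
        assume "\<exists>us zs. ws = map Some us @ None # zs \<and> 2 ^ length us * y = - (2 ^ k) * l"
        then obtain us zs where us: "ws = map Some us @ None # zs" "2 ^ length us * y = - (2 ^ k) * l" by blast
        have "2 ^ length (T # us) * y = 2 * (2 ^ length us * y)" by (simp only: list.size power_Suc mult.assoc add_Suc_right add_0_right)
        also have "\<dots> = - (2 ^ k) * (2 * l)" unfolding us(2) by (simp only: mult.left_commute)
        finally have "2 ^ length (T # us) * y = - (2 ^ k) * (2 * l)" .
        moreover have "w # ws = map Some (T # us) @ None # zs" unfolding Some us(1) by (simp only: list.map append.simps)
        ultimately show ?thesis by blast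
      qed simp
      have "T *\<^sub>v a \<in> carrier_vec d" "0\<^sub>v h \<in> carrier_vec h" "2 * l \<noteq> 0" using T ab l by auto
      with 1 2 show ?thesis by blast
    next
      case None
      have 1: "mat_prod D (map L (w # ws)) *\<^sub>v join (0\<^sub>v d) (0\<^sub>v h) [0, 0, 1] =
          join (x \<cdot>\<^sub>v v) (S *\<^sub>v a) [0, - (2 ^ k) * (y + l), y + l]"
        using step sep_mat_mult[OF v S ab] None by (simp add: letter_def)
      \<comment> \<open>The separator forms \<open>y + l\<close>. If this is 0, then
        \<open>y = - l\<close> is nonzero, so a separator occurred before, and the recorded ratio
        gives \<open>2 ^ length us = 2 ^ k\<close>: the forbidden pattern is complete. Otherwise
        \<open>y + l\<close> is the new nonzero last coordinate, and the count restarts with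
        \<open>us = []\<close>.\<close>
      show ?thesis
      proof (cases "y + l = 0")
        case True
        then have yl: "y = - l" by simp
        then have "y \<noteq> 0" using l by simp
        then obtain us zs where us: "ws = map Some us @ None # zs" "2 ^ length us * y = - (2 ^ k) * l"
          using y by blast
        then have "2 ^ length us * l = 2 ^ k * l" unfolding yl by simp
        then have "(2 :: rat) ^ length us = 2 ^ k" using l by simp
        then have "length us = k" by simp
        then have "w # ws = [] @ None # map Some us @ None # zs \<and> length us = k" using us None by simp
        then show ?thesis by blast
      next
        case False
        have "w # ws = map Some [] @ None # ws \<and>
            2 ^ length ([] :: rat mat list) * (- (2 ^ k) * (y + l)) = - (2 ^ k) * (y + l)"
          using None by simp
        moreover have "x \<cdot>\<^sub>v v \<in> carrier_vec d" "S *\<^sub>v a \<in> carrier_vec h" using v S ab by auto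
        ultimately show ?thesis using 1 False by blast
      qed
    qed
  qed
qed

text \<open>The empty word keeps \<open>b\<close> while every other word clears that block, hence
  the unspecified \<open>b'\<close>. Its value is irrelevant because no separator reads it.\<close>

lemma ext_word_mult:
  assumes "set us \<subseteq> set Ts" "a \<in> carrier_vec d" "b \<in> carrier_vec h"
  shows "\<exists>b'\<in>carrier_vec h. mat_prod D (map L (map Some us)) *\<^sub>v join a b [0, y, z] =
    join (mat_prod d us *\<^sub>v a) b' [0, y, 2 ^ length us * z]"
  using assms
proof (induction us)
  case Nil
  have c: "join a b [0, y, z] \<in> carrier_vec D" using Nil by (intro join_carrier)
  show ?case using one_mult_mat_vec[OF c] Nil by auto
next
  case (Cons T us)
  have T: "T \<in> carrier_mat d d" "set us \<subseteq> carrier_mat d d" using Cons.prems Ts by auto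
  have c: "join a b [0, y, z] \<in> carrier_vec D" using Cons.prems by (intro join_carrier)
  obtain b' where b': "b' \<in> carrier_vec h" "mat_prod D (map L (map Some us)) *\<^sub>v join a b [0, y, z] =
    join (mat_prod d us *\<^sub>v a) b' [0, y, 2 ^ length us * z]" using Cons by auto
  have "set (map Some (T # us)) \<subseteq> letters" using Cons.prems by auto
  then have "mat_prod D (map L (map Some (T # us))) *\<^sub>v join a b [0, y, z] =
      L (Some T) *\<^sub>v join (mat_prod d us *\<^sub>v a) b' [0, y, 2 ^ length us * z]"
    using word_Cons_mult_vec[of "Some T" "map Some us", OF _ c] b'(2) by simp
  also have "\<dots> = join (T *\<^sub>v (mat_prod d us *\<^sub>v a)) (0\<^sub>v h) [0, y, 2 * (2 ^ length us * z)]"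
    using ext_mat_mult[OF T(1) _ b'(1)] mat_prod_carrier[OF T(2)] Cons.prems(2) by (simp add: letter_def)
  also have "T *\<^sub>v (mat_prod d us *\<^sub>v a) = mat_prod d (T # us) *\<^sub>v a"
    using mat_prod_Cons_mult_vec[OF T Cons.prems(2)] by simp
  finally show ?case by (intro bexI[of _ "0\<^sub>v h"]) (simp_all add: mult.assoc)
qed

text \<open>The right separator loads \<open>x\<close> times \<open>v\<close> and sets the automaton
  to multiples of \<open>- (2 ^ k)\<close> and 1. The \<open>k\<close> factors in between make these
  cancel, so the left separator annihilates them; it stores the value of \<open>S\<close> and, since
  the start coordinate is 0 by now, clears the first block.\<close>

lemma good_word_mult:
  assumes us: "set us \<subseteq> set Ts" "length us = k" and a: "a \<in> carrier_vec d" and b: "b \<in> carrier_vec h"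
  shows "mat_prod D (map L (None # map Some us @ [None])) *\<^sub>v join a b [x, y, z] =
    join (0\<^sub>v d) (x \<cdot>\<^sub>v ((S * mat_prod d us) *\<^sub>v v)) [0, 0, 0]"
proof -
  have m: "mat_prod d us \<in> carrier_mat d d" by (rule mat_prod_carrier) (use us Ts in auto)
  have c: "join a b [x, y, z] \<in> carrier_vec D" using a b by (rule join_carrier)
  have l: "set (map Some us) \<subseteq> letters" using us by auto
  have P: "L None \<in> carrier_mat D D" by (rule letter_carrier) simp
  have PM: "L None *\<^sub>v join p q [r, s, t] = join (r \<cdot>\<^sub>v v) (S *\<^sub>v p) [0, - (2 ^ k) * (s + t), s + t]"
    if "p \<in> carrier_vec d" "q \<in> carrier_vec h" for p q r s t
    using sep_mat_mult[OF v S that] by (simp add: letter_def)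
  have xv: "x \<cdot>\<^sub>v v \<in> carrier_vec d" "S *\<^sub>v a \<in> carrier_vec h" using v S a by auto
  obtain b' where b': "b' \<in> carrier_vec h"
    "mat_prod D (map L (map Some us)) *\<^sub>v join (x \<cdot>\<^sub>v v) (S *\<^sub>v a) [0, - (2 ^ k) * (y + z), y + z] =
      join (mat_prod d us *\<^sub>v (x \<cdot>\<^sub>v v)) b' [0, - (2 ^ k) * (y + z), 2 ^ length us * (y + z)]"
    using ext_word_mult[OF us(1) xv] by blast
  have W: "mat_prod D (map L (map Some us)) \<in> carrier_mat D D"
    by (rule mat_prod_carrier, rule word_carrier, rule l)
  have last: "mat_prod D (map L [None]) = L None" using P by simp
  have "mat_prod D (map L (map Some us @ [None])) = mat_prod D (map L (map Some us)) * L None"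
    using mat_prod_append[OF word_carrier[OF l], of "map L [None]"] P last by simp
  then have "mat_prod D (map L (map Some us @ [None])) *\<^sub>v join a b [x, y, z] =
      mat_prod D (map L (map Some us)) *\<^sub>v (L None *\<^sub>v join a b [x, y, z])"
    using assoc_mult_mat_vec[OF W P c] by simp
  also have "\<dots> = join (mat_prod d us *\<^sub>v (x \<cdot>\<^sub>v v)) b' [0, - (2 ^ k) * (y + z), 2 ^ length us * (y + z)]"
    unfolding PM[OF a b] by (rule b'(2))
  finally have 1: "mat_prod D (map L (map Some us @ [None])) *\<^sub>v join a b [x, y, z] = \<dots>" .
  have p: "mat_prod d us *\<^sub>v (x \<cdot>\<^sub>v v) \<in> carrier_vec d" using m xv by auto
  have "set (None # map Some us @ [None]) \<subseteq> letters" using l by auto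
  then have "mat_prod D (map L (None # map Some us @ [None])) *\<^sub>v join a b [x, y, z] =
     L None *\<^sub>v join (mat_prod d us *\<^sub>v (x \<cdot>\<^sub>v v)) b' [0, - (2 ^ k) * (y + z), 2 ^ length us * (y + z)]"
    using word_Cons_mult_vec[OF _ c] 1 by metis
  also have "\<dots> = join (0 \<cdot>\<^sub>v v) (S *\<^sub>v (mat_prod d us *\<^sub>v (x \<cdot>\<^sub>v v))) [0, 0, 0]"
    unfolding PM[OF p b'(1)] us(2) by simp
  also have "0 \<cdot>\<^sub>v v = 0\<^sub>v d" using v by auto
  also have "S *\<^sub>v (mat_prod d us *\<^sub>v (x \<cdot>\<^sub>v v)) = x \<cdot>\<^sub>v ((S * mat_prod d us) *\<^sub>v v)"
    using assoc_mult_mat_vec[OF S m v] mult_mat_vec[OF m v] mult_mat_vec[OF S, of "mat_prod d us *\<^sub>v v"] m v by simp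
  finally show ?thesis .
qed

text \<open>If the product vanishes, then applying it to the last unit vector forces the intended
  shape by \<open>word_automaton\<close>, and applying it to the start coordinate yields the VEST
  equation. Conversely, \<open>good_word_mult\<close> gives zero on every vector.\<close>

lemma zero_product_sep_iff:
  "(\<exists>Bs. length Bs = k + 2 \<and> set Bs \<subseteq> set (map (ext_mat d h) Ts @ [sep_mat k d h v S]) \<and> mat_prod D Bs = 0\<^sub>m D D) \<longleftrightarrow>
   (\<exists>us. length us = k \<and> set us \<subseteq> set Ts \<and> (S * mat_prod d us) *\<^sub>v v = 0\<^sub>v h)" (is "?l \<longleftrightarrow> ?r")
proof
  have ls: "set (map (ext_mat d h) Ts @ [sep_mat k d h v S]) = L ` letters"
    by (auto simp: letter_def image_image)
  {
    assume ?l
    then obtain Bs where Bs: "length Bs = k + 2" "set Bs \<subseteq> L ` letters" "mat_prod D Bs = 0\<^sub>m D D"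
      unfolding ls by blast
    then obtain ws where ws: "set ws \<subseteq> letters" "Bs = map L ws"
    proof -
      have "Bs \<in> map L ` lists letters" using Bs(2) unfolding lists_image[symmetric] in_lists_conv_set by blast
      then show thesis using that by (auto simp: in_lists_conv_set)
    qed
    have c: "join (0\<^sub>v d) (0\<^sub>v h) [0, 0, 1] \<in> carrier_vec D" by (rule join_carrier) simp_all
    have 0: "mat_prod D (map L ws) *\<^sub>v x = 0\<^sub>v D" if "x \<in> carrier_vec D" for x
      using Bs(3) that unfolding ws(2) by (intro eq_vecI) auto
    have "\<not> (\<exists>a b x l y. a \<in> carrier_vec d \<and> b \<in> carrier_vec h \<and> l \<noteq> 0 \<and>
       mat_prod D (map L ws) *\<^sub>v join (0\<^sub>v d) (0\<^sub>v h) [0, 0, 1] = join a b [x, y, l] \<and>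
       (y = 0 \<or> (\<exists>us zs. ws = map Some us @ None # zs \<and> 2 ^ length us * y = - (2 ^ k) * l)))"
    proof (intro notI, elim exE conjE)
      fix a b :: "rat vec" and x l y :: rat
      assume ab: "a \<in> carrier_vec d" "b \<in> carrier_vec h" and "l \<noteq> 0"
        and "mat_prod D (map L ws) *\<^sub>v join (0\<^sub>v d) (0\<^sub>v h) [0, 0, 1] = join a b [x, y, l]"
      then have "join a b [x, y, l] = 0\<^sub>v D" using 0[OF c] by simp
      then show False unfolding join_eq_0_iff[OF ab] using \<open>l \<noteq> 0\<close> by simp
    qed
    then obtain xs us zs where w: "ws = xs @ None # map Some us @ None # zs" "length us = k"
      using word_automaton[OF ws(1)] by blast
    \<comment> \<open>The pattern alone has \<open>k + 2\<close> letters, so \<open>xs\<close> and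
      \<open>zs\<close> are empty.\<close>
    then have w: "ws = None # map Some us @ [None]" using Bs(1) ws(2) by simp
    have us: "set us \<subseteq> set Ts" using ws(1) w by auto
    have m: "mat_prod d us \<in> carrier_mat d d" by (rule mat_prod_carrier) (use us Ts in auto)
    have "join (0\<^sub>v d) (0\<^sub>v h) [1, 0, 0] \<in> carrier_vec D" by (rule join_carrier) simp_all
    from 0[OF this] have "join (0\<^sub>v d) (1 \<cdot>\<^sub>v ((S * mat_prod d us) *\<^sub>v v)) [0, 0, 0] = 0\<^sub>v D"
      unfolding w by (subst (asm) good_word_mult[OF us \<open>length us = k\<close>]) simp_all
    moreover have "1 \<cdot>\<^sub>v ((S * mat_prod d us) *\<^sub>v v) \<in> carrier_vec h" using S m v by auto
    ultimately have "1 \<cdot>\<^sub>v ((S * mat_prod d us) *\<^sub>v v) = 0\<^sub>v h" by (simp add: join_eq_0_iff)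
    then show ?r using us \<open>length us = k\<close> by auto
  next
    assume ?r
    then obtain us where us: "length us = k" "set us \<subseteq> set Ts" "(S * mat_prod d us) *\<^sub>v v = 0\<^sub>v h" by blast
    define ws where "ws = None # map Some us @ [None]"
    have ws: "set ws \<subseteq> letters" using us by (auto simp: ws_def)
    have W: "mat_prod D (map L ws) \<in> carrier_mat D D" by (rule mat_prod_carrier, rule word_carrier, rule ws)
    have "mat_prod D (map L ws) = 0\<^sub>m D D"
    proof (rule mat_eq_0I[OF W])
      fix x :: "rat vec" assume "x \<in> carrier_vec D"
      then obtain a b p q r where x: "a \<in> carrier_vec d" "b \<in> carrier_vec h" "x = join a b [p, q, r]"
        by (rule join_cases)
      have "mat_prod D (map L ws) *\<^sub>v x = join (0\<^sub>v d) (0\<^sub>v h) [0, 0, 0]"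
        unfolding ws_def x(3) good_word_mult[OF us(2,1) x(1,2)] us(3)
        by (intro arg_cong[of _ _ "\<lambda>b. join (0\<^sub>v d) b [0, 0, 0]"] eq_vecI) simp_all
      also have "\<dots> = 0\<^sub>v D" by (simp add: join_eq_0_iff)
      finally show "mat_prod D (map L ws) *\<^sub>v x = 0\<^sub>v D" .
    qed
    moreover have "length (map L ws) = k + 2" using us by (simp add: ws_def)
    moreover have "set (map L ws) \<subseteq> L ` letters" using ws by auto
    ultimately show ?l unfolding ls by blast
  }
qed

end

section \<open>Encodings and the two reductions\<close>

lemma wf_put [simp]: "a < m \<Longrightarrow> wf_prog n m (single j (\<lambda>xs. (a, d)))"
  by (rule wf_single) simp

lemma wf_cp [simp]: "i < n \<Longrightarrow> wf_prog n m (single j (\<lambda>xs. (xs ! i, d)))"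
  by (rule wf_single) (auto dest: nth_mem)

lemma wf_emit [simp]: "set as \<subseteq> {..<m} \<Longrightarrow> wf_prog n m (emit as)"
  by (induction as) (auto simp: emit.simps stay_def)

lemma wf_vest_prog: "wf_prog 6 10 vest_prog"
  by (simp add: vest_prog_def vest_prep_def vest_mats_def vest_last_def read_param_def count_cols_def
      skip_to_def copy_to_def count_rows_prog_def put_each_def extend_mat_def vec_row_def neg_pow_def
      copy_rows_def copy_row_def zero_row_def row_end_def zeros_def wf_rew wf_foreach)

lemma wf_zp_prog: "wf_prog 6 10 zp_prog"
  by (simp add: zp_prog_def zp_prep_def read_param_def read_dim_def make_gap_def to_end_def zp_vec_def
      zp_entry_def id_mat_def id_row_def skip_to_def copy_to_def wf_rew wf_foreach)

text \<open>The same function serves as time factor and as parameter bound in both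
  reductions.\<close>

lemma computable_add_2: "computable (\<lambda>k. k + 2)"
proof -
  define p where "p = copy_to 9 ;; emit [2, 2, 9]"
  have wf: "wf_tm (tm_of 6 10 p)"
    by (rule wf_tm_of) (simp_all add: p_def copy_to_def)
  have "computes_within (tm_of 6 10 p) (enc_unary n) (enc_unary (n + 2)) (3 * n + 6)" for n
  proof (rule computes_within_tm_of)
    have "runs p [Z [] (replicate n 2 @ 9 # []), Z [] [], Z [] [], Z [] [], Z [] [], Z [] []]
        [Z (replicate n 2 @ [9]) [], Z (replicate (n + 2) 2 @ [9]) [], Z [] [], Z [] [], Z [] [], Z [] []] (3 * n + 6)"
      unfolding p_def
      apply (rule runs_cong)
        apply (rule runs_Seq[OF runs_copy_to], simp)
        apply (rule runs_emit)
       apply (simp_all add: replicate_add numeral_2_eq_2 replicate_app_Cons_same)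
      done
    then show "runs p (Z [] (enc_unary n) # replicate (6 - 1) (Z [] []))
       [Z (replicate n 2 @ [9]) [], Z (replicate (n + 2) 2 @ [9]) [], Z [] [], Z [] [], Z [] [], Z [] []] (3 * n + 6)"
      by (simp add: enc_unary_def numeral_eq_Suc)
  qed (auto simp: enc_unary_def)
  then show ?thesis using wf unfolding computable_def by blast
qed

text \<open>An entry without its end marker, the form in which the statements about the machine take
  their items.\<close>

definition rat_code :: "rat \<Rightarrow> nat list" where
  "rat_code r = butlast (enc_rat r)"

lemma set_enc_binary: "set (enc_binary n) \<subseteq> {1, 2}"
proof (induction n rule: enc_binary.induct)
  case (1 n)
  then show ?case by (subst enc_binary.simps) auto
qed

lemma enc_rat_code: "enc_rat r = rat_code r @ [5]" and set_rat_code: "set (rat_code r) \<subseteq> {1..4}"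
proof -
  obtain p q where pq: "quotient_of r = (p, q)" by fastforce
  have e: "enc_rat r = ((if p < 0 then [3] else []) @ enc_binary (nat \<bar>p\<bar>) @ [4] @ enc_binary (nat q)) @ [5]"
    by (simp add: enc_rat_def pq)
  then show "enc_rat r = rat_code r @ [5]" by (simp only: rat_code_def butlast_snoc)
  have "rat_code r = (if p < 0 then [3] else []) @ enc_binary (nat \<bar>p\<bar>) @ [4] @ enc_binary (nat q)"
    unfolding rat_code_def e by (simp only: butlast_snoc)
  moreover have "{1, 2} \<subseteq> {1..4::nat}" by auto
  then have "set (enc_binary n) \<subseteq> {1..4}" for n using set_enc_binary[of n] by blast
  ultimately show "set (rat_code r) \<subseteq> {1..4}" by auto
qed

definition vec_code :: "rat vec \<Rightarrow> nat list" where
  "vec_code v = concat (map enc_rat (list_of_vec v))"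

lemma enc_vec_code: "enc_vec v = vec_code v @ [6]"
  by (simp add: enc_vec_def vec_code_def)

lemma set_vec_code: "set (vec_code v) \<subseteq> {1..5}"
proof -
  have "{1..4} \<subseteq> {1..5::nat}" by auto
  then have "set (enc_rat r) \<subseteq> {1..5}" for r using set_rat_code[of r] by (simp add: enc_rat_code subset_trans)
  then show ?thesis by (auto simp: vec_code_def)
qed

definition mat_code :: "rat mat \<Rightarrow> nat list list" where
  "mat_code A = map vec_code (rows A)"

lemma enc_mat_code: "enc_mat A = rows_code (mat_code A) @ [7]"
  by (simp add: enc_mat_def rows_code_def mat_code_def enc_vec_code[abs_def] o_def)

lemma enc_mats_code: "enc_mats As = mats_code (map mat_code As) @ [8]"
  by (simp add: enc_mats_def mats_code_def enc_mat_code[abs_def] o_def)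

lemma enc_vec_entries: "enc_vec v = entries_code (map rat_code (list_of_vec v)) @ [6]"
  by (simp add: enc_vec_def entries_code_def enc_rat_code[abs_def] o_def)

lemma set_enc_mat: "set (enc_mat A) \<subseteq> {1..7}"
proof -
  have "{1..5} \<subseteq> {1..7::nat}" by auto
  then have "set (vec_code v) \<subseteq> {1..7}" for v using set_vec_code[of v] by blast
  then show ?thesis by (auto simp: enc_mat_def enc_vec_code)
qed

lemma set_enc_vec: "set (enc_vec v) \<subseteq> {0<..<10}"
  using set_vec_code[of v] by (auto simp: enc_vec_code)

lemma set_enc_mats: "set (enc_mats As) \<subseteq> {0<..<10}"
proof -
  have "set (enc_mat A) \<subseteq> {0<..<10}" for A using set_enc_mat[of A] by auto
  then show ?thesis by (auto simp: enc_mats_def)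
qed

lemma set_encode_VEST: "set (encode_pair VEST x k) \<subseteq> {0<..<10}"
proof -
  have "set (enc_mat A) \<subseteq> {0<..<10}" for A using set_enc_mat[of A] by auto
  then show ?thesis using set_enc_vec set_enc_mats by (auto simp: encode_pair_def VEST_def enc_unary_def)
qed

lemma set_encode_ZERO_PRODUCT: "set (encode_pair ZERO_PRODUCT x k) \<subseteq> {0<..<10}"
  using set_enc_mats by (cases x) (auto simp: encode_pair_def ZERO_PRODUCT_def enc_unary_def)

section \<open>Encodings of the constructed numbers, vectors and matrices\<close>

lemma enc_binary_pow: "enc_binary (2 ^ e) = 2 # replicate e 1"
proof (induction e)
  case 0
  show ?case by (subst enc_binary.simps) simp
next
  case (Suc e)
  have "\<not> (2 :: nat) ^ Suc e < 2" by simp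
  then show ?case by (subst enc_binary.simps) (simp add: Suc replicate_append_same)
qed

lemma enc_binary_1: "enc_binary (Suc 0) = [2]"
  using enc_binary_pow[of 0] by simp

lemma enc_rat_int: "enc_rat (of_int z) = (if z < 0 then [3] else []) @ enc_binary (nat \<bar>z\<bar>) @ [4, 2, 5]"
  by (simp add: enc_rat_def quotient_of_int enc_binary_1)

lemma enc_rat_pow: "enc_rat (2 ^ e) = pow_entry e"
  using enc_rat_int[of "2 ^ e"] by (simp add: pow_entry_def enc_binary_pow nat_power_eq)

lemma enc_rat_neg_pow: "enc_rat (- (2 ^ e)) = neg_pow_out e"
  using enc_rat_int[of "- (2 ^ e)"] by (simp add: neg_pow_out_def enc_binary_pow nat_power_eq)

lemma enc_rat_0: "enc_rat 0 = zero_entry"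
proof -
  have "enc_binary 0 = [1]" by (subst enc_binary.simps) simp
  then show ?thesis using enc_rat_int[of 0] by simp
qed

lemma enc_rat_1: "enc_rat 1 = one_entry"
  using enc_rat_pow[of 0] by (simp add: pow_entry_def)

lemma enc_rat_2: "enc_rat 2 = two_entry"
  using enc_rat_pow[of 1] by (simp add: pow_entry_def)

lemma vec_code_zero: "vec_code (0\<^sub>v n) = zs n"
proof -
  have "list_of_vec (0\<^sub>v n) = replicate n (0 :: rat)"
    by (rule nth_equalityI) (simp_all add: list_of_vec_index)
  then show ?thesis by (simp add: vec_code_def zs_def enc_rat_0)
qed

lemma list_of_vec_append: "list_of_vec (v @\<^sub>v w) = list_of_vec v @ list_of_vec w"
  by (rule nth_equalityI) (auto simp: list_of_vec_index nth_append)

lemma vec_code_append: "vec_code (v @\<^sub>v w) = vec_code v @ vec_code w"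
  by (simp add: vec_code_def list_of_vec_append)

lemma vec_code_join: "vec_code (join a b xs) = vec_code a @ vec_code b @ concat (map enc_rat xs)"
  unfolding join_def vec_code_append by (simp add: vec_code_def list_vec)

lemma vec_code_join_zero:
  "vec_code (join a (0\<^sub>v h) [x, y, z]) = vec_code a @ zs h @ enc_rat x @ enc_rat y @ enc_rat z"
  by (simp add: vec_code_join vec_code_zero)

lemma mat_of_rows_code:
  assumes "set vs \<subseteq> carrier_vec n"
  shows "enc_mat (mat_of_rows n vs) = rows_code (map vec_code vs) @ [7]"
  using assms by (simp add: enc_mat_code mat_code_def)

lemma rows_code_append: "rows_code (xs @ ys) = rows_code xs @ rows_code ys"
  by (simp add: rows_code_def)

lemma enc_ext_mat:
  assumes T: "T \<in> carrier_mat d d"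
  shows "enc_mat (ext_mat d h T) = mat_out d h (mat_code T)"
proof -
  have c: "set (map (\<lambda>r. join r (0\<^sub>v h) [0, 0, 0]) (rows T) @
      replicate h (join (0\<^sub>v d) (0\<^sub>v h) [0, 0, 0]) @
      [join (0\<^sub>v d) (0\<^sub>v h) [0, 0, 0], join (0\<^sub>v d) (0\<^sub>v h) [0, 1, 0], join (0\<^sub>v d) (0\<^sub>v h) [0, 0, 2]])
      \<subseteq> carrier_vec (d + h + 3)"
    using set_rows_carrier[OF T] by (auto intro!: join_carrier)
  have r: "rows_code (replicate h x) = concat (replicate h (x @ [6]))" for x
    by (simp add: rows_code_def)
  show ?thesis
    unfolding ext_mat_def mat_of_rows_code[OF c]
    by (simp add: mat_out_def rows_out_def zero_row_out_def rows_code_append r vec_code_join_zero mat_code_def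
        vec_code_zero enc_rat_0 enc_rat_1 enc_rat_2 o_def) (simp add: rows_code_def o_def)
qed

lemma enc_sep_mat:
  assumes v: "v \<in> carrier_vec d" and S: "S \<in> carrier_mat h d"
  shows "enc_mat (sep_mat k d h v S) =
    vec_rows_out d h (map rat_code (list_of_vec v)) @ rows_out h (mat_code S) @
    zero_row_out d h (zero_entry @ zero_entry @ zero_entry) @
    zero_row_out d h (zero_entry @ neg_pow_out k @ neg_pow_out k) @
    zero_row_out d h (zero_entry @ one_entry @ one_entry) @ [7]"
proof -
  have c: "set (map (\<lambda>x. join (0\<^sub>v d) (0\<^sub>v h) [x, 0, 0]) (list_of_vec v) @
      map (\<lambda>r. join r (0\<^sub>v h) [0, 0, 0]) (rows S) @
      [join (0\<^sub>v d) (0\<^sub>v h) [0, 0, 0], join (0\<^sub>v d) (0\<^sub>v h) [0, - (2 ^ k), - (2 ^ k)],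
       join (0\<^sub>v d) (0\<^sub>v h) [0, 1, 1]]) \<subseteq> carrier_vec (d + h + 3)"
    unfolding set_append set_map Un_subset_iff image_subset_iff list.set insert_subset
    by (intro conjI ballI join_carrier empty_subsetI zero_carrier_vec subsetD[OF set_rows_carrier[OF S]])
  show ?thesis
    unfolding sep_mat_def mat_of_rows_code[OF c]
    by (simp add: vec_rows_out_def rows_out_def zero_row_out_def rows_code_append vec_code_join_zero mat_code_def
        vec_code_zero enc_rat_0 enc_rat_1 enc_rat_neg_pow o_def) (simp add: rows_code_def enc_rat_code o_def)
qed

lemma enc_one_mat: "enc_mat (1\<^sub>m d) = id_out d"
proof -
  have u: "vec_code (unit_vec d i) = zs i @ one_entry @ zs (d - Suc i)" if "i < d" for i
  proof -
    have "list_of_vec (unit_vec d i) = replicate i 0 @ (1 :: rat) # replicate (d - Suc i) 0"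
      by (rule nth_equalityI) (use that in \<open>auto simp: list_of_vec_index nth_append nth_Cons split: nat.splits\<close>)
    then show ?thesis by (simp add: vec_code_def zs_def enc_rat_0 enc_rat_1)
  qed
  have "rows (1\<^sub>m d :: rat mat) = map (unit_vec d) [0..<d]"
    by (rule nth_equalityI) auto
  then show ?thesis
    unfolding enc_mat_code mat_code_def rows_code_def id_out_def
    by (auto simp: o_def u intro!: arg_cong[of _ _ concat])
qed

lemma enc_pow_vec:
  "enc_vec (pow_vec d e g) = concat (map (\<lambda>j. pow_entry (e + Suc j * g)) [0..<d]) @ [6]"
proof -
  have "list_of_vec (pow_vec d e g) = map (\<lambda>j. 2 ^ (e + Suc j * g)) [0..<d]"
    by (rule nth_equalityI) (simp_all add: pow_vec_def list_of_vec_index)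
  then show ?thesis by (simp add: enc_vec_def o_def enc_rat_pow del: mult_Suc)
qed

section \<open>The two reductions\<close>

lemma encode_VEST_in:
  "encode_pair VEST x k = vest_in k (map rat_code (list_of_vec (vest_v x))) (map mat_code (vest_T x)) (mat_code (vest_S x))"
  by (simp add: encode_pair_def VEST_def vest_in_def enc_unary_def enc_vec_entries enc_mats_code enc_mat_code)

text \<open>The new list depends on the parameter through the entries \<open>- (2 ^ k)\<close> of
  the separator; their length is linear in \<open>k\<close>, which the input contains in
  unary.\<close>

definition zp_of_vest :: "nat \<Rightarrow> vest \<Rightarrow> nat \<times> rat mat list" where
  "zp_of_vest k x = (vest_d x + vest_h x + 3, map (ext_mat (vest_d x) (vest_h x)) (vest_T x) @
     [sep_mat k (vest_d x) (vest_h x) (vest_v x) (vest_S x)])"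

lemma encode_zp_of_vest:
  assumes "vest_instance x"
  shows "encode_pair ZERO_PRODUCT (zp_of_vest k x) (k + 2) =
    vest_out k (map rat_code (list_of_vec (vest_v x))) (map mat_code (vest_T x)) (mat_code (vest_S x))"
proof -
  have x: "vest_v x \<in> carrier_vec (vest_d x)" "set (vest_T x) \<subseteq> carrier_mat (vest_d x) (vest_d x)"
    "vest_S x \<in> carrier_mat (vest_h x) (vest_d x)" using assms by (auto simp: vest_instance_def)
  have l: "length (list_of_vec (vest_v x)) = vest_d x" "length (mat_code (vest_S x)) = vest_h x"
    using x by (auto simp: mat_code_def)
  have m: "concat (map enc_mat (map (ext_mat (vest_d x) (vest_h x)) (vest_T x))) =
      mats_out (vest_d x) (vest_h x) (map mat_code (vest_T x))"
  proof -
    have "enc_mat (ext_mat (vest_d x) (vest_h x) A) = mat_out (vest_d x) (vest_h x) (mat_code A)"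
      if "A \<in> set (vest_T x)" for A by (rule enc_ext_mat) (use x(2) that in blast)
    then show ?thesis unfolding mats_out_def by (auto simp: o_def intro!: arg_cong[of _ _ concat])
  qed
  have r: "replicate (n + 3) 2 @ [9] = replicate n 2 @ [2, 2, 2, 9 :: nat]"
    "replicate (n + 2) 2 @ [9] = replicate n 2 @ [2, 2, 9 :: nat]" for n
    unfolding replicate_add by (simp_all add: numeral_3_eq_3 numeral_2_eq_2)
  have "encode_pair ZERO_PRODUCT (zp_of_vest k x) (k + 2) =
      (replicate (k + 2) 2 @ [9]) @ (replicate (vest_d x + vest_h x + 3) 2 @ [9]) @
      concat (map enc_mat (map (ext_mat (vest_d x) (vest_h x)) (vest_T x))) @
      enc_mat (sep_mat k (vest_d x) (vest_h x) (vest_v x) (vest_S x)) @ [8]"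
    by (simp add: encode_pair_def ZERO_PRODUCT_def zp_of_vest_def enc_unary_def enc_mats_def del: replicate_Suc)
  also have "\<dots> = vest_out k (map rat_code (list_of_vec (vest_v x))) (map mat_code (vest_T x)) (mat_code (vest_S x))"
    unfolding r m enc_sep_mat[OF x(1,3)] vest_out_def Let_def length_map l by (simp add: replicate_add)
  finally show ?thesis .
qed

text \<open>As \<open>n \<ge> 2\<close>, a constant of at most \<open>2 ^ 11\<close> is absorbed by
  \<open>n ^ 11\<close>; together with degree at most 4 this gives the exponent 15, which suits both
  machines.\<close>

lemma fpt_time:
  fixes n :: nat
  assumes "2 \<le> n" "a \<le> 2 ^ 11" "e \<le> 4"
  shows "a * n ^ e \<le> (k + 2) * n ^ 15"
proof -
  have "a \<le> n ^ 11" using assms(2) power_mono[OF assms(1), of 11] by linarith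
  moreover have "n ^ e \<le> n ^ 4" using assms by (intro power_increasing) auto
  ultimately have "a * n ^ e \<le> n ^ 11 * n ^ 4" by (rule mult_mono) simp_all
  also have "\<dots> = n ^ 15" by (simp add: power_add[symmetric])
  also have "\<dots> \<le> (k + 2) * n ^ 15" by simp
  finally show ?thesis .
qed

lemma VEST_reducible: "fpt_reducible VEST ZERO_PRODUCT"
proof -
  let ?M = "tm_of 6 10 vest_prog"
  have wf: "wf_tm ?M" by (rule wf_tm_of[OF wf_vest_prog]) simp_all
  have "\<exists>x' k'. instance_of ZERO_PRODUCT x' \<and>
      computes_within ?M (encode_pair VEST x k) (encode_pair ZERO_PRODUCT x' k') ((k + 2) * length (encode_pair VEST x k) ^ 15) \<and>
      (yes VEST x k \<longleftrightarrow> yes ZERO_PRODUCT x' k') \<and> k' \<le> k + 2"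
    if inst: "instance_of VEST x" for x k
  proof (intro exI conjI)
    have i: "vest_instance x" using inst by (simp add: VEST_def)
    then have x: "vest_v x \<in> carrier_vec (vest_d x)" "set (vest_T x) \<subseteq> carrier_mat (vest_d x) (vest_d x)"
      "vest_S x \<in> carrier_mat (vest_h x) (vest_d x)" by (auto simp: vest_instance_def)
    show "instance_of ZERO_PRODUCT (zp_of_vest k x)"
      using x sep_mat_carrier[OF x(1,3)] by (auto simp: ZERO_PRODUCT_def zp_of_vest_def intro!: ext_mat_carrier)
    show "yes VEST x k \<longleftrightarrow> yes ZERO_PRODUCT (zp_of_vest k x) (k + 2)"
      using vest_count_pos[OF i] zero_product_sep_iff[OF x(1,3,2), of k]
      by (simp add: VEST_def ZERO_PRODUCT_def zp_of_vest_def)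
    obtain us where us: "runs vest_prog (Z [] (encode_pair VEST x k) # replicate 5 (Z [] [])) us
        (2000 * length (encode_pair VEST x k) ^ 3)"
      "us ! 1 = Z (encode_pair ZERO_PRODUCT (zp_of_vest k x) (k + 2)) []"
    proof -
      have "\<forall>y\<in>set (map rat_code (list_of_vec (vest_v x))). set y \<subseteq> {1..4}" using set_rat_code by auto
      moreover have m: "\<forall>r\<in>set (mat_code A). set r \<subseteq> {1..5}" for A using set_vec_code by (auto simp: mat_code_def)
      then have "\<forall>ra\<in>set (map mat_code (vest_T x)). \<forall>r\<in>set ra. set r \<subseteq> {1..5}" by simp
      ultimately show thesis
        using runs_vest_prog[OF _ _ m refl] that unfolding encode_VEST_in encode_zp_of_vest[OF i] by blast
    qed
    have "2 \<le> length (encode_pair VEST x k)" by (simp add: encode_VEST_in vest_in_def)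
    then have t: "2000 * length (encode_pair VEST x k) ^ 3 \<le> (k + 2) * length (encode_pair VEST x k) ^ 15"
      by (rule fpt_time) simp_all
    show "computes_within ?M (encode_pair VEST x k) (encode_pair ZERO_PRODUCT (zp_of_vest k x) (k + 2))
        ((k + 2) * length (encode_pair VEST x k) ^ 15)"
      by (rule computes_within_tm_of[OF _ us(2) _ t])
        (use us(1) set_encode_VEST set_encode_ZERO_PRODUCT in simp_all)
  qed simp
  then show ?thesis unfolding fpt_reducible_def using wf computable_add_2 by blast
qed

lemma encode_ZERO_PRODUCT_in: "encode_pair ZERO_PRODUCT (d, As) k = zp_in k d (concat (map enc_mat As))"
  by (simp add: encode_pair_def ZERO_PRODUCT_def zp_in_def enc_unary_def enc_mats_def)

lemma encode_vest_of_zp: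
  "encode_pair VEST (vest_of_zp (Suc k) (Suc k * (length (encode_pair ZERO_PRODUCT (d, As) k) * 2)) d As) k =
    zp_out k d (concat (map enc_mat As))"
  unfolding encode_ZERO_PRODUCT_in
  by (simp add: encode_pair_def VEST_def vest_of_zp_def zp_out_def Let_def enc_unary_def enc_mats_def
      enc_pow_vec enc_one_mat del: mult_Suc)

lemma ZERO_PRODUCT_reducible: "fpt_reducible ZERO_PRODUCT VEST"
proof -
  let ?M = "tm_of 6 10 zp_prog"
  have wf: "wf_tm ?M" by (rule wf_tm_of[OF wf_zp_prog]) simp_all
  have "\<exists>x' k'. instance_of VEST x' \<and>
      computes_within ?M (encode_pair ZERO_PRODUCT x k) (encode_pair VEST x' k') ((k + 2) * length (encode_pair ZERO_PRODUCT x k) ^ 15) \<and>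
      (yes ZERO_PRODUCT x k \<longleftrightarrow> yes VEST x' k') \<and> k' \<le> k + 2"
    if inst: "instance_of ZERO_PRODUCT x" for x k
  proof -
    obtain d As where x: "x = (d, As)" by fastforce
    have d: "d \<ge> 1" and As: "set As \<subseteq> carrier_mat d d" using inst by (simp_all add: ZERO_PRODUCT_def x)
    define n where "n = length (encode_pair ZERO_PRODUCT (d, As) k)"
    define g where "g = Suc k * (n * 2)"
    define y where "y = vest_of_zp (Suc k) g d As"
    have out: "encode_pair VEST y k = zp_out k d (concat (map enc_mat As))"
      unfolding y_def g_def n_def by (rule encode_vest_of_zp)
    have n: "n = k + d + length (enc_mats As) + 2"
      by (simp add: n_def encode_ZERO_PRODUCT_in zp_in_def enc_mats_def)
    have g: "(d + 2 * length (enc_mats As)) * k < g"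
    proof -
      \<comment> \<open>The input length \<open>n\<close> contains \<open>d\<close> and the length
        of the matrix list, so \<open>2 * n\<close> dominates
        \<open>d + 2 * length (enc_mats As)\<close>; the inequality becomes strict because
        \<open>g\<close> has the factor \<open>Suc k\<close> in place of \<open>k\<close>.\<close>
      have "(d + 2 * length (enc_mats As)) * k \<le> (n * 2) * k" unfolding n by (intro mult_right_mono) simp_all
      also have "\<dots> < g" unfolding g_def using n by simp
      finally show ?thesis .
    qed
    obtain us where us: "runs zp_prog (Z [] (encode_pair ZERO_PRODUCT x k) # replicate 5 (Z [] [])) us (400 * n ^ 4)"
      "us ! 1 = Z (encode_pair VEST y k) []"
    proof -
      have "set (concat (map enc_mat As)) \<subseteq> {1..7}" using set_enc_mat by (auto simp del: One_nat_def)
      from runs_zp_prog[OF this d refl, of k] show thesis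
        using that unfolding out x n_def encode_ZERO_PRODUCT_in by blast
    qed
    have t: "400 * n ^ 4 \<le> (k + 2) * length (encode_pair ZERO_PRODUCT x k) ^ 15"
      unfolding x n_def[symmetric] by (rule fpt_time) (simp_all add: n)
    have "computes_within ?M (encode_pair ZERO_PRODUCT x k) (encode_pair VEST y k)
        ((k + 2) * length (encode_pair ZERO_PRODUCT x k) ^ 15)"
      by (rule computes_within_tm_of[OF _ us(2) _ t])
        (use us(1) set_encode_VEST set_encode_ZERO_PRODUCT in simp_all)
    moreover have "instance_of VEST y"
      using vest_of_zp_instance[OF d As] by (simp add: VEST_def y_def)
    moreover have "yes ZERO_PRODUCT x k \<longleftrightarrow> yes VEST y k"
      using vest_of_zp_yes[OF d As g] by (simp add: VEST_def ZERO_PRODUCT_def x y_def)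
    ultimately show ?thesis by (intro exI[of _ y] exI[of _ k]) simp
  qed
  then show ?thesis unfolding fpt_reducible_def using wf computable_add_2 by blast
qed

theorem theorem10:
  shows "fpt_reducible VEST ZERO_PRODUCT \<and> fpt_reducible ZERO_PRODUCT VEST"
  using VEST_reducible ZERO_PRODUCT_reducible by simp

end
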